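(* Let $d\geq 3$, let $c\in\mathbb{R}$, $c\neq 0$, satisfy $c<\lambda(d):=\left(\frac{d-2}{2}\right)^2$, let $\frac{4}{d}<\alpha<\frac{4}{d-2}$ and $\omega>0$. Then the set $\mathcal{G}_{\mathrm{rad},\omega}$ of radial ground states is not empty, and it is characterized by $$\mathcal{G}_{\mathrm{rad},\omega}=\left\{v\in H^1_{\mathrm{rad}}\setminus\{0\}\ :\ S_\omega(v)=d(\mathrm{rad},\omega),\ K_\omega(v)=0\right\},$$ where $$K_\omega(v):=\left.\partial_\lambda S_\omega(\lambda v)\right|_{\lambda=1}=\|v\|^2_{\dot H^1_c}+\omega\|v\|^2_{L^2}-\|v\|^{\alpha+2}_{L^{\alpha+2}}$$ is the Nehari functional and $$d(\mathrm{rad},\omega):=\inf\left\{S_\omega(v)\ :\ v\in H^1_{\mathrm{rad}}\setminus\{0\},\ K_\omega(v)=0\right\}.$$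
   Context: All functions are complex-valued on $\mathbb{R}^d$; $H^1=H^1(\mathbb{R}^d)$ and $H^1_{\mathrm{rad}}$ is the subspace of radial functions in $H^1$. Set $\|v\|^2_{\dot H^1_c}:=\|\nabla v\|^2_{L^2}-c\||x|^{-1}v\|^2_{L^2}$ and define the action functional on $H^1$ by $$S_\omega(v):=\frac12\|v\|^2_{\dot H^1_c}+\frac{\omega}{2}\|v\|^2_{L^2}-\frac{1}{\alpha+2}\|v\|^{\alpha+2}_{L^{\alpha+2}}.$$ The condition $S_\omega'(v)=0$ means that $v\in H^1$ is a (weak) solution of the elliptic equation $-\Delta v+\omega v-c|x|^{-2}v-|v|^\alpha v=0$. Let $\mathcal{A}_{\mathrm{rad},\omega}:=\{v\in H^1_{\mathrm{rad}}\setminus\{0\}: S'_\omega(v)=0\}$. The set of radial ground states is $$\mathcal{G}_{\mathrm{rad},\omega}:=\{\phi\in\mathcal{A}_{\mathrm{rad},\omega}: S_\omega(\phi)\leq S_\omega(v)\ \text{for all } v\in\mathcal{A}_{\mathrm{rad},\omega}\}.$$ *)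

theory Defs
  imports "HOL-Analysis.Analysis"
begin

text \<open>
  The space \<open>\<real>\<^sup>d\<close> is \<open>real ^ 'n\<close> with \<open>d = CARD('n)\<close>. Elements of the
  Lebesgue and Sobolev spaces are represented by measurable functions rather than by classes
  modulo almost-everywhere equality; all notions below are invariant under changing a function
  on a null set, and being nonzero means not vanishing almost everywhere.
\<close>

definition Lp_space :: "real \<Rightarrow> (real ^ 'n \<Rightarrow> 'b::euclidean_space) set" where
  "Lp_space p = {f \<in> borel_measurable lebesgue. integrable lebesgue (\<lambda>x. norm (f x) powr p)}"

definition Lp_norm :: "real \<Rightarrow> (real ^ 'n \<Rightarrow> 'b::euclidean_space) \<Rightarrow> real" where
  "Lp_norm p f = (LINT x|lebesgue. norm (f x) powr p) powr (1 / p)"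

definition pdiff :: "'n \<Rightarrow> (real ^ 'n \<Rightarrow> real) \<Rightarrow> real ^ 'n \<Rightarrow> real" where
  "pdiff i f x = frechet_derivative f (at x) (axis i 1)"

primrec Ck :: "nat \<Rightarrow> (real ^ 'n \<Rightarrow> real) \<Rightarrow> bool" where
  "Ck 0 f \<longleftrightarrow> continuous_on UNIV f"
| "Ck (Suc k) f \<longleftrightarrow> f differentiable_on UNIV \<and> (\<forall>i. Ck k (pdiff i f))"

definition test_functions :: "(real ^ 'n \<Rightarrow> real) set" where
  "test_functions = {\<phi>. (\<forall>k. Ck k \<phi>) \<and> compact (closure {x. \<phi> x \<noteq> 0})}"

definition has_weak_gradient ::
    "(real ^ 'n \<Rightarrow> complex) \<Rightarrow> (real ^ 'n \<Rightarrow> complex ^ 'n) \<Rightarrow> bool" where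
  "has_weak_gradient v g \<longleftrightarrow>
     (\<forall>\<phi>\<in>test_functions. \<forall>i.
        (LINT x|lebesgue. pdiff i \<phi> x *\<^sub>R v x) = - (LINT x|lebesgue. \<phi> x *\<^sub>R (g x $ i)))"

definition H1 :: "(real ^ 'n \<Rightarrow> complex) set" where
  "H1 = {v \<in> Lp_space 2. \<exists>g\<in>Lp_space 2. has_weak_gradient v g}"

text \<open>For \<open>v \<in> H1\<close> the weak gradient is unique up to null sets.\<close>

definition weak_gradient :: "(real ^ 'n \<Rightarrow> complex) \<Rightarrow> real ^ 'n \<Rightarrow> complex ^ 'n" where
  "weak_gradient v = (SOME g. g \<in> Lp_space 2 \<and> has_weak_gradient v g)"

definition H1_rad :: "(real ^ 'n \<Rightarrow> complex) set" where
  "H1_rad = {v \<in> H1. \<exists>f :: real \<Rightarrow> complex. AE x in lebesgue. v x = f (norm x)}"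

definition H1_rad_nonzero :: "(real ^ 'n \<Rightarrow> complex) set" where
  "H1_rad_nonzero = {v \<in> H1_rad. \<not> (AE x in lebesgue. v x = 0)}"

text \<open>
  On \<open>H1\<close>, in dimension at least three and with \<open>\<alpha> < 4 / (d - 2)\<close>, all integrals
  below are finite, by the Hardy and Sobolev inequalities.
\<close>

definition Hc_norm_sq :: "real \<Rightarrow> (real ^ 'n \<Rightarrow> complex) \<Rightarrow> real" where
  "Hc_norm_sq c v =
     (Lp_norm 2 (weak_gradient v))\<^sup>2 - c * (Lp_norm 2 (\<lambda>x. inverse (norm x) *\<^sub>R v x))\<^sup>2"

definition action :: "real \<Rightarrow> real \<Rightarrow> real \<Rightarrow> (real ^ 'n \<Rightarrow> complex) \<Rightarrow> real" where
  "action c \<alpha> \<omega> v =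
     1 / 2 * Hc_norm_sq c v + \<omega> / 2 * (Lp_norm 2 v)\<^sup>2
       - 1 / (\<alpha> + 2) * Lp_norm (\<alpha> + 2) v powr (\<alpha> + 2)"

text \<open>
  Weak solutions of \<open>- \<Delta> v + \<omega> v - c |x|\<^sup>-\<^sup>2 v - |v|\<^sup>\<alpha> v = 0\<close>, the equation
  being understood in the dual of \<open>H1\<close>, i.e. tested against all functions in \<open>H1\<close>.
\<close>

definition weak_solution :: "real \<Rightarrow> real \<Rightarrow> real \<Rightarrow> (real ^ 'n \<Rightarrow> complex) \<Rightarrow> bool" where
  "weak_solution c \<alpha> \<omega> v \<longleftrightarrow> v \<in> H1 \<and>
     (\<forall>\<phi>\<in>H1.
        (\<Sum>i\<in>UNIV. LINT x|lebesgue. weak_gradient v x $ i * cnj (weak_gradient \<phi> x $ i))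
        + complex_of_real \<omega> * (LINT x|lebesgue. v x * cnj (\<phi> x))
        - complex_of_real c * (LINT x|lebesgue. inverse ((norm x)\<^sup>2) *\<^sub>R (v x * cnj (\<phi> x)))
        - (LINT x|lebesgue. (norm (v x) powr \<alpha>) *\<^sub>R (v x * cnj (\<phi> x))) = 0)"

definition A_rad :: "real \<Rightarrow> real \<Rightarrow> real \<Rightarrow> (real ^ 'n \<Rightarrow> complex) set" where
  "A_rad c \<alpha> \<omega> = {v \<in> H1_rad_nonzero. weak_solution c \<alpha> \<omega> v}"

definition G_rad :: "real \<Rightarrow> real \<Rightarrow> real \<Rightarrow> (real ^ 'n \<Rightarrow> complex) set" where
  "G_rad c \<alpha> \<omega> =
     {\<phi> \<in> A_rad c \<alpha> \<omega>. \<forall>v\<in>(A_rad c \<alpha> \<omega> :: (real ^ 'n \<Rightarrow> complex) set). action c \<alpha> \<omega> \<phi> \<le> action c \<alpha> \<omega> v}"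

definition nehari :: "real \<Rightarrow> real \<Rightarrow> real \<Rightarrow> (real ^ 'n \<Rightarrow> complex) \<Rightarrow> real" where
  "nehari c \<alpha> \<omega> v = deriv (\<lambda>l::real. action c \<alpha> \<omega> (\<lambda>x. l *\<^sub>R v x)) 1"

text \<open>The type argument fixes the dimension, which the remaining arguments do not determine.\<close>

definition d_rad :: "'n::finite itself \<Rightarrow> real \<Rightarrow> real \<Rightarrow> real \<Rightarrow> real" where
  "d_rad _ c \<alpha> \<omega> =
     Inf {action c \<alpha> \<omega> v | v :: real ^ 'n \<Rightarrow> complex. v \<in> H1_rad_nonzero \<and> nehari c \<alpha> \<omega> v = 0}"

end

(* For a function v of H1 with weak gradient g one has v(x) = - int_1^oo x.g(tx) dt for almost
   every x: testing against psi, dilating and integrating by parts turns the right-hand side into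
   int v(y) (int_1^oo t^(-d-1) div(x psi)(y/t) dt) dy, and the inner integral is psi(y) because its
   integrand is the t-derivative of - t^(-d) psi(y/t).  Cauchy-Schwarz in t with weight t^(d/2) gives
   Hardy's inequality with the sharp constant, and averaging the formula over spheres shows that
   the spherical mean of v is r |-> - int_r^oo G with G the spherical mean of the radial derivative.
   A radial v is thus the same thing as a profile G on the half-line, and the problem becomes one
   dimensional.  There G bounds v by r^(-(d-2)/2) near 0 and by r^(-(d-1)/2) at infinity; as
   2d/(d-1) < 2 + 4/d < alpha + 2 < 2d/(d-2), these bounds dominate |v|^(alpha+2), so a minimizing
   sequence of the energy E under the constraint ||v||_(alpha+2) = 1 has a subsequence converging
   pointwise and in L^(alpha+2).  The parallelogram identity for E makes it a Cauchy sequence in H1.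
   The minimizer satisfies the Euler-Lagrange equation against radial test functions, hence against
   all of H1 since only the spherical means of the test function matter. *)
theory Submission
  imports Defs "HOL-Probability.Probability_Measure" "HOL-Complex_Analysis.Great_Picard"
begin

section \<open>Smooth test functions\<close>

text \<open>The least action is found by homogeneity: E has degree 2, and N, the power alpha + 2 of
  the L^(alpha+2) norm, has degree alpha + 2. If m is the minimum of E under N = 1, every nonzero
  profile with E = N has N at least m^((alpha+2)/alpha), and a multiple of the minimizer attains
  this. On the Nehari set the action is (1/2 - 1/(alpha+2)) N, so this value of N determines the
  infimum; a nonzero radial weak solution lies in that set because it may be tested against itself.
  The Cauchy property comes from midpoints: the midpoint of two late members nearly satisfies the
  constraint, so its energy cannot lie much below m, which leaves no energy for the half-difference.
  N is never differentiated. Convexity of |z|^(alpha+2) bounds N from below by an affine function on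
  each line, and differentiating the explicit expression that results gives the Euler-Lagrange
  equation. The ray formula comes first because a weak gradient is known only through test
  functions, while the compactness argument needs values at single radii.\<close>

lemma pdiff_eqI: "(f has_derivative D) (at x) \<Longrightarrow> pdiff i f x = D (axis i 1)"
  unfolding pdiff_def using frechet_derivative_at by fastforce

lemma has_derivative_pdiff:
  fixes f :: "real ^ 'n \<Rightarrow> real"
  assumes "f differentiable (at x)"
  shows "(f has_derivative (\<lambda>h. \<Sum>i\<in>UNIV. h $ i * pdiff i f x)) (at x)"
proof -
  have D: "(f has_derivative frechet_derivative f (at x)) (at x)"
    using assms frechet_derivative_works by blast
  interpret linear "frechet_derivative f (at x)"
    using D has_derivative_linear by blast
  have "frechet_derivative f (at x) = (\<lambda>h. \<Sum>i\<in>UNIV. h $ i * pdiff i f x)"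
  proof
    fix h :: "real ^ 'n"
    have "h = (\<Sum>i\<in>UNIV. h $ i *\<^sub>R axis i 1)"
      by (metis (no_types) basis_expansion scalar_mult_eq_scaleR)
    then have "frechet_derivative f (at x) h = frechet_derivative f (at x) (\<Sum>i\<in>UNIV. h $ i *\<^sub>R axis i 1)"
      by simp
    then show "frechet_derivative f (at x) h = (\<Sum>i\<in>UNIV. h $ i * pdiff i f x)"
      by (simp add: sum scale pdiff_def)
  qed
  with D show ?thesis by simp
qed

lemma Ck_differentiable: "Ck (Suc k) f \<Longrightarrow> f differentiable (at x)"
  by (simp add: differentiable_on_def)

lemma Ck_SucD: "Ck (Suc k) f \<Longrightarrow> Ck k f"
  by (induction k arbitrary: f) (auto simp: differentiable_imp_continuous_on)

lemma Ck_SucI: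
  assumes "\<And>x. (f has_derivative D x) (at x)" "\<And>i. Ck k (\<lambda>x. D x (axis i 1))"
  shows "Ck (Suc k) f"
proof -
  have "pdiff i f = (\<lambda>x. D x (axis i 1))" for i
    using assms(1) pdiff_eqI by blast
  moreover have "f differentiable_on UNIV"
    using assms(1) by (auto simp: differentiable_on_def differentiable_def)
  ultimately show ?thesis using assms(2) by simp
qed

lemma Ck_const: "Ck k (\<lambda>_. c)"
proof (induction k arbitrary: c)
  case (Suc k) show ?case
    by (rule Ck_SucI[OF has_derivative_const]) (rule Suc)
qed simp

lemma Ck_nth: "Ck k (\<lambda>x. x $ j)"
proof (cases k)
  case (Suc k') show ?thesis unfolding Suc
    by (rule Ck_SucI[OF bounded_linear_imp_has_derivative[OF bounded_linear_vec_nth]]) (rule Ck_const)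
qed (auto intro: continuous_intros)

lemma sum_axis_mult: "(\<Sum>j\<in>UNIV. axis i (1::real) $ j * f j) = f i"
  by (simp add: axis_def if_distrib[of "\<lambda>t. t * _"] cong: if_cong)

lemma Ck_add: "Ck k f \<Longrightarrow> Ck k g \<Longrightarrow> Ck k (\<lambda>x. f x + g x)"
proof (induction k arbitrary: f g)
  case (Suc k)
  have D: "((\<lambda>x. f x + g x) has_derivative
      (\<lambda>h. (\<Sum>i\<in>UNIV. h $ i * pdiff i f x) + (\<Sum>i\<in>UNIV. h $ i * pdiff i g x))) (at x)" for x
    by (intro has_derivative_add has_derivative_pdiff Ck_differentiable[OF Suc.prems(1)] Ck_differentiable[OF Suc.prems(2)])
  have "Ck k (\<lambda>x. pdiff i f x + pdiff i g x)" for i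
    using Suc.prems by (intro Suc.IH) auto
  then show ?case
    by (intro Ck_SucI[OF D]) (simp add: sum_axis_mult)
qed (auto intro: continuous_intros)

lemma Ck_mult: "Ck k f \<Longrightarrow> Ck k g \<Longrightarrow> Ck k (\<lambda>x. f x * g x)"
proof (induction k arbitrary: f g)
  case (Suc k)
  have D: "((\<lambda>x. f x * g x) has_derivative
      (\<lambda>h. f x * (\<Sum>i\<in>UNIV. h $ i * pdiff i g x) + (\<Sum>i\<in>UNIV. h $ i * pdiff i f x) * g x)) (at x)" for x
    by (intro has_derivative_mult has_derivative_pdiff Ck_differentiable[OF Suc.prems(1)] Ck_differentiable[OF Suc.prems(2)])
  have "Ck k (\<lambda>x. f x * pdiff i g x + pdiff i f x * g x)" for i
    using Suc.prems Ck_SucD[OF Suc.prems(1)] Ck_SucD[OF Suc.prems(2)] by (intro Ck_add Suc.IH) auto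
  then show ?case
    by (intro Ck_SucI[OF D]) (simp add: sum_axis_mult)
qed (auto intro: continuous_intros)

lemma Ck_scale: "Ck k f \<Longrightarrow> Ck k (\<lambda>x. f (s *\<^sub>R x))"
proof (induction k arbitrary: f)
  case 0 then show ?case
    by (auto intro!: continuous_on_compose2[of UNIV f] continuous_intros)
next
  case (Suc k)
  have "((\<lambda>x. s *\<^sub>R x) has_derivative (\<lambda>h. s *\<^sub>R h)) (at x)" for x :: "real ^ 'a"
    by (auto intro!: derivative_eq_intros)
  from has_derivative_compose[OF this has_derivative_pdiff[OF Ck_differentiable[OF Suc.prems]]]
  have D: "((\<lambda>x. f (s *\<^sub>R x)) has_derivative (\<lambda>h. \<Sum>i\<in>UNIV. h $ i * (s * pdiff i f (s *\<^sub>R x)))) (at x)" for x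
    by (simp add: mult.assoc mult.left_commute[of s])
  have "Ck k (\<lambda>x. s * pdiff i f (s *\<^sub>R x))" for i
    using Suc.prems by (intro Ck_mult Ck_const Suc.IH) auto
  then show ?case
    by (intro Ck_SucI[OF D]) (simp add: sum_axis_mult)
qed

lemma Ck_prod: "(\<And>j. j \<in> J \<Longrightarrow> Ck k (f j)) \<Longrightarrow> Ck k (\<lambda>x. \<Prod>j\<in>J. f j x)"
  by (induction J rule: infinite_finite_induct) (auto simp: Ck_const Ck_mult)

section \<open>Smooth bumps from the flat function exp(-1/t)\<close>

definition cutoff :: "nat \<Rightarrow> real \<Rightarrow> real" where
  "cutoff m t = (if t > 0 then exp (- (1 / t)) / t ^ m else 0)"

lemma cutoff_tendsto: "((\<lambda>t. exp (- (1 / t)) / t ^ m) \<longlongrightarrow> 0) (at_right (0::real))"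
proof -
  have "((\<lambda>t. inverse t ^ m / exp (inverse t)) \<longlongrightarrow> 0) (at_right (0::real))"
    by (rule filterlim_compose[OF tendsto_power_div_exp_0 filterlim_inverse_at_top_right])
  then show ?thesis
    by (simp add: exp_minus field_simps)
qed

text \<open>The powers of 1/t in \<open>cutoff\<close> serve this closure property: differentiation
  stays within the span of the family, so smoothness of all members follows by one induction on the
  order.\<close>

lemma cutoff_deriv:
  "(cutoff m has_real_derivative cutoff (m + 2) t - real m * cutoff (Suc m) t) (at t)"
proof -
  consider "t > 0" | "t < 0" | "t = 0" by linarith
  then show ?thesis
  proof cases
    case 1
    have "((\<lambda>t. exp (- (1 / t)) / t ^ m) has_real_derivative cutoff (m + 2) t - real m * cutoff (Suc m) t) (at t)"
      using 1 by (auto intro!: derivative_eq_intros simp: cutoff_def field_simps power2_eq_square)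
        (cases m; simp add: field_simps)
    then show ?thesis
      by (rule has_field_derivative_transform_within_open[of _ _ _ "{0<..}"])
         (use 1 in \<open>auto simp: cutoff_def\<close>)
  next
    case 2
    have "((\<lambda>t::real. 0) has_real_derivative cutoff (m + 2) t - real m * cutoff (Suc m) t) (at t)"
      using 2 by (auto simp: cutoff_def)
    then show ?thesis
      by (rule has_field_derivative_transform_within_open[of _ _ _ "{..<0}"])
         (use 2 in \<open>auto simp: cutoff_def\<close>)
  next
    case 3
    \<comment> \<open>From the right the difference quotient at 0 is the expression of
      \<open>cutoff_tendsto\<close> with exponent \<open>Suc m\<close>; from the left it
      vanishes.\<close>
    have "((\<lambda>h. (cutoff m (0 + h) - cutoff m 0) / h) \<longlongrightarrow> 0) (at_right 0)"
      by (rule Lim_transform_eventually[OF cutoff_tendsto[of "Suc m"]])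
         (auto simp: eventually_at_filter cutoff_def)
    moreover have "((\<lambda>h. (cutoff m (0 + h) - cutoff m 0) / h) \<longlongrightarrow> 0) (at_left 0)"
      by (rule Lim_transform_eventually[OF tendsto_const])
         (auto simp: eventually_at_filter cutoff_def)
    ultimately have "((\<lambda>h. (cutoff m (0 + h) - cutoff m 0) / h) \<longlongrightarrow> 0) (at 0)"
      using filterlim_split_at by blast
    then show ?thesis unfolding 3 DERIV_def by (simp add: cutoff_def)
  qed
qed

lemma Ck_cutoff: "Ck k f \<Longrightarrow> Ck k (\<lambda>x. cutoff m (f x))"
proof (induction k arbitrary: m)
  case 0
  have "continuous_on UNIV (cutoff m)"
    using cutoff_deriv by (intro DERIV_continuous_on) auto
  with 0 show ?case by (auto intro!: continuous_on_compose2[of UNIV "cutoff m"])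
next
  case (Suc k)
  have D: "((\<lambda>x. cutoff m (f x)) has_derivative
      (\<lambda>h. (cutoff (m + 2) (f x) - real m * cutoff (Suc m) (f x)) * (\<Sum>i\<in>UNIV. h $ i * pdiff i f x))) (at x)" for x
    using has_derivative_compose[OF has_derivative_pdiff[OF Ck_differentiable[OF Suc.prems]]
      cutoff_deriv[unfolded has_field_derivative_def]] .
  have "Ck k (\<lambda>x. (cutoff (m + 2) (f x) + (- real m) * cutoff (Suc m) (f x)) * pdiff i f x)" for i
    using Suc.prems Suc.IH[OF Ck_SucD[OF Suc.prems]] by (intro Ck_mult Ck_add Ck_const) auto
  then show ?case
    by (intro Ck_SucI[OF D]) (simp add: sum_axis_mult)
qed

lemma test_functions_iff: "\<phi> \<in> test_functions \<longleftrightarrow> (\<forall>k. Ck k \<phi>) \<and> bounded {x. \<phi> x \<noteq> 0}"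
  by (simp add: test_functions_def compact_closure)

lemma test_functions_mult: "\<phi> \<in> test_functions \<Longrightarrow> (\<And>k. Ck k f) \<Longrightarrow> (\<lambda>x. f x * \<phi> x) \<in> test_functions"
  by (auto simp: test_functions_iff Ck_mult intro: bounded_subset)

lemma test_functions_scale:
  assumes "\<phi> \<in> test_functions" "s \<noteq> 0"
  shows "(\<lambda>x. \<phi> (s *\<^sub>R x)) \<in> test_functions"
proof -
  obtain B where B: "\<And>x. \<phi> x \<noteq> 0 \<Longrightarrow> norm x \<le> B"
    using assms by (auto simp: test_functions_iff bounded_iff)
  have "norm x \<le> B / \<bar>s\<bar>" if "\<phi> (s *\<^sub>R x) \<noteq> 0" for x
    using B[OF that] assms by (simp add: field_simps)
  then show ?thesis
    using assms by (auto simp: test_functions_iff Ck_scale bounded_iff)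
qed

lemma test_functions_differentiable: "\<phi> \<in> test_functions \<Longrightarrow> \<phi> differentiable (at x)"
  using Ck_differentiable test_functions_iff by blast

lemma test_functions_pdiff:
  fixes \<phi> :: "real ^ 'n \<Rightarrow> real"
  assumes "\<phi> \<in> test_functions"
  shows "pdiff i \<phi> \<in> test_functions"
proof -
  obtain B where B: "\<And>x. \<phi> x \<noteq> 0 \<Longrightarrow> norm x \<le> B"
    using assms by (auto simp: test_functions_iff bounded_iff)
  have "pdiff i \<phi> x = 0" if "norm x > B" for x
  proof -
    have "((\<lambda>x. 0) has_derivative (\<lambda>h. 0)) (at x)" by simp
    then have "(\<phi> has_derivative (\<lambda>h. 0)) (at x)"
      by (rule has_derivative_transform_within_open[of _ _ _ _ "{x. norm x > B}"])
         (use that B in \<open>force intro!: open_Collect_less continuous_intros\<close>)+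
    then show ?thesis by (rule pdiff_eqI)
  qed
  then have "bounded {x. pdiff i \<phi> x \<noteq> 0}"
    by (auto simp: bounded_iff intro!: exI[of _ B]) (meson not_less)
  moreover have "Ck k (pdiff i \<phi>)" for k
    using assms Ck.simps(2)[of k \<phi>] by (auto simp: test_functions_iff)
  ultimately show ?thesis by (auto simp: test_functions_iff)
qed

lemma test_functions_continuous: "\<phi> \<in> test_functions \<Longrightarrow> continuous_on UNIV \<phi>"
  by (metis Ck.simps(1) test_functions_iff)

lemma test_functions_borel [measurable_dest]: "\<phi> \<in> test_functions \<Longrightarrow> \<phi> \<in> borel_measurable borel"
  by (simp add: borel_measurable_continuous_onI test_functions_continuous)

lemma test_functions_bound:
  fixes \<phi> :: "real ^ 'n \<Rightarrow> real"
  assumes "\<phi> \<in> test_functions"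
  obtains B R where "0 < B" "0 < R" "\<And>x. \<bar>\<phi> x\<bar> \<le> B * indicator (ball 0 R) x"
proof -
  obtain R0 where R0: "\<And>x. \<phi> x \<noteq> 0 \<Longrightarrow> norm x \<le> R0"
    using assms by (auto simp: test_functions_iff bounded_iff)
  define R where "R = \<bar>R0\<bar> + 1"
  have "compact (\<phi> ` cball 0 R)"
    by (intro compact_continuous_image) (auto intro: continuous_on_subset test_functions_continuous[OF assms])
  then obtain B where B: "\<And>x. x \<in> cball 0 R \<Longrightarrow> \<bar>\<phi> x\<bar> \<le> B"
    by (force dest: compact_imp_bounded simp: bounded_iff)
  have "\<bar>\<phi> x\<bar> \<le> (\<bar>B\<bar> + 1) * indicator (ball 0 R) x" for x
  proof (cases "norm x < R")
    case True then show ?thesis using B[of x] by (auto simp: indicator_def)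
  next
    case False
    then have "\<phi> x = 0" using R0[of x] by (cases "\<phi> x = 0") (auto simp: R_def)
    then show ?thesis by (simp add: indicator_def)
  qed
  then show ?thesis by (intro that[of "\<bar>B\<bar> + 1" R]) (auto simp: R_def)
qed

text \<open>The factor \<open>real k\<close> sharpens the edges: as k grows, these functions stay
  between 0 and 1 and tend pointwise to the indicator of the box.\<close>

lemma box_bump:
  fixes a b :: "real ^ 'n"
  shows "(\<lambda>x. \<Prod>i\<in>UNIV. cutoff 0 (real k * (x $ i - a $ i)) * cutoff 0 (real k * (b $ i - x $ i))) \<in> test_functions"
    (is "?f \<in> _")
proof -
  have "?f x = 0" if x: "x \<notin> box a b" for x
  proof -
    obtain i where i: "x $ i \<le> a $ i \<or> b $ i \<le> x $ i"
      using x by (auto simp: mem_box_cart not_less)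
    then have "cutoff 0 (real k * (x $ i - a $ i)) * cutoff 0 (real k * (b $ i - x $ i)) = 0"
      by (auto simp: cutoff_def zero_less_mult_iff)
    then show ?thesis
      by (meson UNIV_I finite_class.finite_UNIV prod_zero)
  qed
  then have "bounded {x. ?f x \<noteq> 0}"
    by (intro bounded_subset[OF bounded_box[of a b]]) blast
  moreover have "Ck m (\<lambda>x. cutoff 0 (real k * (x $ i + (- a $ i))))" "Ck m (\<lambda>x. cutoff 0 (real k * (b $ i + (-1) * x $ i)))" for m i
    by (intro Ck_cutoff Ck_mult Ck_add Ck_const Ck_nth)+
  then have "Ck m ?f" for m
    by (intro Ck_prod Ck_mult) simp_all
  ultimately show ?thesis by (simp add: test_functions_iff)
qed

lemma cutoff_0_tendsto_1:
  assumes "t > 0"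
  shows "(\<lambda>k. cutoff 0 (real k * t)) \<longlonglongrightarrow> 1"
proof -
  have "(\<lambda>k. exp (- (inverse (real k) / t))) \<longlonglongrightarrow> exp (- (0 / t))"
    by (intro tendsto_intros lim_inverse_n) (use assms in auto)
  then show ?thesis
    by (rule Lim_transform_eventually[OF _ eventually_mono[OF eventually_gt_at_top[of 0]], THEN tendsto_eq_rhs])
       (use assms in \<open>auto simp: cutoff_def field_simps\<close>)
qed

lemma cutoff_0_le: "0 \<le> cutoff 0 t" "cutoff 0 t \<le> 1"
  by (auto simp: cutoff_def)

section \<open>The fundamental lemma of the calculus of variations\<close>

lemma AE_zero_if_box_integrals_zero:
  fixes h :: "'a::euclidean_space \<Rightarrow> 'b::{second_countable_topology, banach}"
  assumes I: "\<And>a b. set_integrable lborel (box a b) h"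
    and Z: "\<And>a b. (LINT x:box a b|lborel. h x) = 0"
  shows "AE x in lborel. h x = 0"
proof -
  \<comment> \<open>Cutting off at a bounded box makes the function integrable on the whole space,
    so that integrals over complements and countable unions make sense.\<close>
  define B where "B N = box (- (real N *\<^sub>R One)) (real N *\<^sub>R (One::'a))" for N
  have "AE x in lborel. indicator (B N) x *\<^sub>R h x = 0" for N
  proof (rule sigma_finite_measure.density_zero[OF sigma_finite_lborel])
    let ?f = "\<lambda>x. indicator (B N) x *\<^sub>R h x"
    show If: "integrable lborel ?f"
      using I unfolding B_def set_integrable_def by blast
    have I': "set_integrable lborel A ?f" if "A \<in> sets lborel" for A
      using integrable_mult_indicator[OF that If] by (simp add: set_integrable_def)
    fix A :: "'a set" assume "A \<in> sets lborel"
    then have A: "A \<in> sigma_sets UNIV (range (\<lambda>(a, b). box a b))"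
      by (simp add: borel_eq_box)
    \<comment> \<open>Boxes are stable under intersection and generate the Borel sets, so by
      Dynkin's theorem the vanishing of the integrals passes from boxes to all Borel sets.\<close>
    have S: "Int_stable (range (\<lambda>(a, b). box a b :: 'a set))"
      by (auto simp: Int_stable_def box_Int_box)
    have E: "sigma_sets UNIV (range (\<lambda>(a, b). box a b)) = sets (lborel :: 'a measure)"
      by (simp add: borel_eq_box)
    have "range (\<lambda>(a, b). box a b :: 'a set) \<subseteq> Pow UNIV" by simp
    from S this A
    show "set_lebesgue_integral lborel A ?f = 0"
    proof (induction rule: sigma_sets_induct_disjoint)
      case (basic A)
      then obtain a b where "A = box a b" by auto
      then obtain a' b' where "A \<inter> B N = box a' b'"
        by (auto simp: B_def box_Int_box)
      then show ?case
        using Z[of a' b'] by (simp add: set_lebesgue_integral_def indicator_inter_arith[symmetric])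
    next
      case empty show ?case by (simp add: set_lebesgue_integral_def)
    next
      case (compl A)
      have "(LINT x:A \<union> (UNIV - A)|lborel. ?f x) = (LINT x:A|lborel. ?f x) + (LINT x:UNIV - A|lborel. ?f x)"
        by (rule set_integral_Un) (use compl E in \<open>auto intro!: I'\<close>)
      moreover have "(LINT x:A \<union> (UNIV - A)|lborel. ?f x) = 0"
        using Z unfolding B_def set_lebesgue_integral_def by (simp add: Un_absorb1)
      ultimately show ?case using compl by simp
    next
      case (union A)
      have "(LINT x:(\<Union>i. A i)|lborel. ?f x) = (\<Sum>i. (LINT x:A i|lborel. ?f x))"
        by (rule lebesgue_integral_countable_add)
           (use union E in \<open>auto intro!: I' simp: disjoint_family_on_def\<close>)
      then show ?case using union by simp
    qed
  qed
  then have "AE x in lborel. \<forall>N. indicator (B N) x *\<^sub>R h x = 0"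
    unfolding AE_all_countable by blast
  then show ?thesis
  proof eventually_elim
    case (elim x)
    obtain N where N: "norm x < real N" using reals_Archimedean2 by blast
    have "x \<in> B N" unfolding B_def mem_box
      using N Basis_le_norm[of _ x] by (fastforce simp: inner_minus_left)
    with elim show ?case by (metis indicator_simps(1) scaleR_one)
  qed
qed

text \<open>The bumps of \<open>box_bump\<close> approach the indicator of a box under the majorant
  \<open>norm (h x)\<close> on that box, so dominated convergence reduces test functions to
  boxes.\<close>

lemma AE_zero_if_test_integrals_zero:
  fixes h :: "real ^ 'n \<Rightarrow> 'b::{second_countable_topology, banach}"
  assumes I: "\<And>a b. set_integrable lborel (box a b) h"
    and [measurable]: "h \<in> borel_measurable borel"
    and Z: "\<And>\<psi>. \<psi> \<in> test_functions \<Longrightarrow> (LINT x|lborel. \<psi> x *\<^sub>R h x) = 0"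
  shows "AE x in lborel. h x = 0"
proof (rule AE_zero_if_box_integrals_zero[OF I])
  fix a b :: "real ^ 'n"
  define f where "f k x = (\<Prod>i\<in>UNIV. cutoff 0 (real k * (x $ i - a $ i)) * cutoff 0 (real k * (b $ i - x $ i)))" for k x
  have T: "f k \<in> test_functions" for k
    unfolding f_def[abs_def] by (rule box_bump)
  note [measurable] = test_functions_borel[OF T]
  have f0: "f k x = 0" if x: "x \<notin> box a b" for k x
  proof -
    obtain i where i: "x $ i \<le> a $ i \<or> b $ i \<le> x $ i"
      using x by (auto simp: mem_box_cart not_less)
    then have "cutoff 0 (real k * (x $ i - a $ i)) * cutoff 0 (real k * (b $ i - x $ i)) = 0"
      by (auto simp: cutoff_def zero_less_mult_iff)
    then show ?thesis unfolding f_def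
      by (meson UNIV_I finite_class.finite_UNIV prod_zero)
  qed
  have f1: "(\<lambda>k. f k x) \<longlonglongrightarrow> indicator (box a b) x" for x
  proof (cases "x \<in> box a b")
    case True
    have "(\<lambda>k. f k x) \<longlonglongrightarrow> (\<Prod>i\<in>(UNIV::'n set). 1 * 1)" unfolding f_def
      using True by (intro tendsto_prod tendsto_mult cutoff_0_tendsto_1) (auto simp: mem_box_cart)
    with True show ?thesis by simp
  qed (simp add: f0)
  have fle: "\<bar>f k x\<bar> \<le> 1" for k x
    unfolding f_def abs_prod by (rule prod_le_1) (auto simp: cutoff_0_le abs_mult mult_le_one)
  have "(\<lambda>k. LINT x|lborel. f k x *\<^sub>R h x) \<longlonglongrightarrow> (LINT x|lborel. indicator (box a b) x *\<^sub>R h x)"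
  proof (rule integral_dominated_convergence)
    show "integrable lborel (\<lambda>x. norm (indicator (box a b) x *\<^sub>R h x))"
      using I[of a b] unfolding set_integrable_def by (rule integrable_norm)
    show "AE x in lborel. norm (f k x *\<^sub>R h x) \<le> norm (indicator (box a b) x *\<^sub>R h x)" for k
    proof (rule AE_I2)
      fix x show "norm (f k x *\<^sub>R h x) \<le> norm (indicator (box a b) x *\<^sub>R h x)"
        by (cases "x \<in> box a b") (auto simp: f0 mult_left_le_one_le fle)
    qed
    show "AE x in lborel. (\<lambda>k. f k x *\<^sub>R h x) \<longlonglongrightarrow> indicator (box a b) x *\<^sub>R h x"
      by (intro AE_I2 tendsto_intros f1)
  qed measurable
  then show "(LINT x:box a b|lborel. h x) = 0"
    by (simp add: Z[OF T] LIMSEQ_const_iff set_lebesgue_integral_def)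
qed

section \<open>Square-integrable functions and weak gradients\<close>

text \<open>The measure is a parameter because the same calculus is applied on Euclidean space, on
  the half-line with the radial weight and on the sphere.\<close>

definition L2 :: "'a measure \<Rightarrow> ('a \<Rightarrow> 'b::euclidean_space) \<Rightarrow> bool" where
  "L2 M f \<longleftrightarrow> f \<in> borel_measurable M \<and> integrable M (\<lambda>x. (norm (f x))\<^sup>2)"

definition L2sq :: "'a measure \<Rightarrow> ('a \<Rightarrow> 'b::euclidean_space) \<Rightarrow> real" where
  "L2sq M f = (LINT x|M. (norm (f x))\<^sup>2)"

definition L2inner :: "'a measure \<Rightarrow> ('a \<Rightarrow> 'b::euclidean_space) \<Rightarrow> ('a \<Rightarrow> 'b) \<Rightarrow> real" where
  "L2inner M f g = (LINT x|M. f x \<bullet> g x)"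

lemma L2_measurable [measurable_dest]: "L2 M f \<Longrightarrow> f \<in> borel_measurable M"
  and L2_integrable: "L2 M f \<Longrightarrow> integrable M (\<lambda>x. (norm (f x))\<^sup>2)"
  by (auto simp: L2_def)

lemma L2sq_nonneg: "0 \<le> L2sq M f"
  by (simp add: L2sq_def)

lemma L2_bound:
  fixes f :: "'a \<Rightarrow> 'b::euclidean_space" and g :: "'a \<Rightarrow> 'c::euclidean_space"
  assumes "L2 M f" and [measurable]: "g \<in> borel_measurable M"
    and "AE x in M. norm (g x) \<le> C * norm (f x)"
  shows "L2 M g"
proof -
  have "integrable M (\<lambda>x. (norm (g x))\<^sup>2)"
  proof (rule Bochner_Integration.integrable_bound)
    show "integrable M (\<lambda>x. C\<^sup>2 * (norm (f x))\<^sup>2)"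
      using L2_integrable[OF assms(1)] by simp
    show "AE x in M. norm ((norm (g x))\<^sup>2) \<le> norm (C\<^sup>2 * (norm (f x))\<^sup>2)"
      using assms(3)
    proof eventually_elim
      case (elim x)
      from power_mono[OF this norm_ge_zero, of 2] show ?case
        by (simp add: power_mult_distrib)
    qed
  qed measurable
  then show ?thesis by (simp add: L2_def)
qed

lemma L2_cong_AE:
  assumes "L2 M f" "g \<in> borel_measurable M" "AE x in M. f x = g x"
  shows "L2 M g"
  by (rule L2_bound[OF assms(1,2), of 1]) (use assms(3) in eventually_elim, auto)

lemma L2_integrable_norm_mult:
  fixes f :: "'a \<Rightarrow> 'b::euclidean_space" and g :: "'a \<Rightarrow> 'c::euclidean_space"
  assumes "L2 M f" "L2 M g"
  shows "integrable M (\<lambda>x. norm (f x) * norm (g x))"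
proof (rule Bochner_Integration.integrable_bound)
  note [measurable] = L2_measurable[OF assms(1)] L2_measurable[OF assms(2)]
  show "integrable M (\<lambda>x. (norm (f x))\<^sup>2 + (norm (g x))\<^sup>2)"
    using assms[THEN L2_integrable] by simp
  have "a * b \<le> a\<^sup>2 + b\<^sup>2" if "0 \<le> a" "0 \<le> b" for a b :: real
    using sum_squares_bound[of a b] mult_nonneg_nonneg[OF that] by linarith
  then show "AE x in M. norm (norm (f x) * norm (g x)) \<le> norm ((norm (f x))\<^sup>2 + (norm (g x))\<^sup>2)"
    by simp
  show "(\<lambda>x. norm (f x) * norm (g x)) \<in> borel_measurable M" by measurable
qed

lemma L2_integrable_mult_bound:
  fixes f :: "'a \<Rightarrow> 'b::euclidean_space" and g :: "'a \<Rightarrow> 'c::euclidean_space"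
    and h :: "'a \<Rightarrow> 'd::{banach, second_countable_topology}"
  assumes "L2 M f" "L2 M g" "h \<in> borel_measurable M"
    and "AE x in M. norm (h x) \<le> norm (f x) * norm (g x)"
  shows "integrable M h"
  by (rule Bochner_Integration.integrable_bound[OF L2_integrable_norm_mult[OF assms(1,2)] assms(3)])
     (use assms(4) in eventually_elim, simp)

lemma L2_integrable_inner:
  assumes "L2 M f" "L2 M g"
  shows "integrable M (\<lambda>x. f x \<bullet> g x)"
  by (rule L2_integrable_mult_bound[OF assms])
     (use assms in \<open>auto simp: L2_def Cauchy_Schwarz_ineq2\<close>)

lemma L2_add: "L2 M f \<Longrightarrow> L2 M g \<Longrightarrow> L2 M (\<lambda>x. f x + g x)"
  using L2_integrable_inner[of M f g]
  by (auto simp: L2_def power2_norm_eq_inner inner_add_left inner_add_right inner_commute)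

lemma L2_scaleR: "L2 M f \<Longrightarrow> L2 M (\<lambda>x. c *\<^sub>R f x)"
  by (auto simp: L2_def power_mult_distrib)

lemma L2_diff: "L2 M f \<Longrightarrow> L2 M g \<Longrightarrow> L2 M (\<lambda>x. f x - g x)"
  using L2_add[OF _ L2_scaleR[of M g "-1"], of f] by simp

lemma L2_indicator:
  assumes "A \<in> sets M" "emeasure M A < \<infinity>"
  shows "L2 M (indicator A :: 'a \<Rightarrow> real)"
proof -
  have "(\<lambda>x. (norm (indicator A x :: real))\<^sup>2) = indicator A"
    by (auto simp: fun_eq_iff indicator_def)
  then show ?thesis using assms by (simp add: L2_def)
qed

lemma L2sq_linear:
  assumes "L2 M f" "L2 M g"
  shows "L2sq M (\<lambda>x. a *\<^sub>R f x + t *\<^sub>R g x) = a\<^sup>2 * L2sq M f + 2 * a * t * L2inner M f g + t\<^sup>2 * L2sq M g"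
proof -
  have "(norm (a *\<^sub>R f x + t *\<^sub>R g x))\<^sup>2 = a\<^sup>2 * (norm (f x))\<^sup>2 + 2 * a * t * (f x \<bullet> g x) + t\<^sup>2 * (norm (g x))\<^sup>2" for x
    by (simp only: power2_norm_eq_inner)
       (simp add: inner_add_left inner_add_right inner_commute[of "g x" "f x"] algebra_simps power2_eq_square[of a] power2_eq_square[of t])
  then show ?thesis
    unfolding L2sq_def L2inner_def
    using assms[THEN L2_integrable] L2_integrable_inner[OF assms] by simp
qed

lemma L2_Cauchy_Schwarz:
  fixes f :: "'a \<Rightarrow> 'b::euclidean_space" and g :: "'a \<Rightarrow> 'c::euclidean_space"
  assumes "L2 M f" "L2 M g"
  shows "(LINT x|M. norm (f x) * norm (g x))\<^sup>2 \<le> L2sq M f * L2sq M g"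
proof -
  note [measurable] = L2_measurable[OF assms(1)] L2_measurable[OF assms(2)]
  have "(\<integral>\<^sup>+ x. ennreal (norm (f x)) * ennreal (norm (g x)) \<partial>M)\<^sup>2
      \<le> (\<integral>\<^sup>+ x. (ennreal (norm (f x)))\<^sup>2 \<partial>M) * (\<integral>\<^sup>+ x. (ennreal (norm (g x)))\<^sup>2 \<partial>M)"
    by (rule Cauchy_Schwarz_nn_integral) measurable
  also have "(\<integral>\<^sup>+ x. (ennreal (norm (f x)))\<^sup>2 \<partial>M) = ennreal (L2sq M f)"
    unfolding L2sq_def by (simp add: ennreal_power nn_integral_eq_integral L2_integrable[OF assms(1)])
  also have "(\<integral>\<^sup>+ x. (ennreal (norm (g x)))\<^sup>2 \<partial>M) = ennreal (L2sq M g)"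
    unfolding L2sq_def by (simp add: ennreal_power nn_integral_eq_integral L2_integrable[OF assms(2)])
  also have "(\<integral>\<^sup>+ x. ennreal (norm (f x)) * ennreal (norm (g x)) \<partial>M) = ennreal (LINT x|M. norm (f x) * norm (g x))"
    by (simp add: ennreal_mult[symmetric] nn_integral_eq_integral L2_integrable_norm_mult[OF assms])
  finally show ?thesis
    by (simp add: ennreal_power ennreal_mult[symmetric] L2sq_nonneg)
qed

text \<open>In the minimization this keeps the limit profile in L2: completeness is applied to the
  derivatives alone, while the profiles themselves converge pointwise with a uniform bound.\<close>

lemma L2_Fatou:
  fixes h :: "nat \<Rightarrow> 'a \<Rightarrow> 'b::euclidean_space"
  assumes h: "\<And>k. L2 M (h k)" and [measurable]: "H \<in> borel_measurable M"
    and lim: "AE x in M. (\<lambda>k. h k x) \<longlonglongrightarrow> H x"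
    and C: "eventually (\<lambda>k. L2sq M (h k) \<le> C) sequentially"
  shows "L2 M H" "L2sq M H \<le> C"
proof -
  note [measurable] = L2_measurable[OF h]
  have C0: "C \<ge> 0"
  proof -
    obtain k where "L2sq M (h k) \<le> C" using C eventually_happens by fastforce
    then show ?thesis using L2sq_nonneg[of M "h k"] by linarith
  qed
  have "(\<integral>\<^sup>+x. ennreal ((norm (H x))\<^sup>2) \<partial>M) = (\<integral>\<^sup>+x. liminf (\<lambda>k. ennreal ((norm (h k x))\<^sup>2)) \<partial>M)"
  proof (rule nn_integral_cong_AE)
    show "AE x in M. ennreal ((norm (H x))\<^sup>2) = liminf (\<lambda>k. ennreal ((norm (h k x))\<^sup>2))"
      using lim
    proof eventually_elim
      case (elim x)
      have "(\<lambda>k. ennreal ((norm (h k x))\<^sup>2)) \<longlonglongrightarrow> ennreal ((norm (H x))\<^sup>2)"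
        by (intro tendsto_intros elim)
      from lim_imp_Liminf[OF sequentially_bot this] show ?case by (rule sym)
    qed
  qed
  also have "\<dots> \<le> liminf (\<lambda>k. \<integral>\<^sup>+x. ennreal ((norm (h k x))\<^sup>2) \<partial>M)"
    by (rule nn_integral_liminf) measurable
  also have "\<dots> \<le> limsup (\<lambda>k. \<integral>\<^sup>+x. ennreal ((norm (h k x))\<^sup>2) \<partial>M)"
    by (rule Liminf_le_Limsup) simp
  also have "\<dots> \<le> ennreal C"
  proof (rule Limsup_bounded)
    show "\<forall>\<^sub>F k in sequentially. (\<integral>\<^sup>+x. ennreal ((norm (h k x))\<^sup>2) \<partial>M) \<le> ennreal C"
      using C
    proof eventually_elim
      case (elim k)
      have "(\<integral>\<^sup>+x. ennreal ((norm (h k x))\<^sup>2) \<partial>M) = ennreal (L2sq M (h k))"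
        unfolding L2sq_def using L2_integrable[OF h, of k] by (intro nn_integral_eq_integral) auto
      then show ?case using elim by (simp add: ennreal_leI)
    qed
  qed
  finally have le: "(\<integral>\<^sup>+x. ennreal ((norm (H x))\<^sup>2) \<partial>M) \<le> ennreal C" .
  then have int: "integrable M (\<lambda>x. (norm (H x))\<^sup>2)"
    by (intro integrableI_bounded) (auto simp: less_top[symmetric] top_unique)
  then show "L2 M H" by (simp add: L2_def)
  show "L2sq M H \<le> C"
    using le int C0 unfolding L2sq_def by (simp add: nn_integral_eq_integral)
qed

text \<open>Riesz-Fischer. The squared increments of the subsequence are below 8^-j and are summed
  with weight 4^j: the integral of the sum is at most 2, and where the sum is finite the increments
  are of order 2^-j, so they are summable.\<close>

lemma L2_complete:
  fixes h :: "nat \<Rightarrow> 'a \<Rightarrow> 'b::euclidean_space"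
  assumes h: "\<And>k. L2 M (h k)"
    and C: "\<And>e. e > 0 \<Longrightarrow> \<exists>K. \<forall>k\<ge>K. \<forall>l\<ge>K. L2sq M (\<lambda>x. h k x - h l x) < e"
  obtains H where "L2 M H" "(\<lambda>k. L2sq M (\<lambda>x. h k x - H x)) \<longlonglongrightarrow> 0"
proof -
  note [measurable] = L2_measurable[OF h]
  have "\<forall>j. \<exists>K. \<forall>k\<ge>K. \<forall>l\<ge>K. L2sq M (\<lambda>x. h k x - h l x) < (1/8)^j"
    by (intro allI C) simp
  then obtain K where K: "\<And>j k l. k \<ge> K j \<Longrightarrow> l \<ge> K j \<Longrightarrow> L2sq M (\<lambda>x. h k x - h l x) < (1/8)^j"
    by metis
  \<comment> \<open>The maximum makes the indices nondecreasing without losing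
    \<open>r j \<ge> K j\<close>, so consecutive indices both lie in the range where the bound of
    stage j holds.\<close>
  define r where "r j = Max (K ` {..j})" for j
  have rK: "K j \<le> r j" and r_mono: "r j \<le> r (Suc j)" for j
    unfolding r_def by (auto intro!: Max_mono)
  have d: "L2sq M (\<lambda>x. h (r (Suc j)) x - h (r j) x) < (1/8)^j" for j
    by (rule K) (use rK[of j] r_mono[of j] in auto)
  define S where "S x = (\<Sum>j. ennreal (4^j * (norm (h (r (Suc j)) x - h (r j) x))\<^sup>2))" for x
  have "(\<integral>\<^sup>+x. S x \<partial>M) = (\<Sum>j. \<integral>\<^sup>+x. ennreal (4^j * (norm (h (r (Suc j)) x - h (r j) x))\<^sup>2) \<partial>M)"
    unfolding S_def by (rule nn_integral_suminf) measurable
  also have "\<dots> \<le> (\<Sum>j. ennreal ((1/2)^j))"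
  proof (intro suminf_le summableI)
    fix j
    have "(\<integral>\<^sup>+x. ennreal (4^j * (norm (h (r (Suc j)) x - h (r j) x))\<^sup>2) \<partial>M) = ennreal (4^j * L2sq M (\<lambda>x. h (r (Suc j)) x - h (r j) x))"
      unfolding L2sq_def using L2_integrable[OF L2_diff[OF h h], of "r (Suc j)" "r j"]
      by (subst nn_integral_eq_integral) auto
    also have "\<dots> \<le> ennreal (4^j * (1/8)^j)"
      using d[of j] by (intro ennreal_leI mult_left_mono) auto
    also have "(4::real)^j * (1/8)^j = (1/2)^j"
      by (simp flip: power_mult_distrib)
    finally show "(\<integral>\<^sup>+x. ennreal (4^j * (norm (h (r (Suc j)) x - h (r j) x))\<^sup>2) \<partial>M) \<le> ennreal ((1/2)^j)" .
  qed
  also have "\<dots> = ennreal 2"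
    by (intro suminf_ennreal_eq) (use geometric_sums[of "1/2::real"] in auto)
  finally have fin: "(\<integral>\<^sup>+x. S x \<partial>M) \<noteq> \<infinity>" by (auto simp: top_unique)
  have "S \<in> borel_measurable M"
    unfolding S_def by measurable
  from nn_integral_PInf_AE[OF this fin] have "AE x in M. S x \<noteq> \<infinity>" .
  then have conv: "AE x in M. convergent (\<lambda>j. h (r j) x)"
  proof eventually_elim
    case (elim x)
    have "norm (h (r (Suc j)) x - h (r j) x) \<le> sqrt (enn2real (S x)) * (1/2)^j" for j
    proof -
      have "ennreal (4^j * (norm (h (r (Suc j)) x - h (r j) x))\<^sup>2) \<le> S x"
        unfolding S_def by (rule leI, rule notI, drule ennreal_suminf_lessD[of _ _ j]) simp
      then have "4^j * (norm (h (r (Suc j)) x - h (r j) x))\<^sup>2 \<le> enn2real (S x)"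
        using elim by (cases "S x") auto
      then have "sqrt (4^j * (norm (h (r (Suc j)) x - h (r j) x))\<^sup>2) \<le> sqrt (enn2real (S x))"
        by (rule real_sqrt_le_mono)
      moreover have "sqrt (4^j) = 2^j"
        by (simp add: real_sqrt_power)
      ultimately have "2^j * norm (h (r (Suc j)) x - h (r j) x) \<le> sqrt (enn2real (S x))"
        by (simp add: real_sqrt_mult)
      then have "(1/2)^j * (2^j * norm (h (r (Suc j)) x - h (r j) x)) \<le> (1/2)^j * sqrt (enn2real (S x))"
        by (rule mult_left_mono) simp
      moreover have "(1/2)^j * (2^j * norm (h (r (Suc j)) x - h (r j) x)) = norm (h (r (Suc j)) x - h (r j) x)"
        by (simp only: mult.assoc[symmetric] power_mult_distrib[symmetric]) simp
      ultimately show ?thesis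
        by (simp add: mult.commute)
    qed
    then have "summable (\<lambda>j. h (r (Suc j)) x - h (r j) x)"
      by (rule summable_comparison_test'[OF summable_mult[OF summable_geometric[of "1/2"]], of 0, rotated]) auto
    from summable_LIMSEQ[OF this, unfolded sum_lessThan_telescope[of "\<lambda>j. h (r j) x"]]
    have "convergent (\<lambda>n. h (r n) x - h (r 0) x)"
      by (rule convergentI)
    from convergent_add[OF this convergent_const[of "h (r 0) x"]] show ?case by simp
  qed
  define H where "H x = lim (\<lambda>j. h (r j) x)" for x
  have [measurable]: "H \<in> borel_measurable M"
    unfolding H_def by measurable
  have lim: "AE x in M. (\<lambda>j. h (r j) x) \<longlonglongrightarrow> H x"
    using conv by eventually_elim (auto simp: H_def convergent_LIMSEQ_iff)
  have r_ge: "K i \<le> r j" if "i \<le> j" for i j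
    using that unfolding r_def by (intro Max_ge) auto
  \<comment> \<open>With k fixed, the Cauchy bound survives the limit along the subsequence. This
    gives convergence of the whole sequence and not merely of the subsequence.\<close>
  have Fatou: "L2 M (\<lambda>x. h k x - H x) \<and> L2sq M (\<lambda>x. h k x - H x) \<le> (1/8)^j" if k: "k \<ge> K j" for k j
  proof -
    have 1: "AE x in M. (\<lambda>i. h k x - h (r i) x) \<longlonglongrightarrow> h k x - H x"
      using lim by eventually_elim (intro tendsto_intros)
    have "L2sq M (\<lambda>x. h k x - h (r i) x) \<le> (1/8)^j" if "i \<ge> j" for i
      using K[OF k r_ge[OF that]] by simp
    then have 2: "eventually (\<lambda>i. L2sq M (\<lambda>x. h k x - h (r i) x) \<le> (1/8)^j) sequentially"
      by (auto simp: eventually_sequentially)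
    have 3: "(\<lambda>x. h k x - H x) \<in> borel_measurable M" by measurable
    show ?thesis using L2_Fatou[OF L2_diff[OF h h] 3 1 2] by simp
  qed
  have "L2 M (\<lambda>x. h (K 0) x - H x)"
    using Fatou[of 0 "K 0"] by simp
  from L2_diff[OF h[of "K 0"] this] have "L2 M H" by simp
  moreover have "(\<lambda>k. L2sq M (\<lambda>x. h k x - H x)) \<longlonglongrightarrow> 0"
  proof (rule LIMSEQ_I)
    fix e :: real assume "e > 0"
    then obtain j where j: "(1/8::real)^j < e"
      using real_arch_pow_inv[of e "1/8"] by auto
    show "\<exists>no. \<forall>k\<ge>no. norm (L2sq M (\<lambda>x. h k x - H x) - 0) < e"
    proof (intro exI[of _ "K j"] allI impI)
      fix k assume "K j \<le> k"
      from Fatou[OF this] j show "norm (L2sq M (\<lambda>x. h k x - H x) - 0) < e"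
        using L2sq_nonneg[of M "\<lambda>x. h k x - H x"] by simp
    qed
  qed
  ultimately show ?thesis by (rule that)
qed

text \<open>Borel representatives with respect to \<open>lborel\<close> take the place of Lebesgue
  measurable ones: the functions are composed with dilations depending on a parameter and with polar
  coordinates, and Borel measurability is preserved under such compositions.\<close>

definition weak_pair :: "(real ^ 'n \<Rightarrow> complex) \<Rightarrow> (real ^ 'n \<Rightarrow> complex ^ 'n) \<Rightarrow> bool" where
  "weak_pair v g \<longleftrightarrow> L2 lborel v \<and> L2 lborel g \<and>
     (\<forall>\<phi>\<in>test_functions. \<forall>i.
        (LINT x|lborel. pdiff i \<phi> x *\<^sub>R v x) = - (LINT x|lborel. \<phi> x *\<^sub>R (g x $ i)))"

lemma test_functions_L2:
  fixes \<phi> :: "real ^ 'n \<Rightarrow> real"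
  assumes "\<phi> \<in> test_functions" shows "L2 lborel \<phi>"
proof -
  obtain B R where B: "0 < B" "\<And>x. \<bar>\<phi> x\<bar> \<le> B * indicator (ball 0 R) x"
    using test_functions_bound[OF assms] by metis
  have "L2 lborel (indicator (ball 0 R) :: real ^ 'n \<Rightarrow> real)"
    by (rule L2_indicator) (use emeasure_lborel_ball_finite in auto)
  then show ?thesis
    by (rule L2_bound[of _ _ _ B]) (use B test_functions_borel[OF assms] in auto)
qed

lemma test_functions_integrable:
  fixes f :: "real ^ 'n \<Rightarrow> 'b::euclidean_space"
  assumes "\<phi> \<in> test_functions" "L2 lborel f"
  shows "integrable lborel (\<lambda>x. \<phi> x *\<^sub>R f x)"
proof -
  note [measurable] = test_functions_borel[OF assms(1)] L2_measurable[OF assms(2)]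
  show ?thesis
    by (rule L2_integrable_mult_bound[OF test_functions_L2[OF assms(1)] assms(2)]) auto
qed

lemma complex_vec_nth_measurable [measurable (raw)]:
  "g \<in> borel_measurable M \<Longrightarrow> (\<lambda>x. (g x :: complex ^ 'n) $ i) \<in> borel_measurable M"
  by (rule borel_measurable_continuous_on[of "\<lambda>x. x $ i"]) (auto intro: continuous_intros)

lemma L2_nth: "L2 M g \<Longrightarrow> L2 M (\<lambda>x. (g x :: complex ^ 'n) $ i)"
  by (rule L2_bound[of M g _ 1]) (auto simp: Finite_Cartesian_Product.norm_nth_le)

lemma L2_set_integrable_box:
  fixes f :: "'a::euclidean_space \<Rightarrow> 'b::euclidean_space"
  assumes "L2 lborel f"
  shows "set_integrable lborel (box a b) f"
proof -
  note [measurable] = L2_measurable[OF assms(1)]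
  have "L2 lborel (indicator (box a b) :: 'a \<Rightarrow> real)"
    by (rule L2_indicator) (use emeasure_lborel_box_finite in auto)
  from L2_integrable_mult_bound[OF this assms(1), of "\<lambda>x. indicator (box a b) x *\<^sub>R f x"] show ?thesis
    by (simp add: set_integrable_def)
qed

lemma weak_pair_unique:
  fixes v v' :: "real ^ 'n \<Rightarrow> complex"
  assumes "weak_pair v g" "weak_pair v' g'" "AE x in lborel. v x = v' x"
  shows "AE x in lborel. g x = g' x"
proof -
  note W = assms(1,2)[unfolded weak_pair_def]
  have "AE x in lborel. g x $ i - g' x $ i = 0" for i
  proof (rule AE_zero_if_test_integrals_zero)
    note [measurable] = W[THEN conjunct2, THEN conjunct1, THEN L2_measurable]
    have L: "L2 lborel (\<lambda>x. g x $ i - g' x $ i)"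
      using W by (intro L2_diff L2_nth) auto
    show "set_integrable lborel (box a b) (\<lambda>x. g x $ i - g' x $ i)" for a b
      by (rule L2_set_integrable_box[OF L])
    show "(\<lambda>x. g x $ i - g' x $ i) \<in> borel_measurable borel"
      using L2_measurable[OF L] by simp
    fix \<psi> :: "real ^ 'n \<Rightarrow> real" assume \<psi>: "\<psi> \<in> test_functions"
    have "(LINT x|lborel. pdiff i \<psi> x *\<^sub>R v x) = (LINT x|lborel. pdiff i \<psi> x *\<^sub>R v' x)"
      using test_functions_borel[OF test_functions_pdiff[OF \<psi>, of i]] W[THEN conjunct1, THEN L2_measurable]
      by (intro integral_cong_AE) (use assms(3) in auto)
    then have "(LINT x|lborel. \<psi> x *\<^sub>R (g x $ i)) = (LINT x|lborel. \<psi> x *\<^sub>R (g' x $ i))"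
      using W \<psi> by auto
    then show "(LINT x|lborel. \<psi> x *\<^sub>R (g x $ i - g' x $ i)) = 0"
      using W by (simp add: scaleR_diff_right test_functions_integrable[OF \<psi> L2_nth])
  qed
  then have "AE x in lborel. \<forall>i. g x $ i - g' x $ i = 0"
    by (simp add: AE_all_countable)
  then show ?thesis
    by eventually_elim (simp add: vec_eq_iff)
qed

lemma L2_cmult: "L2 M f \<Longrightarrow> L2 M (\<lambda>x. (c::complex) * f x)"
  by (rule L2_bound[of M f _ "norm c"]) (auto simp: norm_mult)

lemma norm_vector_cmult: "norm (c *s g) = norm c * norm (g :: complex ^ 'n)"
  by (simp add: norm_vec_def vector_scalar_mult_def norm_mult L2_set_right_distrib)

lemma vector_cmult_measurable [measurable]:
  assumes [measurable]: "f \<in> borel_measurable M" "g \<in> borel_measurable M"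
  shows "(\<lambda>x. f x *s (g x :: complex ^ 'n)) \<in> borel_measurable M"
proof -
  have "continuous_on UNIV (\<lambda>p. fst p *s (snd p :: complex ^ 'n))"
    unfolding vector_scalar_mult_def by (intro continuous_intros)
  from borel_measurable_continuous_on[OF this, of "\<lambda>x. (f x, g x)" M] show ?thesis
    by (simp add: borel_measurable_Pair assms)
qed

lemma weak_pair_cmult:
  fixes v :: "real ^ 'n \<Rightarrow> complex"
  assumes "weak_pair v g"
  shows "weak_pair (\<lambda>x. c * v x) (\<lambda>x. c *s g x)"
proof -
  note W = assms[unfolded weak_pair_def]
  have "L2 lborel (\<lambda>x. c *s g x)"
    by (rule L2_bound[of _ g _ "norm c"]) (use W in \<open>auto simp: norm_vector_cmult L2_def\<close>)
  then show ?thesis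
    using W unfolding weak_pair_def by (auto simp: L2_cmult mult_scaleR_right[symmetric] simp del: mult_scaleR_right)
qed

lemma lebesgue_ex_borel:
  fixes f :: "'a::euclidean_space \<Rightarrow> 'b::euclidean_space"
  assumes "f \<in> borel_measurable lebesgue"
  obtains f' where "f' \<in> borel_measurable borel" "AE x in lborel. f x = f' x"
proof -
  have "\<exists>h\<in>borel_measurable lborel. (AE x in lborel. f x \<bullet> b = h x)" for b
    by (rule completion_ex_borel_measurable_real) (use assms in measurable)
  then obtain h where h: "\<And>b. h b \<in> borel_measurable lborel" "\<And>b. AE x in lborel. f x \<bullet> b = h b x"
    by metis
  have "AE x in lborel. \<forall>b\<in>Basis. f x \<bullet> b = h b x"
    using h(2) by (intro AE_finite_allI) auto
  then have "AE x in lborel. f x = (\<Sum>b\<in>Basis. h b x *\<^sub>R b)"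
  proof eventually_elim
    case (elim x)
    have "f x = (\<Sum>b\<in>Basis. (f x \<bullet> b) *\<^sub>R b)" by (simp add: euclidean_representation)
    then show ?case using elim by simp
  qed
  moreover have "(\<lambda>x. \<Sum>b\<in>Basis. h b x *\<^sub>R b) \<in> borel_measurable borel"
    using h(1) by auto
  ultimately show ?thesis by (rule that[rotated])
qed

lemma Lp_space_2_iff: "f \<in> Lp_space 2 \<longleftrightarrow> L2 lebesgue f"
  by (simp add: Lp_space_def L2_def)

lemma L2_lebesgue_iff: "f \<in> borel_measurable borel \<Longrightarrow> L2 lebesgue f \<longleftrightarrow> L2 lborel f"
  by (simp add: L2_def measurable_completion integrable_completion)

lemma lebesgue_measurable_AE_borel:
  fixes f :: "'a::euclidean_space \<Rightarrow> 'b::euclidean_space"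
  assumes "f' \<in> borel_measurable borel" "AE x in lebesgue. f x = f' x"
  shows "f \<in> borel_measurable lebesgue"
proof (rule borel_measurable_AE)
  show "f' \<in> borel_measurable lebesgue" using assms(1) by (simp add: measurable_completion)
  show "AE x in lebesgue. f' x = f x" using assms(2) by eventually_elim simp
qed

lemma has_weak_gradient_iff_borel:
  fixes v v' :: "real ^ 'n \<Rightarrow> complex"
  assumes "L2 lborel v'" "L2 lborel g'"
    and "AE x in lebesgue. v x = v' x" "AE x in lebesgue. g x = g' x"
  shows "v \<in> Lp_space 2 \<and> g \<in> Lp_space 2 \<and> has_weak_gradient v g \<longleftrightarrow> weak_pair v' g'"
proof -
  note [measurable] = assms(1,2)[THEN L2_measurable, unfolded measurable_lborel2]
  have m: "v \<in> borel_measurable lebesgue" "g \<in> borel_measurable lebesgue"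
    using assms by (auto intro!: lebesgue_measurable_AE_borel)
  have "L2 lebesgue v'" "L2 lebesgue g'"
    using assms(1,2) by (simp_all add: L2_lebesgue_iff)
  moreover have "AE x in lebesgue. v' x = v x" "AE x in lebesgue. g' x = g x"
    using assms(3,4) by (auto elim: eventually_mono)
  ultimately have "v \<in> Lp_space 2" "g \<in> Lp_space 2"
    unfolding Lp_space_2_iff using m by (blast intro: L2_cong_AE)+
  moreover have "(LINT x|lebesgue. pdiff i \<phi> x *\<^sub>R v x) = (LINT x|lborel. pdiff i \<phi> x *\<^sub>R v' x)"
    "(LINT x|lebesgue. \<phi> x *\<^sub>R (g x $ i)) = (LINT x|lborel. \<phi> x *\<^sub>R (g' x $ i))"
    if "\<phi> \<in> test_functions" for \<phi> i
  proof -
    note [measurable] = test_functions_borel[OF that] test_functions_borel[OF test_functions_pdiff[OF that]]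
      measurable_completion[OF test_functions_borel[OF that, folded measurable_lborel2]]
      measurable_completion[OF test_functions_borel[OF test_functions_pdiff[OF that], folded measurable_lborel2]]
      measurable_completion[OF assms(1)[THEN L2_measurable]] measurable_completion[OF assms(2)[THEN L2_measurable]] m
    have "(LINT x|lebesgue. pdiff i \<phi> x *\<^sub>R v x) = (LINT x|lebesgue. pdiff i \<phi> x *\<^sub>R v' x)"
      by (intro integral_cong_AE) (use assms in auto)
    also have "\<dots> = (LINT x|lborel. pdiff i \<phi> x *\<^sub>R v' x)"
      by (rule integral_completion) measurable
    finally show "(LINT x|lebesgue. pdiff i \<phi> x *\<^sub>R v x) = (LINT x|lborel. pdiff i \<phi> x *\<^sub>R v' x)" .
    have "(LINT x|lebesgue. \<phi> x *\<^sub>R (g x $ i)) = (LINT x|lebesgue. \<phi> x *\<^sub>R (g' x $ i))"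
      by (intro integral_cong_AE) (use assms in auto)
    also have "\<dots> = (LINT x|lborel. \<phi> x *\<^sub>R (g' x $ i))"
      by (rule integral_completion) measurable
    finally show "(LINT x|lebesgue. \<phi> x *\<^sub>R (g x $ i)) = (LINT x|lborel. \<phi> x *\<^sub>R (g' x $ i))" .
  qed
  ultimately show ?thesis
    using assms by (simp add: has_weak_gradient_def weak_pair_def)
qed

lemma weak_pair_exists:
  fixes v :: "real ^ 'n \<Rightarrow> complex"
  assumes "v \<in> Lp_space 2" "g \<in> Lp_space 2" "has_weak_gradient v g"
  obtains v' g' where "weak_pair v' g'" "AE x in lebesgue. v x = v' x" "AE x in lebesgue. g x = g' x"
proof -
  have m: "v \<in> borel_measurable lebesgue" "g \<in> borel_measurable lebesgue"
    using assms by (auto simp: Lp_space_2_iff L2_def)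
  obtain v' where [measurable]: "v' \<in> borel_measurable borel" and v': "AE x in lborel. v x = v' x"
    using lebesgue_ex_borel[OF m(1)] by blast
  obtain g' where [measurable]: "g' \<in> borel_measurable borel" and g': "AE x in lborel. g x = g' x"
    using lebesgue_ex_borel[OF m(2)] by blast
  note AE = v'[THEN AE_completion] g'[THEN AE_completion]
  have "L2 lebesgue v'"
    by (rule L2_cong_AE[OF _ _ AE(1)]) (use assms(1) in \<open>simp_all add: Lp_space_2_iff measurable_completion\<close>)
  moreover have "L2 lebesgue g'"
    by (rule L2_cong_AE[OF _ _ AE(2)]) (use assms(2) in \<open>simp_all add: Lp_space_2_iff measurable_completion\<close>)
  ultimately have "L2 lborel v'" "L2 lborel g'" by (simp_all add: L2_lebesgue_iff)
  with AE assms that show ?thesis using has_weak_gradient_iff_borel by blast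
qed

lemma H1_obtain:
  fixes v :: "real ^ 'n \<Rightarrow> complex"
  assumes "v \<in> H1"
  obtains v' g' where "weak_pair v' g'" "AE x in lebesgue. v x = v' x" "AE x in lebesgue. weak_gradient v x = g' x"
proof -
  have "\<exists>g. g \<in> Lp_space 2 \<and> has_weak_gradient v g" "v \<in> Lp_space 2"
    using assms by (auto simp: H1_def)
  from someI_ex[OF this(1)] this(2) that show ?thesis
    unfolding weak_gradient_def[symmetric] using weak_pair_exists by blast
qed

text \<open>Disposes of the choice operator in \<open>weak_gradient\<close>: by uniqueness up to
  null sets the chosen gradient agrees with any known one.\<close>

lemma H1_weak_pair:
  fixes v :: "real ^ 'n \<Rightarrow> complex"
  assumes "weak_pair v' g'" "AE x in lebesgue. v x = v' x"
  shows "v \<in> H1" "AE x in lebesgue. weak_gradient v x = g' x"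
proof -
  have "L2 lborel v'" "L2 lborel g'" using assms by (auto simp: weak_pair_def)
  then show "v \<in> H1"
    using has_weak_gradient_iff_borel[of v' g' v g'] assms by (auto simp: H1_def)
  then obtain v2 g2 where 2: "weak_pair v2 g2" "AE x in lebesgue. v x = v2 x" "AE x in lebesgue. weak_gradient v x = g2 x"
    by (rule H1_obtain)
  from 2(2) assms(2) have "AE x in lebesgue. v2 x = v' x" by eventually_elim simp
  then have "AE x in lborel. v2 x = v' x" by (simp add: AE_completion_iff)
  from weak_pair_unique[OF 2(1) assms(1) this] have "AE x in lebesgue. g2 x = g' x"
    by (rule AE_completion)
  with 2(3) show "AE x in lebesgue. weak_gradient v x = g' x" by eventually_elim simp
qed

section \<open>Integration along rays and the Hardy inequality\<close>

lemma nn_integral_lborel_scale: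
  fixes f :: "'a::euclidean_space \<Rightarrow> ennreal"
  assumes [measurable]: "f \<in> borel_measurable borel" and "s > 0"
  shows "(\<integral>\<^sup>+x. f (s *\<^sub>R x) \<partial>lborel) = ennreal (inverse (s ^ DIM('a))) * (\<integral>\<^sup>+x. f x \<partial>lborel)"
proof -
  have "(\<integral>\<^sup>+x. f x \<partial>lborel) = (\<integral>\<^sup>+x. f x \<partial>density (distr lborel borel (\<lambda>x::'a. 0 + s *\<^sub>R x)) (\<lambda>_. ennreal (\<bar>s\<bar>^DIM('a))))"
    using lborel_affine[of s "0::'a"] \<open>s > 0\<close> by simp
  also have "\<dots> = ennreal (s ^ DIM('a)) * (\<integral>\<^sup>+x. f (s *\<^sub>R x) \<partial>lborel)"
    using \<open>s > 0\<close> by (simp add: nn_integral_density nn_integral_distr nn_integral_cmult)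
  finally show ?thesis
    using \<open>s > 0\<close> by (simp add: mult.assoc[symmetric] ennreal_mult[symmetric])
qed

lemma integral_lborel_scale:
  fixes f :: "'a::euclidean_space \<Rightarrow> 'b::{banach, second_countable_topology}"
  assumes [measurable]: "f \<in> borel_measurable borel" and "s > 0"
  shows "(LINT x|lborel. f (s *\<^sub>R x)) = inverse (s ^ DIM('a)) *\<^sub>R (LINT x|lborel. f x)"
proof -
  have "(LINT x|lborel. f x) = (LINT x|density (distr lborel borel (\<lambda>x::'a. 0 + s *\<^sub>R x)) (\<lambda>_. ennreal (\<bar>s\<bar>^DIM('a))). f x)"
    using lborel_affine[of s "0::'a"] \<open>s > 0\<close> by simp
  also have "\<dots> = (s ^ DIM('a)) *\<^sub>R (LINT x|lborel. f (s *\<^sub>R x))"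
    using \<open>s > 0\<close> by (simp add: integral_density integral_distr)
  finally show ?thesis using \<open>s > 0\<close> by simp
qed

lemma nn_integral_powr_atLeast:
  assumes "b > 1" "a > 0"
  shows "(\<integral>\<^sup>+t. indicator {a..} t * ennreal (t powr - b) \<partial>lborel) = ennreal (a powr (1 - b) / (b - 1))"
proof -
  have "((\<lambda>t. t powr - b) has_integral - (a powr (- b + 1)) / (- b + 1)) {a..}"
    by (rule has_integral_powr_to_inf) (use assms in auto)
  also have "- (a powr (- b + 1)) / (- b + 1) = a powr (1 - b) / (b - 1)"
    using assms by (simp add: field_simps)
  finally have "((\<lambda>t. if t \<in> {a..} then t powr - b else 0) has_integral a powr (1 - b) / (b - 1)) UNIV"
    by (simp only: has_integral_restrict_UNIV)
  then have "((\<lambda>t. indicator {a..} t * t powr - b) has_integral a powr (1 - b) / (b - 1)) UNIV"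
    by (rule has_integral_eq[rotated]) auto
  then have "(\<integral>\<^sup>+t. ennreal (indicator {a..} t * t powr - b) \<partial>lborel) = ennreal (a powr (1 - b) / (b - 1))"
    by (intro nn_integral_has_integral_lborel) auto
  then show ?thesis
    by (simp add: ennreal_mult' ennreal_indicator)
qed

text \<open>Without conjugation, so that \<open>cdot x (g y)\<close> is the derivative in direction
  x of a complex function whose gradient at y is \<open>g y\<close>.\<close>

definition cdot :: "real ^ 'n \<Rightarrow> complex ^ 'n \<Rightarrow> complex" where
  "cdot x g = (\<Sum>i\<in>UNIV. (x $ i) *\<^sub>R (g $ i))"

lemma norm_cdot_le: "norm (cdot x g) \<le> norm x * norm g"
proof -
  have "norm (cdot x g) \<le> (\<Sum>i\<in>UNIV. \<bar>x $ i\<bar> * norm (g $ i))"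
    unfolding cdot_def by (rule order_trans[OF norm_sum]) simp
  also have "\<dots> \<le> L2_set (\<lambda>i. x $ i) UNIV * L2_set (\<lambda>i. norm (g $ i)) UNIV"
    using L2_set_mult_ineq[of "\<lambda>i. x $ i" "\<lambda>i. norm (g $ i)" UNIV] by simp
  also have "\<dots> = norm x * norm g"
    by (simp add: norm_vec_def L2_set_def)
  finally show ?thesis .
qed

lemma real_vec_nth_measurable [measurable (raw)]:
  "g \<in> borel_measurable M \<Longrightarrow> (\<lambda>x. (g x :: real ^ 'n) $ i) \<in> borel_measurable M"
  by (rule borel_measurable_continuous_on[of "\<lambda>x. x $ i"]) (auto intro: continuous_intros)

lemma cdot_measurable [measurable]:
  assumes [measurable]: "f \<in> borel_measurable M" "g \<in> borel_measurable M"
  shows "(\<lambda>x. cdot (f x) (g x)) \<in> borel_measurable M"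
  unfolding cdot_def by measurable

lemma cdot_scaleR_left: "cdot (t *\<^sub>R x) g = t *\<^sub>R cdot x g"
  by (simp add: cdot_def scaleR_sum_right)

lemma Hardy_tail:
  fixes u :: "real ^ 'n \<Rightarrow> real"
  assumes n: "CARD('n) \<ge> 3" and [measurable]: "u \<in> borel_measurable borel" and u: "\<And>x. 0 \<le> u x"
  shows "(\<integral>\<^sup>+x. (\<integral>\<^sup>+t. indicator {1..} t * ennreal (u (t *\<^sub>R x)) \<partial>lborel)\<^sup>2 \<partial>lborel)
     \<le> ennreal ((2 / (real CARD('n) - 2))\<^sup>2) * (\<integral>\<^sup>+x. ennreal ((u x)\<^sup>2) \<partial>lborel)"
proof -
  \<comment> \<open>With weight t^b the Cauchy-Schwarz inequality leaves the integrals of t^-b and,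
    after the dilation has contributed t^-d, of t^(b-d). Their product 1/((b-1)(d-b-1)) is smallest
    at b = d/2, where both factors are 1/(a-1) = 2/(d-2). Dimension at least three is what makes a >
    1.\<close>
  define a where "a = real CARD('n) / 2"
  have a: "a > 1" using n by (simp add: a_def)
  define C where "C = 1 / (a - 1)"
  have C: "(\<integral>\<^sup>+t. indicator {1..} t * ennreal (t powr - a) \<partial>lborel) = ennreal C"
    using nn_integral_powr_atLeast[OF a, of 1] by (simp add: C_def)
  have CS: "(\<integral>\<^sup>+t. indicator {1..} t * ennreal (u (t *\<^sub>R x)) \<partial>lborel)\<^sup>2
      \<le> ennreal C * (\<integral>\<^sup>+t. indicator {1..} t * ennreal (t powr a * (u (t *\<^sub>R x))\<^sup>2) \<partial>lborel)" for x
  proof -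
    let ?p = "\<lambda>t. indicator {1..} t * ennreal (t powr (- a / 2))"
    let ?q = "\<lambda>t. indicator {1..} t * ennreal (t powr (a / 2) * u (t *\<^sub>R x))"
    have pq: "indicator {1..} t * ennreal (u (t *\<^sub>R x)) = ?p t * ?q t" for t :: real
    proof (cases "t \<ge> 1")
      case True
      have "t powr (- a / 2) * (t powr (a / 2) * u (t *\<^sub>R x)) = (t powr (- a / 2) * t powr (a / 2)) * u (t *\<^sub>R x)"
        by simp
      also have "t powr (- a / 2) * t powr (a / 2) = 1"
        using True by (simp add: powr_add[symmetric])
      finally show ?thesis using True u[of "t *\<^sub>R x"] by (simp add: ennreal_mult[symmetric])
    qed simp
    have p2: "(?p t)\<^sup>2 = indicator {1..} t * ennreal (t powr - a)" for t :: real
    proof (cases "t \<ge> 1")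
      case True
      have "(t powr (- a / 2))\<^sup>2 = t powr - a"
        by (simp add: power2_eq_square powr_add[symmetric])
      then show ?thesis using True by (simp add: ennreal_power)
    qed simp
    have q2: "(?q t)\<^sup>2 = indicator {1..} t * ennreal (t powr a * (u (t *\<^sub>R x))\<^sup>2)" for t :: real
    proof (cases "t \<ge> 1")
      case True
      have "(t powr (a / 2))\<^sup>2 = t powr a"
        by (simp add: power2_eq_square powr_add[symmetric])
      then show ?thesis using True u[of "t *\<^sub>R x"] by (simp add: ennreal_power power_mult_distrib)
    qed simp
    have "(\<integral>\<^sup>+t. ?p t * ?q t \<partial>lborel)\<^sup>2 \<le> (\<integral>\<^sup>+t. (?p t)\<^sup>2 \<partial>lborel) * (\<integral>\<^sup>+t. (?q t)\<^sup>2 \<partial>lborel)"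
      by (rule Cauchy_Schwarz_nn_integral) measurable
    then show ?thesis unfolding pq p2 q2 C .
  qed
  have "(\<integral>\<^sup>+x. (\<integral>\<^sup>+t. indicator {1..} t * ennreal (u (t *\<^sub>R x)) \<partial>lborel)\<^sup>2 \<partial>lborel)
      \<le> (\<integral>\<^sup>+x. ennreal C * (\<integral>\<^sup>+t. indicator {1..} t * ennreal (t powr a * (u (t *\<^sub>R x))\<^sup>2) \<partial>lborel) \<partial>lborel)"
    by (intro nn_integral_mono CS)
  also have "\<dots> = ennreal C * (\<integral>\<^sup>+x. (\<integral>\<^sup>+t. indicator {1..} t * ennreal (t powr a * (u (t *\<^sub>R x))\<^sup>2) \<partial>lborel) \<partial>lborel)"
    by (rule nn_integral_cmult) measurable
  also have "(\<integral>\<^sup>+x. (\<integral>\<^sup>+t. indicator {1..} t * ennreal (t powr a * (u (t *\<^sub>R x))\<^sup>2) \<partial>lborel) \<partial>lborel)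
      = (\<integral>\<^sup>+t. (\<integral>\<^sup>+x. indicator {1..} t * ennreal (t powr a * (u (t *\<^sub>R x))\<^sup>2) \<partial>lborel) \<partial>lborel)"
    by (rule lborel_pair.Fubini'[symmetric]) measurable
  also have "\<dots> = (\<integral>\<^sup>+t. indicator {1..} t * ennreal (t powr - a) * (\<integral>\<^sup>+x. ennreal ((u x)\<^sup>2) \<partial>lborel) \<partial>lborel)"
  proof (rule nn_integral_cong)
    fix t :: real
    show "(\<integral>\<^sup>+x. indicator {1..} t * ennreal (t powr a * (u (t *\<^sub>R x))\<^sup>2) \<partial>lborel)
       = indicator {1..} t * ennreal (t powr - a) * (\<integral>\<^sup>+x. ennreal ((u x)\<^sup>2) \<partial>lborel)"
    proof (cases "t \<ge> 1")
      case True
      have "(\<integral>\<^sup>+x. ennreal (t powr a * (u (t *\<^sub>R x))\<^sup>2) \<partial>lborel) = ennreal (t powr a) * (\<integral>\<^sup>+x. ennreal ((u (t *\<^sub>R x))\<^sup>2) \<partial>lborel)"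
        by (simp add: ennreal_mult nn_integral_cmult)
      also have "(\<integral>\<^sup>+x. ennreal ((u (t *\<^sub>R x))\<^sup>2) \<partial>lborel) = ennreal (inverse (t ^ CARD('n))) * (\<integral>\<^sup>+x. ennreal ((u x)\<^sup>2) \<partial>lborel)"
        using nn_integral_lborel_scale[of "\<lambda>x. ennreal ((u x)\<^sup>2)" t] True by simp
      also have "inverse (t ^ CARD('n)) = t powr (- 2 * a)"
        using True by (simp add: a_def powr_minus powr_realpow)
      also have "ennreal (t powr a) * (ennreal (t powr (- 2 * a)) * (\<integral>\<^sup>+x. ennreal ((u x)\<^sup>2) \<partial>lborel))
          = ennreal (t powr - a) * (\<integral>\<^sup>+x. ennreal ((u x)\<^sup>2) \<partial>lborel)"
        by (simp add: mult.assoc[symmetric] ennreal_mult[symmetric] powr_add[symmetric])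
      finally show ?thesis using True by simp
    qed simp
  qed
  also have "\<dots> = ennreal C * (\<integral>\<^sup>+x. ennreal ((u x)\<^sup>2) \<partial>lborel)"
    by (simp add: nn_integral_multc C)
  also have "ennreal C * (ennreal C * (\<integral>\<^sup>+x. ennreal ((u x)\<^sup>2) \<partial>lborel)) = ennreal ((2 / (real CARD('n) - 2))\<^sup>2) * (\<integral>\<^sup>+x. ennreal ((u x)\<^sup>2) \<partial>lborel)"
  proof -
    have "C = 2 / (real CARD('n) - 2)" using n by (simp add: C_def a_def field_simps)
    moreover have "C \<ge> 0" using a by (simp add: C_def)
    ultimately show ?thesis
      by (metis (no_types, lifting) ennreal_mult mult.assoc power2_eq_square)
  qed
  finally show ?thesis .
qed

text \<open>Extended-valued, since finiteness at almost every point is itself a consequence of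
  \<open>Hardy_tail\<close>.\<close>

definition ray_tail :: "(real ^ 'n \<Rightarrow> complex ^ 'n) \<Rightarrow> real ^ 'n \<Rightarrow> ennreal" where
  "ray_tail g x = (\<integral>\<^sup>+t. indicator {1..} t * ennreal (norm (g (t *\<^sub>R x))) \<partial>lborel)"

lemma ray_tail_measurable [measurable]:
  assumes [measurable]: "g \<in> borel_measurable borel"
  shows "ray_tail g \<in> borel_measurable borel"
  unfolding ray_tail_def[abs_def] by measurable

lemma ray_tail_L2:
  fixes g :: "real ^ 'n \<Rightarrow> complex ^ 'n"
  assumes n: "CARD('n) \<ge> 3" and g: "L2 lborel g"
  shows "L2 lborel (\<lambda>x. enn2real (ray_tail g x))" "AE x in lborel. ray_tail g x < \<infinity>"
    "L2sq lborel (\<lambda>x. enn2real (ray_tail g x)) \<le> (2 / (real CARD('n) - 2))\<^sup>2 * L2sq lborel g"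
proof -
  have [measurable]: "g \<in> borel_measurable borel" using L2_measurable[OF g] by simp
  define C where "C = (2 / (real CARD('n) - 2))\<^sup>2"
  have *: "(\<integral>\<^sup>+x. (ray_tail g x)\<^sup>2 \<partial>lborel) \<le> ennreal (C * L2sq lborel g)"
    using Hardy_tail[OF n, of "\<lambda>x. norm (g x)"] L2_integrable[OF g]
    by (simp add: C_def ray_tail_def L2sq_def ennreal_mult nn_integral_eq_integral)
  then have "(\<integral>\<^sup>+x. (ray_tail g x)\<^sup>2 \<partial>lborel) \<noteq> \<infinity>" by (auto simp: top_unique)
  moreover have "(\<lambda>x. (ray_tail g x)\<^sup>2) \<in> borel_measurable lborel" by measurable
  ultimately have "AE x in lborel. (ray_tail g x)\<^sup>2 \<noteq> \<infinity>"
    using nn_integral_PInf_AE by blast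
  then show fin: "AE x in lborel. ray_tail g x < \<infinity>"
    by eventually_elim (auto simp: less_top[symmetric] ennreal_top_mult power2_eq_square)
  have eq: "(\<integral>\<^sup>+x. ennreal ((norm (enn2real (ray_tail g x)))\<^sup>2) \<partial>lborel) = (\<integral>\<^sup>+x. (ray_tail g x)\<^sup>2 \<partial>lborel)"
  proof (rule nn_integral_cong_AE)
    show "AE x in lborel. ennreal ((norm (enn2real (ray_tail g x)))\<^sup>2) = (ray_tail g x)\<^sup>2"
      using fin by eventually_elim (simp add: ennreal_power[symmetric])
  qed
  have "integrable lborel (\<lambda>x. (norm (enn2real (ray_tail g x)))\<^sup>2)"
    by (rule integrableI_bounded) (use eq * in \<open>auto intro: le_less_trans\<close>)
  then show L: "L2 lborel (\<lambda>x. enn2real (ray_tail g x))"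
    unfolding L2_def by simp
  have "ennreal (L2sq lborel (\<lambda>x. enn2real (ray_tail g x))) \<le> ennreal (C * L2sq lborel g)"
    using * unfolding eq[symmetric] by (simp add: L2sq_def nn_integral_eq_integral L2_integrable[OF L, simplified])
  then show "L2sq lborel (\<lambda>x. enn2real (ray_tail g x)) \<le> C * L2sq lborel g"
    by (simp add: ennreal_le_iff C_def L2sq_nonneg)
qed

lemma test_divergence:
  fixes \<psi> :: "real ^ 'n \<Rightarrow> real"
  assumes \<psi>: "\<psi> \<in> test_functions"
  shows "(\<lambda>x. real CARD('n) * \<psi> x + (\<Sum>i\<in>UNIV. x $ i * pdiff i \<psi> x)) \<in> test_functions" (is "?D \<in> _")
proof -
  have "{x. ?D x \<noteq> 0} \<subseteq> {x. \<psi> x \<noteq> 0} \<union> (\<Union>i. {x. pdiff i \<psi> x \<noteq> 0})"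
  proof
    fix x assume "x \<in> {x. ?D x \<noteq> 0}"
    moreover have "?D x = 0" if "\<psi> x = 0" "\<And>i. pdiff i \<psi> x = 0" using that by simp
    ultimately show "x \<in> {x. \<psi> x \<noteq> 0} \<union> (\<Union>i. {x. pdiff i \<psi> x \<noteq> 0})" by blast
  qed
  then have "bounded {x. ?D x \<noteq> 0}"
    by (rule bounded_subset[rotated]) (use \<psi> test_functions_pdiff[OF \<psi>] in \<open>auto simp: test_functions_iff\<close>)
  moreover have "Ck k (\<lambda>x. \<Sum>i\<in>A. x $ i * pdiff i \<psi> x)" for k and A :: "'n set"
    using finite[of A]
    by (induction A rule: finite_induct)
       (use test_functions_pdiff[OF \<psi>] in \<open>auto simp: Ck_const test_functions_iff intro!: Ck_add Ck_mult Ck_nth\<close>)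
  then have "Ck k ?D" for k
    using \<psi> by (intro Ck_add Ck_mult Ck_const) (auto simp: test_functions_iff)
  ultimately show ?thesis by (simp add: test_functions_iff)
qed

text \<open>Summed over i this is the divergence of \<open>x \<psi>(x)\<close> evaluated at
  \<open>s *\<^sub>R y\<close>: the factor s from the chain rule is absorbed by the
  coordinate.\<close>

lemma pdiff_scaled_coordinate:
  fixes \<psi> :: "real ^ 'n \<Rightarrow> real"
  assumes \<psi>: "\<psi> \<in> test_functions"
  shows "pdiff i (\<lambda>y. y $ i * \<psi> (s *\<^sub>R y)) y = \<psi> (s *\<^sub>R y) + (s *\<^sub>R y) $ i * pdiff i \<psi> (s *\<^sub>R y)"
proof -
  have "((\<lambda>y. s *\<^sub>R y) has_derivative (\<lambda>h. s *\<^sub>R h)) (at y)"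
    by (auto intro!: derivative_eq_intros)
  from has_derivative_compose[OF this has_derivative_pdiff[OF test_functions_differentiable[OF \<psi>]]]
  have "((\<lambda>y. \<psi> (s *\<^sub>R y)) has_derivative (\<lambda>h. \<Sum>j\<in>UNIV. h $ j * (s * pdiff j \<psi> (s *\<^sub>R y)))) (at y)"
    by (simp add: mult.assoc mult.left_commute[of s])
  from has_derivative_mult[OF bounded_linear_imp_has_derivative[OF bounded_linear_vec_nth[of i]] this]
  have "pdiff i (\<lambda>y. y $ i * \<psi> (s *\<^sub>R y)) y = y $ i * (\<Sum>j\<in>UNIV. axis i 1 $ j * (s * pdiff j \<psi> (s *\<^sub>R y))) + axis i 1 $ i * \<psi> (s *\<^sub>R y)"
    by (rule pdiff_eqI)
  then show ?thesis by (simp only: sum_axis_mult) (simp add: axis_def)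
qed

lemma test_functions_bounded:
  assumes "\<phi> \<in> test_functions"
  obtains B where "\<And>x. \<bar>\<phi> x\<bar> \<le> B"
proof -
  obtain B R where B: "0 < B" "\<And>x. \<bar>\<phi> x\<bar> \<le> B * indicator (ball 0 R) x"
    using test_functions_bound[OF assms] by metis
  have "\<bar>\<phi> x\<bar> \<le> B" for x
    using B(1) B(2)[of x] by (cases "x \<in> ball 0 R") auto
  then show ?thesis by (rule that)
qed

lemma integral_dilated_divergence:
  fixes \<psi> :: "real ^ 'n \<Rightarrow> real"
  assumes n: "CARD('n) \<ge> 3" and \<psi>: "\<psi> \<in> test_functions"
  defines "D \<equiv> \<lambda>x. real CARD('n) * \<psi> x + (\<Sum>i\<in>UNIV. x $ i * pdiff i \<psi> x)"
  shows "integrable lborel (\<lambda>t. indicator {1..} t * (t powr (- real CARD('n) - 1) * D (inverse t *\<^sub>R y)))"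
    and "(LINT t|lborel. indicator {1..} t * (t powr (- real CARD('n) - 1) * D (inverse t *\<^sub>R y))) = \<psi> y"
proof -
  let ?n = "real CARD('n)"
  let ?f = "\<lambda>t. t powr (- ?n - 1) * D (inverse t *\<^sub>R y)"
  let ?F = "\<lambda>t. - (t powr (- ?n) * \<psi> (inverse t *\<^sub>R y))"
  have DT: "D \<in> test_functions" unfolding D_def by (rule test_divergence[OF \<psi>])
  have [measurable]: "D \<in> borel_measurable borel" by (rule test_functions_borel[OF DT])
  obtain B where B: "\<And>x. \<bar>D x\<bar> \<le> B"
    using test_functions_bounded[OF DT] by metis
  obtain B' where B': "\<And>x. \<bar>\<psi> x\<bar> \<le> B'"
    using test_functions_bounded[OF \<psi>] by metis
  have deriv: "(?F has_vector_derivative ?f t) (at t)" if t: "t > 0" for t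
  proof -
    have 1: "((\<lambda>t. inverse t *\<^sub>R y) has_derivative (\<lambda>h. (- (h * inverse t * inverse t)) *\<^sub>R y)) (at t)"
      using t by (auto intro!: derivative_eq_intros simp: field_simps)
    have "((\<lambda>t. \<psi> (inverse t *\<^sub>R y)) has_derivative
        (\<lambda>h. \<Sum>i\<in>UNIV. ((- (h * inverse t * inverse t)) *\<^sub>R y) $ i * pdiff i \<psi> (inverse t *\<^sub>R y))) (at t)"
      by (rule has_derivative_compose[OF 1 has_derivative_pdiff[OF test_functions_differentiable[OF \<psi>]]])
    moreover have "(\<lambda>h. \<Sum>i\<in>UNIV. ((- (h * inverse t * inverse t)) *\<^sub>R y) $ i * pdiff i \<psi> (inverse t *\<^sub>R y))
       = (*) (- inverse t * (\<Sum>i\<in>UNIV. (inverse t *\<^sub>R y) $ i * pdiff i \<psi> (inverse t *\<^sub>R y)))"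
      by (auto simp: fun_eq_iff sum_distrib_left sum_distrib_right sum_negf[symmetric] mult_ac intro!: sum.cong)
    ultimately have d\<psi>: "((\<lambda>t. \<psi> (inverse t *\<^sub>R y)) has_real_derivative
        - inverse t * (\<Sum>i\<in>UNIV. (inverse t *\<^sub>R y) $ i * pdiff i \<psi> (inverse t *\<^sub>R y))) (at t)"
      by (simp only: has_field_derivative_def)
    have dp: "((\<lambda>t. t powr (- ?n)) has_real_derivative (- ?n) * t powr (- ?n - 1)) (at t)"
      by (rule has_real_derivative_powr[OF t])
    have tt: "t powr (- ?n) * inverse t = t powr (- ?n - 1)"
      using t by (simp add: powr_diff field_simps)
    show ?thesis
      unfolding has_real_derivative_iff_has_vector_derivative[symmetric]
      by (rule DERIV_cong[OF DERIV_minus[OF DERIV_mult[OF dp d\<psi>]]])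
         (simp add: D_def tt[symmetric] algebra_simps)
  qed
  have fi: "set_integrable lborel {1..} ?f"
    unfolding set_integrable_def
  proof (rule Bochner_Integration.integrable_bound)
    have "(\<integral>\<^sup>+t. ennreal (B * (indicator {1..} t * t powr - (?n + 1))) \<partial>lborel)
        = ennreal B * (\<integral>\<^sup>+t. indicator {1..} t * ennreal (t powr - (?n + 1)) \<partial>lborel)"
      using B[of 0] by (simp add: ennreal_mult' nn_integral_cmult ennreal_indicator)
    also have "\<dots> < \<infinity>"
      by (subst nn_integral_powr_atLeast) (use n in \<open>auto simp: ennreal_mult_less_top\<close>)
    finally show "integrable lborel (\<lambda>t. B * (indicator {1..} t * t powr - (?n + 1)))"
      using B[of 0] by (intro integrableI_nonneg) (auto intro!: AE_I2)
    show "AE t in lborel. norm (indicator {1..} t *\<^sub>R ?f t) \<le> norm (B * (indicator {1..} t * t powr - (?n + 1)))"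
      using order_trans[OF B abs_ge_self] by (intro AE_I2) (auto simp: indicator_def abs_mult mult.commute intro!: mult_right_mono)
  qed measurable
  then show "integrable lborel (\<lambda>t. indicator {1..} t * (t powr (- ?n - 1) * D (inverse t *\<^sub>R y)))"
    by (simp add: set_integrable_def)
  have "((\<lambda>T. LINT t:{1..T}|lborel. ?f t) \<longlongrightarrow> (LINT t:{1..}|lborel. ?f t)) at_top"
    by (rule tendsto_set_lebesgue_integral_at_top[OF _ fi]) auto
  moreover have "eventually (\<lambda>T. (LINT t:{1..T}|lborel. ?f t) = ?F T - ?F 1) at_top"
  proof (rule eventually_mono[OF eventually_ge_at_top[of 1]])
    fix T :: real assume "T \<ge> 1"
    have "(\<integral>t. ?f t * indicator {1..T} t \<partial>lborel) = ?F T - ?F 1"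
    proof (rule integral_FTC_Icc_real[OF \<open>T \<ge> 1\<close>])
      show "DERIV ?F t :> ?f t" if "1 \<le> t" "t \<le> T" for t
        using deriv[of t] that by (simp add: has_real_derivative_iff_has_vector_derivative)
      have "continuous_on {0<..} ?f"
        by (intro continuous_intros continuous_on_compose2[OF test_functions_continuous[OF DT]]) auto
      then show "isCont ?f t" if "1 \<le> t" "t \<le> T" for t
        using that by (auto simp: continuous_on_eq_continuous_at)
    qed
    then show "(LINT t:{1..T}|lborel. ?f t) = ?F T - ?F 1"
      by (simp add: set_lebesgue_integral_def mult.commute)
  qed
  ultimately have "((\<lambda>T. ?F T - ?F 1) \<longlongrightarrow> (LINT t:{1..}|lborel. ?f t)) at_top"
    by (rule Lim_transform_eventually)
  \<comment> \<open>A bounded function times t^-d vanishes at infinity, so the only boundary term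
    left is the one at t = 1, and \<open>?F 1\<close> is minus the value of the test function at
    y.\<close>
  moreover have "((\<lambda>T. ?F T - ?F 1) \<longlongrightarrow> 0 - ?F 1) at_top"
  proof (intro tendsto_diff tendsto_const)
    have "((\<lambda>T. T powr (- ?n) * B') \<longlongrightarrow> 0 * B') at_top"
      by (intro tendsto_intros tendsto_neg_powr filterlim_ident) (use n in auto)
    then have "((\<lambda>T. T powr (- ?n) * B') \<longlongrightarrow> 0) at_top" by simp
    then show "(?F \<longlongrightarrow> 0) at_top"
      by (rule Lim_null_comparison[rotated])
         (auto simp: abs_mult B' intro!: always_eventually mult_left_mono)
  qed
  ultimately have "(LINT t:{1..}|lborel. ?f t) = 0 - ?F 1"
    using tendsto_unique[OF trivial_limit_at_top_linorder] by blast
  then show "(LINT t|lborel. indicator {1..} t * (t powr (- ?n - 1) * D (inverse t *\<^sub>R y))) = \<psi> y"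
    by (simp add: set_lebesgue_integral_def)
qed

section \<open>The ray representation of functions in H1\<close>

definition ray_integral :: "(real ^ 'n \<Rightarrow> complex ^ 'n) \<Rightarrow> real ^ 'n \<Rightarrow> complex" where
  "ray_integral g x = (LINT t|lborel. indicator {1..} t *\<^sub>R cdot x (g (t *\<^sub>R x)))"

lemma ray_integral_measurable [measurable]:
  assumes [measurable]: "g \<in> borel_measurable borel"
  shows "ray_integral g \<in> borel_measurable borel"
  unfolding ray_integral_def[abs_def] by measurable

lemma norm_ray_integral_le:
  fixes g :: "real ^ 'n \<Rightarrow> complex ^ 'n"
  assumes [measurable]: "g \<in> borel_measurable borel" and fin: "ray_tail g x < \<infinity>"
  shows "norm (ray_integral g x) \<le> norm x * enn2real (ray_tail g x)"
proof (cases "integrable lborel (\<lambda>t. indicator {1..} t *\<^sub>R cdot x (g (t *\<^sub>R x)))")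
  case True
  have "ennreal (norm (ray_integral g x)) \<le> (\<integral>\<^sup>+t. ennreal (norm (indicator {1..} t *\<^sub>R cdot x (g (t *\<^sub>R x)))) \<partial>lborel)"
    unfolding ray_integral_def by (rule integral_norm_bound_ennreal[OF True])
  also have "\<dots> \<le> (\<integral>\<^sup>+t. ennreal (norm x) * (indicator {1..} t * ennreal (norm (g (t *\<^sub>R x)))) \<partial>lborel)"
    by (intro nn_integral_mono) (auto simp: indicator_def ennreal_mult[symmetric] norm_cdot_le intro!: ennreal_leI)
  also have "\<dots> = ennreal (norm x) * ray_tail g x"
    unfolding ray_tail_def by (rule nn_integral_cmult) measurable
  also have "\<dots> = ennreal (norm x * enn2real (ray_tail g x))"
    using fin by (simp add: ennreal_mult)
  finally show ?thesis by (simp add: ennreal_le_iff)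
next
  case False
  \<comment> \<open>A Bochner integral that does not exist has the value 0, for which the bound is
    trivial.\<close>
  then show ?thesis by (simp add: ray_integral_def not_integrable_integral_eq)
qed

text \<open>The substitution y = t x moves the dilation to the test function, and each
  \<open>y $ i * \<psi> (inverse t *\<^sub>R y)\<close> is again a test function, so the definition
  of the weak gradient applies to every component. In the exponent, -d is the Jacobian and -1 comes
  from x = y/t.\<close>

lemma integral_test_ray:
  fixes v :: "real ^ 'n \<Rightarrow> complex"
  assumes W: "weak_pair v g" and \<psi>: "\<psi> \<in> test_functions" and t: "t \<ge> 1"
  defines "D \<equiv> \<lambda>x. real CARD('n) * \<psi> x + (\<Sum>i\<in>UNIV. x $ i * pdiff i \<psi> x)"
  shows "(LINT x|lborel. \<psi> x *\<^sub>R cdot x (g (t *\<^sub>R x))) = - (t powr (- real CARD('n) - 1) *\<^sub>R (LINT y|lborel. D (inverse t *\<^sub>R y) *\<^sub>R v y))"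
proof -
  have L: "L2 lborel v" "L2 lborel g" using W by (auto simp: weak_pair_def)
  note [measurable] = L[THEN L2_measurable, unfolded measurable_lborel2] test_functions_borel[OF \<psi>]
  define \<xi> where "\<xi> i y = y $ i * \<psi> (inverse t *\<^sub>R y)" for i and y :: "real ^ 'n"
  have \<xi>: "\<xi> i \<in> test_functions" for i
    unfolding \<xi>_def[abs_def] using t by (intro test_functions_mult test_functions_scale \<psi> Ck_nth) auto
  have "(LINT x|lborel. \<psi> x *\<^sub>R cdot x (g (t *\<^sub>R x))) = (LINT x|lborel. (\<lambda>y. \<psi> (inverse t *\<^sub>R y) *\<^sub>R cdot (inverse t *\<^sub>R y) (g y)) (t *\<^sub>R x))"
    using t by simp
  also have "\<dots> = inverse (t ^ CARD('n)) *\<^sub>R (LINT y|lborel. \<psi> (inverse t *\<^sub>R y) *\<^sub>R cdot (inverse t *\<^sub>R y) (g y))"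
    by (subst integral_lborel_scale) (use t in auto)
  also have "(LINT y|lborel. \<psi> (inverse t *\<^sub>R y) *\<^sub>R cdot (inverse t *\<^sub>R y) (g y)) = (LINT y|lborel. inverse t *\<^sub>R (\<Sum>i\<in>UNIV. \<xi> i y *\<^sub>R (g y $ i)))"
    by (simp only: cdot_scaleR_left) (simp add: cdot_def \<xi>_def scaleR_sum_right mult_ac)
  also have "\<dots> = inverse t *\<^sub>R (\<Sum>i\<in>UNIV. LINT y|lborel. \<xi> i y *\<^sub>R (g y $ i))"
    by (simp add: test_functions_integrable[OF \<xi> L2_nth[OF L(2)]])
  also have "(\<Sum>i\<in>UNIV. LINT y|lborel. \<xi> i y *\<^sub>R (g y $ i)) = (\<Sum>i\<in>UNIV. - (LINT y|lborel. pdiff i (\<xi> i) y *\<^sub>R v y))"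
    using W \<xi> by (simp add: weak_pair_def)
  also have "\<dots> = - (LINT y|lborel. (\<Sum>i\<in>UNIV. pdiff i (\<xi> i) y *\<^sub>R v y))"
    by (simp add: sum_negf test_functions_integrable[OF test_functions_pdiff[OF \<xi>] L(1)])
  also have "(\<lambda>y. \<Sum>i\<in>UNIV. pdiff i (\<xi> i) y *\<^sub>R v y) = (\<lambda>y. D (inverse t *\<^sub>R y) *\<^sub>R v y)"
    by (auto simp: fun_eq_iff D_def \<xi>_def[abs_def] pdiff_scaled_coordinate[OF \<psi>] scaleR_sum_left[symmetric] sum.distrib)
  also have "inverse (t ^ CARD('n)) *\<^sub>R inverse t *\<^sub>R - (LINT y|lborel. D (inverse t *\<^sub>R y) *\<^sub>R v y)
      = - ((inverse (t ^ CARD('n)) * inverse t) *\<^sub>R (LINT y|lborel. D (inverse t *\<^sub>R y) *\<^sub>R v y))"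
    by simp
  also have "inverse (t ^ CARD('n)) * inverse t = t powr (- real CARD('n) - 1)"
    using t by (simp add: powr_diff powr_minus powr_realpow field_simps)
  finally show ?thesis .
qed

lemma test_functions_mult_norm_L2:
  fixes \<psi> :: "real ^ 'n \<Rightarrow> real"
  assumes \<psi>: "\<psi> \<in> test_functions"
  shows "L2 lborel (\<lambda>x. \<bar>\<psi> x\<bar> * norm x)"
proof -
  note [measurable] = test_functions_borel[OF \<psi>]
  obtain B R where B: "0 < B" "0 < R" "\<And>x. \<bar>\<psi> x\<bar> \<le> B * indicator (ball 0 R) x"
    using test_functions_bound[OF \<psi>] by metis
  show ?thesis
  proof (rule L2_bound[OF test_functions_L2[OF \<psi>], of _ R])
    have "\<bar>\<psi> x\<bar> * norm x \<le> R * \<bar>\<psi> x\<bar>" for x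
      using B(3)[of x] by (cases "x \<in> ball 0 R") (auto simp: mult.commute[of R] intro!: mult_left_mono)
    then show "AE x in lborel. norm (\<bar>\<psi> x\<bar> * norm x) \<le> R * norm (\<psi> x)" by simp
  qed measurable
qed

lemma integrable_ray_test:
  fixes g :: "real ^ 'n \<Rightarrow> complex ^ 'n"
  assumes n: "CARD('n) \<ge> 3" and g: "L2 lborel g" and \<psi>: "\<psi> \<in> test_functions"
  shows "integrable (lborel \<Otimes>\<^sub>M lborel) (\<lambda>(x, t). indicator {1..} t *\<^sub>R (\<psi> x *\<^sub>R cdot x (g (t *\<^sub>R x))))"
proof -
  note [measurable] = g[THEN L2_measurable, unfolded measurable_lborel2] test_functions_borel[OF \<psi>]
  note L = test_functions_mult_norm_L2[OF \<psi>]
  have "(\<integral>\<^sup>+z. ennreal (norm (case z of (x, t) \<Rightarrow> indicator {1..} t *\<^sub>R (\<psi> x *\<^sub>R cdot x (g (t *\<^sub>R x))))) \<partial>(lborel \<Otimes>\<^sub>M lborel))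
     = (\<integral>\<^sup>+x. \<integral>\<^sup>+t. ennreal (norm (indicator {1..} t *\<^sub>R (\<psi> x *\<^sub>R cdot x (g (t *\<^sub>R x))))) \<partial>lborel \<partial>lborel)"
    by (subst lborel.nn_integral_fst[symmetric]) (auto simp: case_prod_beta)
  also have "\<dots> \<le> (\<integral>\<^sup>+x. \<integral>\<^sup>+t. ennreal (\<bar>\<psi> x\<bar> * norm x) * (indicator {1..} t * ennreal (norm (g (t *\<^sub>R x)))) \<partial>lborel \<partial>lborel)"
    by (intro nn_integral_mono)
       (auto simp: indicator_def ennreal_mult[symmetric] norm_cdot_le mult.assoc intro!: ennreal_leI mult_left_mono)
  also have "\<dots> = (\<integral>\<^sup>+x. ennreal (\<bar>\<psi> x\<bar> * norm x) * ray_tail g x \<partial>lborel)"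
    unfolding ray_tail_def by (intro nn_integral_cong nn_integral_cmult) measurable
  also have "\<dots> = (\<integral>\<^sup>+x. ennreal (norm (\<bar>\<psi> x\<bar> * norm x) * norm (enn2real (ray_tail g x))) \<partial>lborel)"
  proof (rule nn_integral_cong_AE)
    show "AE x in lborel. ennreal (\<bar>\<psi> x\<bar> * norm x) * ray_tail g x = ennreal (norm (\<bar>\<psi> x\<bar> * norm x) * norm (enn2real (ray_tail g x)))"
      using ray_tail_L2(2)[OF n g] by eventually_elim (simp add: ennreal_mult)
  qed
  also have "\<dots> < \<infinity>"
    using L2_integrable_norm_mult[OF L ray_tail_L2(1)[OF n g]] by (simp add: nn_integral_eq_integral)
  finally show ?thesis by (intro integrableI_bounded) measurable
qed

lemma integrable_dilated_product:
  fixes v :: "real ^ 'n \<Rightarrow> complex"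
  assumes n: "CARD('n) \<ge> 3" and v: "L2 lborel v" and D: "L2 lborel D"
  shows "integrable (lborel \<Otimes>\<^sub>M lborel) (\<lambda>(y, t). (indicator {1..} t * (t powr (- real CARD('n) - 1) * D (inverse t *\<^sub>R y))) *\<^sub>R v y)"
    (is "integrable _ (\<lambda>(y, t). ?G y t)")
proof -
  note [measurable] = v[THEN L2_measurable, unfolded measurable_lborel2] D[THEN L2_measurable, unfolded measurable_lborel2]
  \<comment> \<open>The squared L2 norm of a dilate by t grows like t^d. Splitting the product with
    the weight t^a, a = d/2, gives both terms the size t^a, and the prefactor t^(-2a-1) leaves the
    integrable power t^-(a+1).\<close>
  define a where "a = real CARD('n) / 2"
  define K where "K = L2sq lborel D + L2sq lborel v"
  have K: "K \<ge> 0" by (simp add: K_def L2sq_nonneg)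
  have le: "(\<integral>\<^sup>+y. ennreal (norm (?G y t)) \<partial>lborel) \<le> ennreal K * (indicator {1..} t * ennreal (t powr - (a + 1)))" for t
  proof (cases "t \<ge> 1")
    case True
    have amgm: "p * q \<le> inverse s * p\<^sup>2 + s * q\<^sup>2" if "s > 0" "p \<ge> 0" "q \<ge> 0" for p q s :: real
    proof -
      have "0 \<le> inverse s * (p - s * q)\<^sup>2" using that by simp
      also have "\<dots> = inverse s * p\<^sup>2 + s * q\<^sup>2 - 2 * p * q"
        using that by (simp add: power2_eq_square field_simps)
      finally show ?thesis using mult_nonneg_nonneg[OF that(2,3)] by linarith
    qed
    have "(\<integral>\<^sup>+y. ennreal (norm (?G y t)) \<partial>lborel)
       = (\<integral>\<^sup>+y. ennreal (t powr (- 2 * a - 1)) * ennreal (\<bar>D (inverse t *\<^sub>R y)\<bar> * norm (v y)) \<partial>lborel)"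
      using True by (intro nn_integral_cong) (simp add: a_def abs_mult ennreal_mult[symmetric] mult.assoc)
    also have "\<dots> = ennreal (t powr (- 2 * a - 1)) * (\<integral>\<^sup>+y. ennreal (\<bar>D (inverse t *\<^sub>R y)\<bar> * norm (v y)) \<partial>lborel)"
      by (rule nn_integral_cmult) measurable
    also have "(\<integral>\<^sup>+y. ennreal (\<bar>D (inverse t *\<^sub>R y)\<bar> * norm (v y)) \<partial>lborel)
        \<le> (\<integral>\<^sup>+y. ennreal (t powr - a * (D (inverse t *\<^sub>R y))\<^sup>2) + ennreal (t powr a * (norm (v y))\<^sup>2) \<partial>lborel)"
      using amgm[of "t powr a"] True
      by (intro nn_integral_mono) (simp add: ennreal_plus[symmetric] powr_minus del: ennreal_plus, metis abs_ge_zero norm_ge_zero power2_abs)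
    also have "\<dots> = (\<integral>\<^sup>+y. ennreal (t powr - a * (D (inverse t *\<^sub>R y))\<^sup>2) \<partial>lborel) + (\<integral>\<^sup>+y. ennreal (t powr a * (norm (v y))\<^sup>2) \<partial>lborel)"
      by (rule nn_integral_add) measurable
    also have "(\<integral>\<^sup>+y. ennreal (t powr a * (norm (v y))\<^sup>2) \<partial>lborel) = ennreal (t powr a * L2sq lborel v)"
      by (subst nn_integral_eq_integral) (auto simp: L2sq_def L2_integrable[OF v])
    also have "(\<integral>\<^sup>+y. ennreal (t powr - a * (D (inverse t *\<^sub>R y))\<^sup>2) \<partial>lborel) = ennreal (t powr a * L2sq lborel D)"
    proof -
      have "(\<integral>\<^sup>+y. ennreal (t powr - a * (D (inverse t *\<^sub>R y))\<^sup>2) \<partial>lborel)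
          = ennreal (inverse (inverse t ^ CARD('n))) * (\<integral>\<^sup>+y. ennreal (t powr - a * (D y)\<^sup>2) \<partial>lborel)"
        using nn_integral_lborel_scale[of "\<lambda>y. ennreal (t powr - a * (D y)\<^sup>2)" "inverse t"] True by simp
      also have "(\<integral>\<^sup>+y. ennreal (t powr - a * (D y)\<^sup>2) \<partial>lborel) = ennreal (t powr - a * L2sq lborel D)"
        using L2_integrable[OF D] by (subst nn_integral_eq_integral) (auto simp: L2sq_def)
      also have "inverse (inverse t ^ CARD('n)) = t powr (2 * a)"
        using True by (simp add: a_def powr_realpow power_inverse)
      also have "ennreal (t powr (2 * a)) * ennreal (t powr - a * L2sq lborel D) = ennreal ((t powr (2 * a) * t powr - a) * L2sq lborel D)"
        by (simp add: ennreal_mult[symmetric] L2sq_nonneg mult.assoc)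
      also have "t powr (2 * a) * t powr - a = t powr a"
        by (simp add: powr_add[symmetric])
      finally show ?thesis .
    qed
    also have "ennreal (t powr a * L2sq lborel D) + ennreal (t powr a * L2sq lborel v) = ennreal (t powr a * K)"
      by (simp add: K_def L2sq_nonneg ennreal_plus[symmetric] distrib_left del: ennreal_plus)
    also have "ennreal (t powr (- 2 * a - 1)) * ennreal (t powr a * K) = ennreal (K * (t powr (- 2 * a - 1) * t powr a))"
      using K by (simp add: ennreal_mult[symmetric] mult_ac)
    also have "t powr (- 2 * a - 1) * t powr a = t powr - (a + 1)"
      by (simp add: powr_add[symmetric])
    finally show ?thesis
      using True K by (simp add: ennreal_mult mult_left_mono)
  qed simp
  have "(\<integral>\<^sup>+z. ennreal (norm (case z of (y, t) \<Rightarrow> ?G y t)) \<partial>(lborel \<Otimes>\<^sub>M lborel))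
     = (\<integral>\<^sup>+t. \<integral>\<^sup>+y. ennreal (norm (?G y t)) \<partial>lborel \<partial>lborel)"
    by (subst lborel_pair.nn_integral_snd[symmetric]) (auto simp: case_prod_beta)
  also have "\<dots> \<le> (\<integral>\<^sup>+t. ennreal K * (indicator {1..} t * ennreal (t powr - (a + 1))) \<partial>lborel)"
    by (intro nn_integral_mono le)
  also have "\<dots> = ennreal K * (\<integral>\<^sup>+t. indicator {1..} t * ennreal (t powr - (a + 1)) \<partial>lborel)"
    by (rule nn_integral_cmult) measurable
  also have "\<dots> < \<infinity>"
    by (subst nn_integral_powr_atLeast) (use n in \<open>auto simp: a_def ennreal_mult_less_top\<close>)
  finally show ?thesis by (intro integrableI_bounded) measurable
qed

theorem ray_representation:
  fixes v :: "real ^ 'n \<Rightarrow> complex"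
  assumes n: "CARD('n) \<ge> 3" and W: "weak_pair v g"
  shows "AE x in lborel. v x = - ray_integral g x"
proof -
  have L: "L2 lborel v" "L2 lborel g" using W by (auto simp: weak_pair_def)
  note [measurable] = L[THEN L2_measurable, unfolded measurable_lborel2]
  have wbound: "AE x in lborel. norm (ray_integral g x) \<le> norm x * enn2real (ray_tail g x)"
    using ray_tail_L2(2)[OF n L(2)] by eventually_elim (simp add: norm_ray_integral_le)
  \<comment> \<open>The ray integral is dominated by the norm of x times a square integrable
    function, and on a ball the factor \<open>norm x\<close> is harmless. Boxes and test functions
    both need this local integrability.\<close>
  have wint: "integrable lborel (\<lambda>x. f x *\<^sub>R ray_integral g x)"
    if [measurable]: "f \<in> borel_measurable borel" and f: "\<And>x. \<bar>f x\<bar> \<le> B * indicator (ball 0 R) x" "B > 0" "R > 0" for f B R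
  proof (rule L2_integrable_mult_bound[OF _ ray_tail_L2(1)[OF n L(2)]])
    have fb: "\<bar>f x\<bar> * norm x \<le> (B * R) * indicator (ball 0 R) x" for x
      using f(1)[of x] mult_mono[OF f(1)[of x], of "norm x" R] f(2,3) by (cases "x \<in> ball 0 R") auto
    have iL: "L2 lborel (indicator (ball 0 R) :: real ^ 'n \<Rightarrow> real)"
      by (rule L2_indicator) (use emeasure_lborel_ball_finite in auto)
    show "L2 lborel (\<lambda>x. \<bar>f x\<bar> * norm x)"
      by (rule L2_bound[OF iL, of _ "B * R"]) (use fb f in auto)
    show "AE x in lborel. norm (f x *\<^sub>R ray_integral g x) \<le> norm (\<bar>f x\<bar> * norm x) * norm (enn2real (ray_tail g x))"
      using wbound by eventually_elim (simp add: mult.assoc mult_left_mono)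
  qed measurable
  have "AE x in lborel. v x + ray_integral g x = 0"
  proof (rule AE_zero_if_test_integrals_zero)
    fix a b :: "real ^ 'n"
    obtain R where R: "R > 0" "box a b \<subseteq> ball 0 R"
      using bounded_box[of a b] bounded_subset_ballD by blast
    have "integrable lborel (\<lambda>x. indicator (box a b) x *\<^sub>R ray_integral g x)"
      by (rule wint[of _ 1 R]) (use R in \<open>auto simp: indicator_def\<close>)
    then show "set_integrable lborel (box a b) (\<lambda>x. v x + ray_integral g x)"
      using L2_set_integrable_box[OF L(1), of a b] unfolding set_integrable_def by (simp add: scaleR_add_right)
  next
    fix \<psi> :: "real ^ 'n \<Rightarrow> real" assume \<psi>: "\<psi> \<in> test_functions"
    note [measurable] = test_functions_borel[OF \<psi>]
    define D where "D x = real CARD('n) * \<psi> x + (\<Sum>i\<in>UNIV. x $ i * pdiff i \<psi> x)" for x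
    have DT: "D \<in> test_functions" unfolding D_def[abs_def] by (rule test_divergence[OF \<psi>])
    have "(LINT x|lborel. \<psi> x *\<^sub>R ray_integral g x) = (LINT x|lborel. LINT t|lborel. indicator {1..} t *\<^sub>R (\<psi> x *\<^sub>R cdot x (g (t *\<^sub>R x))))"
      unfolding ray_integral_def integral_scaleR_right[symmetric] by (simp add: mult.commute)
    also have "\<dots> = (LINT t|lborel. LINT x|lborel. indicator {1..} t *\<^sub>R (\<psi> x *\<^sub>R cdot x (g (t *\<^sub>R x))))"
      by (rule lborel_pair.Fubini_integral[symmetric]) (rule integrable_ray_test[OF n L(2) \<psi>])
    also have "\<dots> = (LINT t|lborel. - (LINT y|lborel. (indicator {1..} t * (t powr (- real CARD('n) - 1) * D (inverse t *\<^sub>R y))) *\<^sub>R v y))"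
    proof (rule Bochner_Integration.integral_cong[OF refl])
      fix t :: real
      have "(LINT x|lborel. \<psi> x *\<^sub>R cdot x (g (t *\<^sub>R x))) = - (LINT y|lborel. t powr (- real CARD('n) - 1) *\<^sub>R (D (inverse t *\<^sub>R y) *\<^sub>R v y))" if "t \<ge> 1"
        unfolding integral_scaleR_right D_def by (rule integral_test_ray[OF W \<psi> that])
      then show "(LINT x|lborel. indicator {1..} t *\<^sub>R (\<psi> x *\<^sub>R cdot x (g (t *\<^sub>R x))))
          = - (LINT y|lborel. (indicator {1..} t * (t powr (- real CARD('n) - 1) * D (inverse t *\<^sub>R y))) *\<^sub>R v y)"
        by (cases "t \<ge> 1") simp_all
    qed
    also have "\<dots> = - (LINT t|lborel. LINT y|lborel. (indicator {1..} t * (t powr (- real CARD('n) - 1) * D (inverse t *\<^sub>R y))) *\<^sub>R v y)"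
      by simp
    also have "(LINT t|lborel. LINT y|lborel. (indicator {1..} t * (t powr (- real CARD('n) - 1) * D (inverse t *\<^sub>R y))) *\<^sub>R v y)
       = (LINT y|lborel. LINT t|lborel. (indicator {1..} t * (t powr (- real CARD('n) - 1) * D (inverse t *\<^sub>R y))) *\<^sub>R v y)"
      by (rule lborel_pair.Fubini_integral) (rule integrable_dilated_product[OF n L(1) test_functions_L2[OF DT]])
    also have "\<dots> = (LINT y|lborel. \<psi> y *\<^sub>R v y)"
      by (intro Bochner_Integration.integral_cong refl)
         (simp only: integral_scaleR_left[OF integral_dilated_divergence(1)[OF n \<psi>, folded D_def]]
            integral_dilated_divergence(2)[OF n \<psi>, folded D_def])
    finally have "(LINT x|lborel. \<psi> x *\<^sub>R ray_integral g x) = - (LINT y|lborel. \<psi> y *\<^sub>R v y)" .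
    moreover obtain B R where BR: "0 < B" "0 < R" "\<And>x. \<bar>\<psi> x\<bar> \<le> B * indicator (ball 0 R) x"
      using test_functions_bound[OF \<psi>] by metis
    have "integrable lborel (\<lambda>x. \<psi> x *\<^sub>R ray_integral g x)"
      by (rule wint[OF test_functions_borel[OF \<psi>] BR(3) BR(1) BR(2)])
    ultimately show "(LINT x|lborel. \<psi> x *\<^sub>R (v x + ray_integral g x)) = 0"
      by (simp add: scaleR_add_right test_functions_integrable[OF \<psi> L(1)])
  qed measurable
  then show ?thesis by eventually_elim (simp add: eq_neg_iff_add_eq_0)
qed

corollary Hardy_inequality:
  fixes v :: "real ^ 'n \<Rightarrow> complex"
  assumes n: "CARD('n) \<ge> 3" and W: "weak_pair v g"
  shows "L2 lborel (\<lambda>x. inverse (norm x) *\<^sub>R v x)"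
    and "L2sq lborel (\<lambda>x. inverse (norm x) *\<^sub>R v x) \<le> (2 / (real CARD('n) - 2))\<^sup>2 * L2sq lborel g"
proof -
  have L: "L2 lborel v" "L2 lborel g" using W by (auto simp: weak_pair_def)
  note [measurable] = L[THEN L2_measurable, unfolded measurable_lborel2]
  have b: "AE x in lborel. norm (inverse (norm x) *\<^sub>R v x) \<le> 1 * norm (enn2real (ray_tail g x))"
    using ray_representation[OF n W] ray_tail_L2(2)[OF n L(2)]
  proof eventually_elim
    case (elim x)
    have "norm (inverse (norm x) *\<^sub>R v x) \<le> inverse (norm x) * (norm x * enn2real (ray_tail g x))"
      using norm_ray_integral_le[of g x] elim by (auto intro!: mult_left_mono)
    also have "\<dots> \<le> enn2real (ray_tail g x)"
      by (cases "x = 0") (simp_all add: mult.assoc[symmetric])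
    finally show ?case by simp
  qed
  show LH: "L2 lborel (\<lambda>x. inverse (norm x) *\<^sub>R v x)"
    by (rule L2_bound[OF ray_tail_L2(1)[OF n L(2)] _ b]) measurable
  have "L2sq lborel (\<lambda>x. inverse (norm x) *\<^sub>R v x) \<le> L2sq lborel (\<lambda>x. enn2real (ray_tail g x))"
    unfolding L2sq_def
  proof (rule integral_mono_AE[OF L2_integrable[OF LH] L2_integrable[OF ray_tail_L2(1)[OF n L(2)]]])
    show "AE x in lborel. (norm (inverse (norm x) *\<^sub>R v x))\<^sup>2 \<le> (norm (enn2real (ray_tail g x)))\<^sup>2"
      using b by eventually_elim (intro power_mono, auto)
  qed
  also have "\<dots> \<le> (2 / (real CARD('n) - 2))\<^sup>2 * L2sq lborel g"
    by (rule ray_tail_L2(3)[OF n L(2)])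
  finally show "L2sq lborel (\<lambda>x. inverse (norm x) *\<^sub>R v x) \<le> (2 / (real CARD('n) - 2))\<^sup>2 * L2sq lborel g" .
qed

section \<open>Polar coordinates\<close>

text \<open>Normalized surface measure, obtained as the law of the direction of a uniformly
  distributed point of the unit ball.\<close>

definition sphere_measure :: "'a::euclidean_space measure" where
  "sphere_measure = distr (uniform_measure lborel (ball 0 1)) borel sgn"

text \<open>The area of the sphere of radius r. The whole area sits in the radial factor because
  \<open>sphere_measure\<close> is a probability measure.\<close>

definition radial_density :: "nat \<Rightarrow> real \<Rightarrow> real" where
  "radial_density n r = indicator {0<..} r * (real n * unit_ball_vol (real n) * r ^ (n - 1))"

definition radial_measure :: "nat \<Rightarrow> real measure" where
  "radial_measure n = density lborel (\<lambda>r. ennreal (radial_density n r))"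

lemma sgn_borel_measurable [measurable]: "(sgn :: 'a::euclidean_space \<Rightarrow> 'a) \<in> borel_measurable borel"
  unfolding sgn_div_norm[abs_def] by measurable

lemma sets_sphere_measure [simp, measurable_cong]: "sets sphere_measure = sets borel"
  by (simp add: sphere_measure_def)

lemma space_sphere_measure [simp]: "space sphere_measure = UNIV"
  by (simp add: sphere_measure_def)

lemma sets_radial_measure [simp, measurable_cong]: "sets (radial_measure n) = sets borel"
  by (simp add: radial_measure_def)

lemma space_radial_measure [simp]: "space (radial_measure n) = UNIV"
  by (simp add: radial_measure_def)

lemma radial_density_measurable [measurable]: "radial_density n \<in> borel_measurable borel"
  unfolding radial_density_def[abs_def] by measurable

lemma radial_density_nonneg: "0 \<le> radial_density n r"
  by (auto simp: radial_density_def indicator_def unit_ball_vol_nonneg)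

lemma prob_space_sphere_measure: "prob_space (sphere_measure :: 'a::euclidean_space measure)"
  unfolding sphere_measure_def
proof (rule prob_space.prob_space_distr[OF prob_space_uniform_measure])
  have "unit_ball_vol (real DIM('a)) \<noteq> 0"
    using unit_ball_vol_pos[of "real DIM('a)"] by (metis less_irrefl of_nat_0_le_iff)
  then
  show "emeasure lborel (ball (0::'a) 1) \<noteq> 0" "emeasure lborel (ball (0::'a) 1) \<noteq> \<infinity>"
    by (simp_all add: emeasure_ball)
qed measurable

lemma emeasure_radial_measure:
  assumes "n \<ge> 1"
  shows "emeasure (radial_measure n) {..a} = (if a \<le> 0 then 0 else ennreal (unit_ball_vol n * a ^ n))"
proof (cases "a \<le> 0")
  case True
  have "emeasure (radial_measure n) {..a} = (\<integral>\<^sup>+r. ennreal (radial_density n r) * indicator {..a} r \<partial>lborel)"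
    by (simp add: radial_measure_def emeasure_density)
  also have "\<dots> = (\<integral>\<^sup>+r. 0 \<partial>(lborel :: real measure))"
    using True by (intro nn_integral_cong) (auto simp: radial_density_def indicator_def)
  finally show ?thesis using True by simp
next
  case False
  let ?f = "\<lambda>r. real n * unit_ball_vol n * r ^ (n - 1)"
  let ?F = "\<lambda>r. unit_ball_vol n * r ^ n"
  have "emeasure (radial_measure n) {..a} = (\<integral>\<^sup>+r. ennreal (radial_density n r) * indicator {..a} r \<partial>lborel)"
    by (simp add: radial_measure_def emeasure_density)
  also have "\<dots> = (\<integral>\<^sup>+r. ennreal (?f r) * indicator {0..a} r \<partial>lborel)"
  proof (rule nn_integral_cong_AE)
    have "AE r in lborel. r \<noteq> (0::real)" by (rule AE_lborel_singleton)
    then show "AE r in lborel. ennreal (radial_density n r) * indicator {..a} r = ennreal (?f r) * indicator {0..a} r"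
      by eventually_elim (auto simp: radial_density_def indicator_def)
  qed
  also have "\<dots> = ennreal (?F a - ?F 0)"
  proof (rule nn_integral_FTC_Icc)
    show "DERIV ?F x :> ?f x" for x
      by (auto intro!: derivative_eq_intros)
  qed (use False in \<open>auto simp: unit_ball_vol_nonneg\<close>)
  finally show ?thesis using False assms by (simp add: zero_power)
qed

lemma sigma_finite_radial_measure:
  assumes "n \<ge> 1" shows "sigma_finite_measure (radial_measure n)"
proof
  show "\<exists>A. countable A \<and> A \<subseteq> sets (radial_measure n) \<and> \<Union> A = space (radial_measure n) \<and> (\<forall>a\<in>A. emeasure (radial_measure n) a \<noteq> \<infinity>)"
  proof (intro exI[of _ "range (\<lambda>i::nat. {..real i})"] conjI ballI)
    show "\<Union> (range (\<lambda>i::nat. {..real i})) = space (radial_measure n)"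
      using real_arch_simple by auto
  qed (auto simp: emeasure_radial_measure[OF assms] split: if_splits)
qed

lemma emeasure_cone:
  fixes B :: "'a::euclidean_space set"
  assumes [measurable]: "B \<in> sets borel" and a: "a > 0"
  shows "emeasure lborel (cball 0 a \<inter> sgn -` B) = ennreal (a ^ DIM('a)) * emeasure lborel (cball 0 1 \<inter> sgn -` B)"
proof -
  have [measurable]: "sgn -` B \<in> sets borel"
    using measurable_sets[OF sgn_borel_measurable assms(1)] by simp
  have "(\<integral>\<^sup>+x. indicator (cball 0 a \<inter> sgn -` B) (a *\<^sub>R x) \<partial>lborel)
      = ennreal (inverse (a ^ DIM('a))) * (\<integral>\<^sup>+x. indicator (cball 0 a \<inter> sgn -` B) x \<partial>lborel)"
    by (rule nn_integral_lborel_scale[OF _ a]) (intro borel_measurable_indicator sets.Int, auto)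
  also have "(\<lambda>x. indicator (cball 0 a \<inter> sgn -` B) (a *\<^sub>R x) :: ennreal) = indicator (cball 0 1 \<inter> sgn -` B)"
    using a by (auto simp: fun_eq_iff indicator_def sgn_scaleR)
  finally have "emeasure lborel (cball 0 1 \<inter> sgn -` B) = ennreal (inverse (a ^ DIM('a))) * emeasure lborel (cball 0 a \<inter> sgn -` B)"
    by simp
  then have "ennreal (a ^ DIM('a)) * emeasure lborel (cball 0 1 \<inter> sgn -` B)
      = (ennreal (a ^ DIM('a)) * ennreal (inverse (a ^ DIM('a)))) * emeasure lborel (cball 0 a \<inter> sgn -` B)"
    by (simp add: mult.assoc)
  also have "ennreal (a ^ DIM('a)) * ennreal (inverse (a ^ DIM('a))) = 1"
    using a by (simp add: ennreal_mult[symmetric])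
  finally show ?thesis by simp
qed

lemma emeasure_sphere_measure:
  fixes B :: "'a::euclidean_space set"
  assumes [measurable]: "B \<in> sets borel"
  shows "ennreal (unit_ball_vol DIM('a)) * emeasure sphere_measure B = emeasure lborel (cball 0 1 \<inter> sgn -` B)"
proof -
  have [measurable]: "sgn -` B \<in> sets borel"
    using measurable_sets[OF sgn_borel_measurable assms(1)] by simp
  have "emeasure sphere_measure B = emeasure lborel (ball 0 1 \<inter> sgn -` B) / ennreal (unit_ball_vol DIM('a))"
    by (simp add: sphere_measure_def emeasure_distr emeasure_uniform_measure emeasure_ball)
  then have "ennreal (unit_ball_vol DIM('a)) * emeasure sphere_measure B = emeasure lborel (ball 0 1 \<inter> sgn -` B)"
    by (metis emeasure_neq_0_sets ennreal_mult_divide_eq ennreal_neq_top ennreal_eq_0_iff mult.commute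
        ennreal_times_divide unit_ball_vol_pos not_le of_nat_0_le_iff)
  \<comment> \<open>Passing to the closed ball costs a null set and matches the closed half-lines
    \<open>{..a}\<close> that generate the Borel sets of radii.\<close>
  also have "\<dots> = emeasure lborel (cball 0 1 \<inter> sgn -` B)"
  proof (rule emeasure_eq_AE)
    have "sphere (0::'a) 1 \<in> null_sets lborel"
      using negligible_sphere[of "0::'a" 1] by (auto simp: null_sets_completion_iff negligible_iff_null_sets)
    then have "AE x in lborel. x \<notin> sphere (0::'a) 1" by (rule AE_not_in)
    then show "AE x in lborel. (x \<in> ball 0 1 \<inter> sgn -` B) = (x \<in> cball 0 1 \<inter> sgn -` B)"
      by eventually_elim auto
  qed measurable
  finally show ?thesis .
qed

text \<open>Homogeneity of Lebesgue measure carries the proof. For a fixed set B of directions both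
  sides are measures in the radius, and on the half-lines \<open>{..a}\<close> they compare the cone
  of radius a over B with the cone of radius 1, whose volumes differ by the factor a^d.\<close>

theorem polar_measure:
  "radial_measure DIM('a) \<Otimes>\<^sub>M (sphere_measure :: 'a::euclidean_space measure)
     = distr lborel (borel \<Otimes>\<^sub>M borel) (\<lambda>x. (norm x, sgn x))"
proof (rule pair_measure_eqI)
  let ?n = "DIM('a)"
  let ?S = "sphere_measure :: 'a measure"
  have n: "?n \<ge> 1" using DIM_positive by (simp add: Suc_le_eq)
  show "sigma_finite_measure (radial_measure ?n)" by (rule sigma_finite_radial_measure[OF n])
  show "sigma_finite_measure ?S"
    using prob_space_sphere_measure by (rule prob_space_imp_sigma_finite)
  show "sets (radial_measure ?n \<Otimes>\<^sub>M ?S) = sets (distr lborel (borel \<Otimes>\<^sub>M borel) (\<lambda>x::'a. (norm x, sgn x)))"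
    by (simp cong: sets_pair_measure_cong)
  fix A and B :: "'a set" assume "A \<in> sets (radial_measure ?n)" "B \<in> sets ?S"
  then have [measurable]: "A \<in> sets borel" "B \<in> sets borel" by auto
  have sB [measurable]: "sgn -` B \<in> sets borel"
    using measurable_sets[OF sgn_borel_measurable \<open>B \<in> sets borel\<close>] by simp
  define N1 where "N1 = distr (density lborel (indicator (sgn -` B))) borel (norm :: 'a \<Rightarrow> real)"
  define N2 where "N2 = density (radial_measure ?n) (\<lambda>_. emeasure ?S B)"
  have N1: "emeasure N1 X = emeasure lborel (norm -` X \<inter> sgn -` B)" if [measurable]: "X \<in> sets borel" for X
  proof -
    have [measurable]: "(norm :: 'a \<Rightarrow> real) -` X \<in> sets borel"
      using measurable_sets[of "norm :: 'a \<Rightarrow> real" borel borel X] by simp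
    show ?thesis
      by (simp add: N1_def emeasure_distr emeasure_density indicator_inter_arith[symmetric] Int_commute)
  qed
  have N2: "emeasure N2 X = emeasure ?S B * emeasure (radial_measure ?n) X" if [measurable]: "X \<in> sets borel" for X
    by (simp add: N2_def emeasure_density nn_integral_cmult)
  have "N1 = N2"
  proof (rule measure_eqI_generator_eq[of "range atMost" UNIV _ _ "\<lambda>i. {..real i}"])
    show "Int_stable (range (atMost :: real \<Rightarrow> _))"
      by (auto simp: Int_stable_def)
    show eq: "emeasure N1 X = emeasure N2 X" if rX: "X \<in> range atMost" for X
    proof -
      obtain a where X: "X = {..a}" using rX by blast
      consider "a < 0" | "a = 0" | "a > 0" by linarith
      then show ?thesis
      proof cases
        case 1
        then have "norm -` {..a} = ({} :: 'a set)" by (auto simp: not_le dest: order_trans[OF norm_ge_zero])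
        then show ?thesis using 1 by (simp add: X N1 N2 emeasure_radial_measure[OF n])
      next
        case 2
        then have "norm -` {..a} \<inter> sgn -` B \<subseteq> ({0} :: 'a set)" by auto
        then have "emeasure lborel (norm -` {..a} \<inter> sgn -` B :: 'a set) \<le> emeasure lborel {0::'a}"
          by (intro emeasure_mono) auto
        then show ?thesis using 2 by (simp add: X N1 N2 emeasure_radial_measure[OF n])
      next
        case 3
        have "norm -` {..a} = (cball 0 a :: 'a set)" by auto
        then have "emeasure N1 X = ennreal (a ^ ?n) * emeasure lborel (cball 0 1 \<inter> sgn -` B)"
          using emeasure_cone[of B a] 3 by (simp add: X N1)
        also have "\<dots> = emeasure ?S B * (ennreal (unit_ball_vol ?n) * ennreal (a ^ ?n))"
          by (simp add: emeasure_sphere_measure[symmetric] mult_ac)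
        also have "\<dots> = emeasure N2 X"
          using 3 by (simp add: X N2 emeasure_radial_measure[OF n] ennreal_mult unit_ball_vol_nonneg)
        finally show ?thesis .
      qed
    qed
    show "sets N1 = sigma_sets UNIV (range atMost)" "sets N2 = sigma_sets UNIV (range atMost)"
      by (simp_all add: N1_def N2_def borel_eq_atMost)
    show "(\<Union>i. {..real i}) = UNIV" using real_arch_simple by auto
    show "emeasure N1 {..real i} \<noteq> \<infinity>" for i
    proof -
      have "emeasure N1 {..real i} \<le> emeasure lborel (cball (0::'a) (real i))"
        unfolding N1[OF atMost_borel] by (intro emeasure_mono) auto
      then show ?thesis using emeasure_lborel_cball_finite[of "0::'a" "real i"] by (auto simp: top_unique)
    qed
  qed auto
  then have "emeasure (radial_measure ?n) A * emeasure ?S B = emeasure lborel (norm -` A \<inter> sgn -` B)"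
    using N1[of A] N2[of A] by (simp add: mult.commute)
  also have "\<dots> = emeasure (distr lborel (borel \<Otimes>\<^sub>M borel) (\<lambda>x::'a. (norm x, sgn x))) (A \<times> B)"
    by (subst emeasure_distr) (auto intro!: arg_cong[where f="emeasure lborel"])
  finally show "emeasure (radial_measure ?n) A * emeasure ?S B
     = emeasure (distr lborel (borel \<Otimes>\<^sub>M borel) (\<lambda>x::'a. (norm x, sgn x))) (A \<times> B)" .
qed

lemma norm_scaleR_sgn: "norm x *\<^sub>R sgn x = (x :: 'a::real_normed_vector)"
  by (cases "x = 0") (simp_all add: sgn_div_norm)

lemma lborel_polar:
  "(lborel :: 'a::euclidean_space measure) = distr (radial_measure DIM('a) \<Otimes>\<^sub>M sphere_measure) borel (\<lambda>(r, \<theta>). r *\<^sub>R \<theta>)"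
proof -
  have "distr (radial_measure DIM('a) \<Otimes>\<^sub>M sphere_measure) borel (\<lambda>(r, \<theta>::'a). r *\<^sub>R \<theta>)
     = distr lborel borel ((\<lambda>(r, \<theta>). r *\<^sub>R \<theta>) \<circ> (\<lambda>x::'a. (norm x, sgn x)))"
    unfolding polar_measure by (rule distr_distr) measurable
  also have "(\<lambda>(r, \<theta>). r *\<^sub>R \<theta>) \<circ> (\<lambda>x::'a. (norm x, sgn x)) = (\<lambda>x. x)"
    by (simp add: fun_eq_iff norm_scaleR_sgn)
  finally show ?thesis by (simp add: distr_id2)
qed

lemma pair_sigma_finite_polar:
  "pair_sigma_finite (radial_measure DIM('a)) (sphere_measure :: 'a::euclidean_space measure)"
proof -
  have "DIM('a) \<ge> 1" using DIM_positive by (simp add: Suc_le_eq)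
  from sigma_finite_radial_measure[OF this] prob_space_imp_sigma_finite[OF prob_space_sphere_measure]
  show ?thesis by (simp add: pair_sigma_finite_def)
qed

lemma nn_integral_polar:
  fixes f :: "'a::euclidean_space \<Rightarrow> ennreal"
  assumes [measurable]: "f \<in> borel_measurable borel"
  shows "(\<integral>\<^sup>+x. f x \<partial>lborel) = (\<integral>\<^sup>+r. \<integral>\<^sup>+\<theta>. f (r *\<^sub>R \<theta>) \<partial>sphere_measure \<partial>radial_measure DIM('a))"
proof -
  interpret pair_sigma_finite "radial_measure DIM('a)" "sphere_measure :: 'a measure"
    by (rule pair_sigma_finite_polar)
  have "(\<integral>\<^sup>+x. f x \<partial>lborel) = (\<integral>\<^sup>+z. f (fst z *\<^sub>R snd z) \<partial>(radial_measure DIM('a) \<Otimes>\<^sub>M sphere_measure))"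
    by (subst lborel_polar) (simp add: nn_integral_distr case_prod_beta)
  also have "\<dots> = (\<integral>\<^sup>+r. \<integral>\<^sup>+\<theta>. f (r *\<^sub>R \<theta>) \<partial>sphere_measure \<partial>radial_measure DIM('a))"
    by (subst M2.nn_integral_fst[symmetric]) auto
  finally show ?thesis .
qed

lemma integral_polar:
  fixes f :: "'a::euclidean_space \<Rightarrow> 'b::{banach, second_countable_topology}"
  assumes f: "integrable lborel f"
  shows "(LINT x|lborel. f x) = (LINT r|radial_measure DIM('a). LINT \<theta>|sphere_measure. f (r *\<^sub>R \<theta>))"
    and "AE r in radial_measure DIM('a). integrable sphere_measure (\<lambda>\<theta>. f (r *\<^sub>R \<theta>))"
    and "integrable (radial_measure DIM('a)) (\<lambda>r. LINT \<theta>|sphere_measure. f (r *\<^sub>R \<theta>))"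
proof -
  interpret pair_sigma_finite "radial_measure DIM('a)" "sphere_measure :: 'a measure"
    by (rule pair_sigma_finite_polar)
  have [measurable]: "f \<in> borel_measurable borel" using f by auto
  have "integrable (radial_measure DIM('a) \<Otimes>\<^sub>M sphere_measure) (\<lambda>z. f (fst z *\<^sub>R snd z))"
    using f by (subst (asm) lborel_polar) (simp add: integrable_distr_eq case_prod_beta)
  then have I: "integrable (radial_measure DIM('a) \<Otimes>\<^sub>M sphere_measure) (\<lambda>(r, \<theta>). f (r *\<^sub>R \<theta>))"
    unfolding case_prod_beta .
  have "(LINT x|lborel. f x) = (LINT z|(radial_measure DIM('a) \<Otimes>\<^sub>M sphere_measure). f (fst z *\<^sub>R snd z))"
    by (subst lborel_polar) (simp add: integral_distr case_prod_beta)
  then show "(LINT x|lborel. f x) = (LINT r|radial_measure DIM('a). LINT \<theta>|sphere_measure. f (r *\<^sub>R \<theta>))"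
    using integral_fst[OF I] unfolding case_prod_beta by simp
  show "AE r in radial_measure DIM('a). integrable sphere_measure (\<lambda>\<theta>. f (r *\<^sub>R \<theta>))"
    using AE_integrable_fst[OF I] by simp
  show "integrable (radial_measure DIM('a)) (\<lambda>r. LINT \<theta>|sphere_measure. f (r *\<^sub>R \<theta>))"
    using integrable_fst[OF I] by simp
qed

lemma AE_polar:
  fixes P :: "'a::euclidean_space \<Rightarrow> bool"
  assumes "AE x in lborel. P x"
  shows "AE r in radial_measure DIM('a). AE \<theta> in sphere_measure. P (r *\<^sub>R \<theta>)"
proof -
  interpret pair_sigma_finite "radial_measure DIM('a)" "sphere_measure :: 'a measure"
    by (rule pair_sigma_finite_polar)
  obtain N where N: "N \<in> null_sets lborel" "{x. \<not> P x} \<subseteq> N"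
    using assms by (auto simp: eventually_ae_filter)
  then have [measurable]: "N \<in> sets borel" by auto
  have "AE x in lborel. x \<notin> N" using N by (rule_tac AE_not_in)
  then have "AE z in radial_measure DIM('a) \<Otimes>\<^sub>M sphere_measure. fst z *\<^sub>R snd z \<notin> N"
    by (subst (asm) lborel_polar) (simp add: AE_distr_iff case_prod_beta)
  from AE_pair[OF this] show ?thesis
    by (rule AE_mp) (use N in \<open>auto elim!: eventually_mono\<close>)
qed

lemma distr_norm_lborel: "distr lborel borel (norm :: 'a::euclidean_space \<Rightarrow> real) = radial_measure DIM('a)"
proof -
  interpret prob_space "sphere_measure :: 'a measure" by (rule prob_space_sphere_measure)
  interpret p: pair_sigma_finite "radial_measure DIM('a)" "sphere_measure :: 'a measure"
    by (rule pair_sigma_finite_polar)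
  show ?thesis
  proof (rule measure_eqI)
    fix A assume "A \<in> sets (distr lborel borel (norm :: 'a \<Rightarrow> real))"
    then have [measurable]: "A \<in> sets borel" by simp
    have "emeasure (radial_measure DIM('a)) A = emeasure (radial_measure DIM('a) \<Otimes>\<^sub>M (sphere_measure :: 'a measure)) (A \<times> UNIV)"
      using emeasure_space_1 by (subst emeasure_pair_measure_Times) auto
    also have "\<dots> = emeasure lborel ((\<lambda>x::'a. (norm x, sgn x)) -` (A \<times> UNIV) \<inter> space lborel)"
      unfolding polar_measure by (rule emeasure_distr) measurable
    also have "\<dots> = emeasure (distr lborel borel (norm :: 'a \<Rightarrow> real)) A"
      by (subst emeasure_distr) (auto intro!: arg_cong[where f="emeasure lborel"])
    finally show "emeasure (distr lborel borel (norm :: 'a \<Rightarrow> real)) A = emeasure (radial_measure DIM('a)) A" by simp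
  qed simp
qed

lemma AE_sphere_measure_norm: "AE \<theta> in sphere_measure. norm (\<theta> :: 'a::euclidean_space) = 1"
proof -
  have "AE x in uniform_measure lborel (ball 0 1). x \<noteq> (0::'a)"
    by (rule AE_uniform_measureI) (use AE_lborel_singleton[of "0::'a"] in \<open>auto elim: eventually_mono\<close>)
  then have "AE x in uniform_measure lborel (ball 0 1). norm (sgn x :: 'a) = 1"
    by eventually_elim (simp add: norm_sgn)
  then show ?thesis
    unfolding sphere_measure_def by (subst AE_distr_iff) auto
qed

lemma AE_radial_measure_iff: "(AE r in radial_measure n. P r) \<longleftrightarrow> (AE r in lborel. 0 < r \<longrightarrow> P r)" if "n \<ge> 1"
proof -
  have "0 < radial_density n r \<longleftrightarrow> 0 < r" for r
    using that by (auto simp: radial_density_def indicator_def unit_ball_vol_pos zero_less_mult_iff)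
  then show ?thesis
    unfolding radial_measure_def by (subst AE_density) auto
qed

lemma integral_radial_measure:
  fixes f :: "real \<Rightarrow> 'b::{banach, second_countable_topology}"
  assumes [measurable]: "f \<in> borel_measurable borel"
  shows "(LINT r|radial_measure n. f r) = (LINT r|lborel. radial_density n r *\<^sub>R f r)"
    and "integrable (radial_measure n) f \<longleftrightarrow> integrable lborel (\<lambda>r. radial_density n r *\<^sub>R f r)"
  unfolding radial_measure_def
  by (subst integral_density integrable_density; auto simp: radial_density_nonneg)+

section \<open>Integration by parts for Lipschitz functions of bounded support\<close>

lemma integrable_indicator_ball: "integrable lborel (\<lambda>x. C * indicator (ball (c::'a::euclidean_space) R) x :: real)"
  by (intro integrable_mult_right integrable_real_indicator) (use emeasure_lborel_ball_finite in auto)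

lemma integral_directional_derivative_eq_0:
  fixes \<Psi> :: "'a::euclidean_space \<Rightarrow> real"
  assumes lip: "\<And>x y. \<bar>\<Psi> x - \<Psi> y\<bar> \<le> K * norm (x - y)"
    and supp: "\<And>x. norm x \<ge> R \<Longrightarrow> \<Psi> x = 0" and e: "norm e \<le> 1"
    and [measurable]: "D \<in> borel_measurable borel"
    and D: "AE x in lborel. ((\<lambda>h. (\<Psi> (x + h *\<^sub>R e) - \<Psi> x) / h) \<longlongrightarrow> D x) (at 0)"
  shows "(LINT x|lborel. D x) = 0"
proof -
  have K: "K \<ge> 0"
  proof -
    obtain b :: 'a where "b \<in> Basis" using nonempty_Basis by blast
    then show ?thesis using lip[of b 0] abs_ge_zero[of "\<Psi> b - \<Psi> 0"] by simp
  qed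
  have cont: "continuous_on UNIV \<Psi>"
  proof (rule continuous_onI)
    fix x and \<epsilon> :: real assume "\<epsilon> > 0"
    then show "\<exists>d>0. \<forall>x'\<in>UNIV. dist x' x < d \<longrightarrow> dist (\<Psi> x') (\<Psi> x) \<le> \<epsilon>"
    proof (intro exI[of _ "\<epsilon> / (K + 1)"] conjI ballI impI)
      fix x' assume "dist x' x < \<epsilon> / (K + 1)"
      then have "(K + 1) * norm (x' - x) < \<epsilon>" using K by (simp add: dist_norm field_simps)
      moreover have "K * norm (x' - x) \<le> (K + 1) * norm (x' - x)" by (intro mult_right_mono) auto
      ultimately show "dist (\<Psi> x') (\<Psi> x) \<le> \<epsilon>" using lip[of x' x] by (simp add: dist_norm)
    qed (use K in auto)
  qed
  have [measurable]: "\<Psi> \<in> borel_measurable borel" by (rule borel_measurable_continuous_onI[OF cont])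
  define hs where "hs k = inverse (real (Suc k))" for k
  have hs: "0 < hs k" "hs k \<le> 1" for k by (auto simp: hs_def field_simps)
  define q where "q k x = (\<Psi> (x + hs k *\<^sub>R e) - \<Psi> x) / hs k" for k x
  \<comment> \<open>The increment has norm at most 1, so for x outside the ball of radius |R| + 2
    both points of the quotient lie where the function vanishes.\<close>
  have bound: "\<bar>q k x\<bar> \<le> K * indicator (ball 0 (\<bar>R\<bar> + 2)) x" for k x
  proof (cases "norm x < \<bar>R\<bar> + 2")
    case True
    have "\<bar>\<Psi> (x + hs k *\<^sub>R e) - \<Psi> x\<bar> \<le> K * (hs k * norm e)"
      using lip[of "x + hs k *\<^sub>R e" x] hs[of k] by simp
    also have "\<dots> \<le> K * hs k" using K hs[of k] e by (intro mult_left_mono mult_left_le) auto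
    finally show ?thesis using True hs[of k] by (simp add: q_def field_simps)
  next
    case False
    have "norm (hs k *\<^sub>R e) \<le> 1 * 1" unfolding norm_scaleR by (intro mult_mono) (use hs[of k] e in auto)
    then have "norm (x + hs k *\<^sub>R e) \<ge> R" using False norm_diff_ineq[of x "hs k *\<^sub>R e"] by simp
    then show ?thesis using supp False by (simp add: q_def)
  qed
  have intB: "integrable lborel (\<lambda>x. K * indicator (ball 0 (\<bar>R\<bar> + 2)) x :: real)"
    by (rule integrable_indicator_ball)
  have int\<Psi>: "integrable lborel \<Psi>"
  proof (rule Bochner_Integration.integrable_bound)
    have "\<bar>\<Psi> x\<bar> \<le> 2 * K * \<bar>R\<bar> * indicator (ball 0 \<bar>R\<bar>) x" for x
    proof (cases "norm x < \<bar>R\<bar>")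
      case True
      obtain b :: 'a where b: "b \<in> Basis" using nonempty_Basis by blast
      have "\<Psi> (\<bar>R\<bar> *\<^sub>R b) = 0" using b by (intro supp) simp
      then have "\<bar>\<Psi> x\<bar> \<le> K * norm (x - \<bar>R\<bar> *\<^sub>R b)" using lip[of x "\<bar>R\<bar> *\<^sub>R b"] by simp
      also have "K * norm (x - \<bar>R\<bar> *\<^sub>R b) \<le> K * (2 * \<bar>R\<bar>)"
        using norm_triangle_ineq4[of x "\<bar>R\<bar> *\<^sub>R b"] True b K by (intro mult_left_mono) auto
      finally show ?thesis using True by (simp add: mult_ac)
    qed (use supp in auto)
    then show "AE x in lborel. norm (\<Psi> x) \<le> norm ((2 * K * \<bar>R\<bar>) * indicator (ball 0 \<bar>R\<bar>) x :: real)"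
      using K by (auto simp: abs_mult)
    show "integrable lborel (\<lambda>x. (2 * K * \<bar>R\<bar>) * indicator (ball 0 \<bar>R\<bar>) x :: real)"
      by (rule integrable_indicator_ball)
  qed measurable
  have "(LINT x|lborel. q k x) = 0" for k
  proof -
    have d: "distr lborel borel ((+) (hs k *\<^sub>R e)) = (lborel :: 'a measure)" by (rule lborel_distr_plus)
    have "integrable (distr lborel borel ((+) (hs k *\<^sub>R e))) \<Psi>" unfolding d by (rule int\<Psi>)
    then have I: "integrable lborel (\<lambda>x. \<Psi> (x + hs k *\<^sub>R e))"
      by (subst (asm) integrable_distr_eq) (auto simp: add.commute)
    have "(LINT x|lborel. \<Psi> x) = (LINT x|distr lborel borel ((+) (hs k *\<^sub>R e)). \<Psi> x)" unfolding d ..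
    also have "\<dots> = (LINT x|lborel. \<Psi> (x + hs k *\<^sub>R e))"
      by (subst integral_distr) (auto simp: add.commute)
    finally show ?thesis unfolding q_def using I int\<Psi> by simp
  qed
  moreover have "(\<lambda>k. LINT x|lborel. q k x) \<longlonglongrightarrow> (LINT x|lborel. D x)"
  proof (rule integral_dominated_convergence[OF _ _ intB])
    have lim: "filterlim hs (at 0) sequentially"
      unfolding filterlim_at hs_def using LIMSEQ_inverse_real_of_nat by (auto intro!: always_eventually)
    show "AE x in lborel. (\<lambda>k. q k x) \<longlonglongrightarrow> D x"
      using D by eventually_elim (auto simp: q_def intro: filterlim_compose[OF _ lim])
  qed (use bound in \<open>auto simp: q_def\<close>)
  ultimately show ?thesis by (simp add: LIMSEQ_const_iff)
qed

lemma integrable_test_mult_bounded: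
  fixes f u :: "real ^ 'n \<Rightarrow> real"
  assumes f: "f \<in> test_functions" and [measurable]: "u \<in> borel_measurable borel" and u: "\<And>x. \<bar>u x\<bar> \<le> C"
  shows "integrable lborel (\<lambda>x. f x * u x)"
proof -
  obtain B R where f': "0 < B" "0 < R" "\<And>x. \<bar>f x\<bar> \<le> B * indicator (ball 0 R) x"
    using test_functions_bound[OF f] by metis
  note [measurable] = test_functions_borel[OF f]
  show ?thesis
  proof (rule Bochner_Integration.integrable_bound)
    show "integrable lborel (\<lambda>x. B * C * indicator (ball (0::real^'n) R) x :: real)"
      by (rule integrable_indicator_ball)
    have "C \<ge> 0" using u[of 0] by linarith
    then have "\<bar>f x\<bar> * \<bar>u x\<bar> \<le> B * C * indicator (ball 0 R) x" for x
      using mult_mono[OF f'(3)[of x] u[of x]] f'(1) by (cases "x \<in> ball 0 R") auto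
    then show "AE x in lborel. norm (f x * u x) \<le> norm (B * C * indicator (ball 0 R) x)"
      using \<open>C \<ge> 0\<close> f'(1) by (auto simp: abs_mult)
  qed measurable
qed

lemma sgn_nth_indicator_le: "\<bar>sgn x $ i * indicator A (norm x)\<bar> \<le> 1" for x :: "real ^ 'n"
  using component_le_norm_cart[of "sgn x" i] by (auto simp: abs_mult indicator_def norm_sgn split: if_splits)

lemma test_functions_Lipschitz:
  fixes \<psi> :: "real ^ 'n \<Rightarrow> real"
  assumes \<psi>: "\<psi> \<in> test_functions"
  obtains K where "K \<ge> 0" "\<And>x y. \<bar>\<psi> x - \<psi> y\<bar> \<le> K * norm (x - y)"
proof -
  have "\<forall>i. \<exists>B. \<forall>x. \<bar>pdiff i \<psi> x\<bar> \<le> B"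
    using test_functions_bounded[OF test_functions_pdiff[OF \<psi>]] by metis
  then obtain B where B: "\<And>i x. \<bar>pdiff i \<psi> x\<bar> \<le> B i" by metis
  have B0: "0 \<le> B i" for i using B[of i 0] by linarith
  define K where "K = (\<Sum>i\<in>UNIV. B i)"
  have "norm (\<psi> x - \<psi> y) \<le> K * norm (x - y)" for x y
  proof (rule differentiable_bound[of UNIV \<psi>])
    fix x
    show "(\<psi> has_derivative (\<lambda>h. \<Sum>i\<in>UNIV. h $ i * pdiff i \<psi> x)) (at x within UNIV)"
      by (rule has_derivative_at_withinI[OF has_derivative_pdiff[OF test_functions_differentiable[OF \<psi>]]])
    show "onorm (\<lambda>h. \<Sum>i\<in>UNIV. h $ i * pdiff i \<psi> x) \<le> K"
    proof (rule onorm_le)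
      fix h :: "real ^ 'n"
      have "norm (\<Sum>i\<in>UNIV. h $ i * pdiff i \<psi> x) \<le> (\<Sum>i\<in>UNIV. norm h * B i)"
        by (rule sum_norm_le) (auto simp: abs_mult intro!: mult_mono B component_le_norm_cart B0)
      also have "\<dots> = K * norm h" by (simp add: K_def sum_distrib_left mult.commute)
      finally show "norm (\<Sum>i\<in>UNIV. h $ i * pdiff i \<psi> x) \<le> K * norm h" .
    qed
  qed auto
  moreover have "K \<ge> 0" unfolding K_def by (intro sum_nonneg B0)
  ultimately show ?thesis by (intro that[of K]) auto
qed

text \<open>For a \<le> b this is the length of the part of the interval from a to b beyond r. In
  other words, \<open>tent a b (norm x)\<close> is the integral over radii s between a and b of the
  indicator of the ball of radius s.\<close>

definition tent :: "real \<Rightarrow> real \<Rightarrow> real \<Rightarrow> real" where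
  "tent a b r = max 0 (b - max a r)"

lemma tent_Lipschitz: "\<bar>tent a b r - tent a b s\<bar> \<le> \<bar>r - s\<bar>"
  by (auto simp: tent_def)

lemma sphere_null: "AE x in lborel. norm (x :: 'a::euclidean_space) \<noteq> a"
proof -
  have "sphere (0::'a) a \<in> null_sets lborel"
    using negligible_sphere[of "0::'a" a] by (auto simp: null_sets_completion_iff negligible_iff_null_sets)
  then have "AE x in lborel. x \<notin> sphere (0::'a) a" by (rule AE_not_in)
  then show ?thesis by eventually_elim auto
qed

text \<open>The divergence theorem averaged over the radii between a and b. Averaging replaces the
  jump of the indicator of a ball by a Lipschitz weight; the product rule can fail only at the
  origin and on two spheres, which are null sets.\<close>

lemma integral_tent_by_parts:
  fixes \<psi> :: "real ^ 'n \<Rightarrow> real"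
  assumes \<psi>: "\<psi> \<in> test_functions" and ab: "0 \<le> a" "a \<le> b"
  shows "(LINT x|lborel. pdiff i \<psi> x * tent a b (norm x)) = (LINT x|lborel. \<psi> x * (sgn x $ i * indicator {a<..<b} (norm x)))"
proof -
  note [measurable] = test_functions_borel[OF \<psi>] test_functions_borel[OF test_functions_pdiff[OF \<psi>]]
  obtain K where K: "K \<ge> 0" "\<And>x y. \<bar>\<psi> x - \<psi> y\<bar> \<le> K * norm (x - y)"
    using test_functions_Lipschitz[OF \<psi>] by metis
  obtain B R where BR: "0 < B" "0 < R" "\<And>x. \<bar>\<psi> x\<bar> \<le> B * indicator (ball 0 R) x"
    using test_functions_bound[OF \<psi>] by metis
  have \<psi>B: "\<bar>\<psi> x\<bar> \<le> B" for x
    using BR(1) BR(3)[of x] by (cases "x \<in> ball 0 R") auto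
  have \<psi>0: "\<psi> x = 0" if "norm x \<ge> R" for x using BR(3)[of x] that by (simp add: indicator_def)
  have [measurable]: "tent a b \<in> borel_measurable borel" unfolding tent_def[abs_def] by measurable
  define D where "D x = pdiff i \<psi> x * tent a b (norm x) - \<psi> x * (sgn x $ i * indicator {a<..<b} (norm x))" for x
  have tb: "0 \<le> tent a b r" "tent a b r \<le> b" for r using ab by (auto simp: tent_def)
  have D0: "(LINT x|lborel. D x) = 0"
  proof (rule integral_directional_derivative_eq_0[of "\<lambda>x. \<psi> x * tent a b (norm x)" "K * b + B" R "axis i 1"])
    fix x y :: "real ^ 'n"
    have "\<psi> x * tent a b (norm x) - \<psi> y * tent a b (norm y) = (\<psi> x - \<psi> y) * tent a b (norm x) + \<psi> y * (tent a b (norm x) - tent a b (norm y))"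
      by (simp add: algebra_simps)
    also have "\<bar>\<dots>\<bar> \<le> \<bar>\<psi> x - \<psi> y\<bar> * tent a b (norm x) + \<bar>\<psi> y\<bar> * \<bar>tent a b (norm x) - tent a b (norm y)\<bar>"
      using tb by (intro order_trans[OF abs_triangle_ineq]) (simp add: abs_mult)
    also have "\<dots> \<le> (K * norm (x - y)) * b + B * norm (x - y)"
      using ab K BR tb
      by (intro add_mono mult_mono order_trans[OF tent_Lipschitz norm_triangle_ineq3]) (auto simp: \<psi>B)
    finally show "\<bar>\<psi> x * tent a b (norm x) - \<psi> y * tent a b (norm y)\<bar> \<le> (K * b + B) * norm (x - y)"
      by (simp add: algebra_simps)
  next
    show "\<psi> x * tent a b (norm x) = 0" if "R \<le> norm x" for x using \<psi>0[OF that] by simp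
    show "norm (axis i 1 :: real ^ 'n) \<le> 1" by simp
    show "D \<in> borel_measurable borel" unfolding D_def by measurable
    show "AE x in lborel. ((\<lambda>h. (\<psi> (x + h *\<^sub>R axis i 1) * tent a b (norm (x + h *\<^sub>R axis i 1)) - \<psi> x * tent a b (norm x)) / h) \<longlongrightarrow> D x) (at 0)"
      using sphere_null[of 0] sphere_null[of a] sphere_null[of b]
    proof eventually_elim
      case (elim x)
      have dn: "(norm has_derivative (\<lambda>h. sgn x \<bullet> h)) (at x)"
        using has_derivative_norm[of x] elim(1) by (simp add: inner_commute)
      have T: "((\<lambda>y. tent a b (norm y)) has_derivative (\<lambda>h. - (sgn x \<bullet> h) * indicator {a<..<b} (norm x))) (at x)"
      proof -
        consider "norm x < a" | "a < norm x" "norm x < b" | "b < norm x" using elim by linarith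
        then show ?thesis
        proof cases
          case 1
          have "((\<lambda>y::real^'n. b - a) has_derivative (\<lambda>h. - (sgn x \<bullet> h) * indicator {a<..<b} (norm x))) (at x)"
            using 1 by simp
          then show ?thesis
            by (rule has_derivative_transform_within_open[of _ _ _ _ "{y. norm y < a}"])
               (use 1 ab in \<open>auto intro!: open_Collect_less continuous_intros simp: tent_def\<close>)
        next
          case 2
          have "((\<lambda>y. b - norm y) has_derivative (\<lambda>h. - (sgn x \<bullet> h) * indicator {a<..<b} (norm x))) (at x)"
            using 2 by (auto intro!: derivative_eq_intros dn)
          then show ?thesis
            by (rule has_derivative_transform_within_open[of _ _ _ _ "{y. a < norm y} \<inter> {y. norm y < b}"])
               (use 2 in \<open>auto intro!: open_Int open_Collect_less continuous_intros simp: tent_def\<close>)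
        next
          case 3
          have "((\<lambda>y::real^'n. 0) has_derivative (\<lambda>h. - (sgn x \<bullet> h) * indicator {a<..<b} (norm x))) (at x)"
            using 3 by simp
          then show ?thesis
            by (rule has_derivative_transform_within_open[of _ _ _ _ "{y. b < norm y}"])
               (use 3 ab in \<open>auto intro!: open_Collect_less continuous_intros simp: tent_def\<close>)
        qed
      qed
      have P: "((\<lambda>y. \<psi> y * tent a b (norm y)) has_derivative
         (\<lambda>h. \<psi> x * (- (sgn x \<bullet> h) * indicator {a<..<b} (norm x)) + (\<Sum>j\<in>UNIV. h $ j * pdiff j \<psi> x) * tent a b (norm x))) (at x)"
        by (rule has_derivative_mult[OF has_derivative_pdiff[OF test_functions_differentiable[OF \<psi>]] T])
      have l: "((\<lambda>h. x + h *\<^sub>R axis i 1) has_derivative (\<lambda>h. h *\<^sub>R axis i 1)) (at (0::real))"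
        by (auto intro!: derivative_eq_intros)
      have "((\<lambda>h. \<psi> (x + h *\<^sub>R axis i 1) * tent a b (norm (x + h *\<^sub>R axis i 1))) has_derivative
         (\<lambda>h. \<psi> x * (- (sgn x \<bullet> (h *\<^sub>R axis i 1)) * indicator {a<..<b} (norm x)) + (\<Sum>j\<in>UNIV. (h *\<^sub>R axis i 1) $ j * pdiff j \<psi> x) * tent a b (norm x))) (at 0)"
        by (rule has_derivative_compose[OF l]) (use P in simp)
      moreover have "(\<lambda>h. \<psi> x * (- (sgn x \<bullet> (h *\<^sub>R axis i 1)) * indicator {a<..<b} (norm x)) + (\<Sum>j\<in>UNIV. (h *\<^sub>R axis i 1) $ j * pdiff j \<psi> x) * tent a b (norm x))
         = (*) (D x)"
      proof
        fix h :: real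
        have "(\<Sum>j\<in>UNIV. (h *\<^sub>R axis i 1) $ j * pdiff j \<psi> x) = h * (\<Sum>j\<in>UNIV. axis i 1 $ j * pdiff j \<psi> x)"
          by (simp add: sum_distrib_left mult.assoc)
        then show "\<psi> x * (- (sgn x \<bullet> (h *\<^sub>R axis i 1)) * indicator {a<..<b} (norm x)) + (\<Sum>j\<in>UNIV. (h *\<^sub>R axis i 1) $ j * pdiff j \<psi> x) * tent a b (norm x) = D x * h"
          unfolding sum_axis_mult by (simp add: D_def inner_axis algebra_simps)
      qed
      ultimately have "((\<lambda>h. \<psi> (x + h *\<^sub>R axis i 1) * tent a b (norm (x + h *\<^sub>R axis i 1))) has_real_derivative D x) (at 0)"
        by (simp only: has_field_derivative_def)
      then show ?case by (simp add: DERIV_def)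
    qed
  qed
  have "integrable lborel (\<lambda>x. pdiff i \<psi> x * tent a b (norm x))"
    by (rule integrable_test_mult_bounded[OF test_functions_pdiff[OF \<psi>], of _ b]) (use tb in auto)
  moreover have "integrable lborel (\<lambda>x. \<psi> x * (sgn x $ i * indicator {a<..<b} (norm x)))"
    by (rule integrable_test_mult_bounded[OF \<psi> _ sgn_nth_indicator_le]) measurable
  ultimately show ?thesis using D0 unfolding D_def by simp
qed

section \<open>Radial profiles\<close>

definition surface_const :: "nat \<Rightarrow> real" where
  "surface_const n = real n * unit_ball_vol (real n)"

lemma surface_const_pos: "n \<ge> 1 \<Longrightarrow> surface_const n > 0"
  by (simp add: surface_const_def)

lemma radial_density_eq: "r > 0 \<Longrightarrow> radial_density n r = surface_const n * r ^ (n - 1)"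
  by (simp add: radial_density_def surface_const_def)

lemma radial_density_pos: "n \<ge> 1 \<Longrightarrow> r > 0 \<Longrightarrow> radial_density n r > 0"
  by (simp add: radial_density_eq surface_const_pos)

text \<open>Write H as the product of \<open>sqrt w * H\<close> and \<open>1 / sqrt w\<close> with w
  the radial density. All pointwise bounds on profiles come from this passage from the weighted L2
  norm to an unweighted integral.\<close>

lemma weighted_Cauchy_Schwarz:
  fixes H :: "real \<Rightarrow> 'b::euclidean_space"
  assumes n: "n \<ge> 1" and H: "L2 (radial_measure n) H"
    and [measurable]: "A \<in> sets borel" and A: "A \<subseteq> {0<..}"
    and wA: "set_integrable lborel A (\<lambda>s. 1 / radial_density n s)"
  shows "set_integrable lborel A H"
    and "(LINT s:A|lborel. norm (H s))\<^sup>2 \<le> (LINT s:A|lborel. 1 / radial_density n s) * L2sq (radial_measure n) H"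
proof -
  have [measurable]: "H \<in> borel_measurable borel"
    using L2_measurable[OF H] by (simp cong: measurable_cong_sets)
  let ?w = "radial_density n"
  have w: "?w s > 0" if "s \<in> A" for s using radial_density_pos[OF n] A that by auto
  define f where "f s = sqrt (?w s) *\<^sub>R H s" for s
  define g where "g s = indicator A s * sqrt (1 / ?w s)" for s
  have f2: "(norm (f s))\<^sup>2 = ?w s *\<^sub>R (norm (H s))\<^sup>2" for s
    by (simp add: f_def power_mult_distrib radial_density_nonneg)
  have g2: "(norm (g s))\<^sup>2 = indicator A s *\<^sub>R (1 / ?w s)" for s
    by (simp add: g_def power_mult_distrib radial_density_nonneg indicator_def real_sqrt_divide power_divide)
  have Lf: "L2 lborel f"
    unfolding L2_def f2 using L2_integrable[OF H]
    by (simp add: integral_radial_measure(2)) (simp add: f_def[abs_def])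
  have Lg: "L2 lborel g"
    unfolding L2_def g2 using wA by (simp add: set_integrable_def) (simp add: g_def[abs_def])
  have fg: "norm (f s) * norm (g s) = indicator A s *\<^sub>R norm (H s)" for s
    using w[of s] by (cases "s \<in> A") (simp_all add: f_def g_def real_sqrt_divide)
  have I: "integrable lborel (\<lambda>s. indicator A s *\<^sub>R norm (H s))"
    using L2_integrable_norm_mult[OF Lf Lg] unfolding fg .
  then have "integrable lborel (\<lambda>s. norm (indicator A s *\<^sub>R H s))" by simp
  then show "set_integrable lborel A H"
    unfolding set_integrable_def by (subst (asm) integrable_norm_iff) auto
  have "L2sq lborel f = L2sq (radial_measure n) H"
    unfolding L2sq_def f2 by (simp add: integral_radial_measure(1))
  moreover have "L2sq lborel g = (LINT s:A|lborel. 1 / ?w s)"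
    unfolding L2sq_def g2 set_lebesgue_integral_def ..
  ultimately show "(LINT s:A|lborel. norm (H s))\<^sup>2 \<le> (LINT s:A|lborel. 1 / ?w s) * L2sq (radial_measure n) H"
    using L2_Cauchy_Schwarz[OF Lf Lg] unfolding fg set_lebesgue_integral_def by (simp add: mult.commute)
qed

lemma set_integrable_const_Icc: "set_integrable lborel {a..b::real} (\<lambda>_. c::real)"
  unfolding set_integrable_def
  by (intro integrable_scaleR_left integrable_real_indicator) (use emeasure_lborel_cbox_finite[of a b] in auto)

definition tail_const :: "nat \<Rightarrow> real \<Rightarrow> real" where
  "tail_const n r = r powr (2 - real n) / ((real n - 2) * surface_const n)"

text \<open>The inverse density decays like s^(1-n), which is integrable at infinity in dimension at
  least three. Hence a radial function can be recovered from its derivative by integrating from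
  infinity.\<close>

lemma inverse_density_tail:
  assumes n: "n \<ge> 3" and r: "r > 0"
  shows "set_integrable lborel {r..} (\<lambda>s. 1 / radial_density n s)"
    and "(LINT s:{r..}|lborel. 1 / radial_density n s) = tail_const n r"
proof -
  let ?k = "surface_const n"
  have k: "?k > 0" using n by (intro surface_const_pos) auto
  have e: "ennreal (indicator {r..} s *\<^sub>R (1 / radial_density n s)) = ennreal (1 / ?k) * (indicator {r..} s * ennreal (s powr - (real n - 1)))" for s
  proof (cases "s \<ge> r")
    case True
    then have s: "s > 0" using r by simp
    have p: "s ^ (n - 1) = s powr (real n - 1)"
      using s n by (simp add: powr_realpow[symmetric] of_nat_diff)
    have "1 / radial_density n s = 1 / ?k * s powr - (real n - 1)"
      unfolding radial_density_eq[OF s] p powr_minus by (simp add: divide_inverse)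
    then show ?thesis using True k by (simp add: ennreal_mult[symmetric])
  qed simp
  have "(\<integral>\<^sup>+s. ennreal (indicator {r..} s *\<^sub>R (1 / radial_density n s)) \<partial>lborel) = ennreal (1 / ?k) * (\<integral>\<^sup>+s. indicator {r..} s * ennreal (s powr - (real n - 1)) \<partial>lborel)"
    unfolding e by (rule nn_integral_cmult) measurable
  also have "\<dots> = ennreal (1 / ?k) * ennreal (r powr (2 - real n) / (real n - 2))"
    by (subst nn_integral_powr_atLeast) (use n r in auto)
  also have "\<dots> = ennreal (tail_const n r)"
    using k n by (simp add: ennreal_mult[symmetric] tail_const_def mult.commute)
  finally have *: "(\<integral>\<^sup>+s. ennreal (indicator {r..} s *\<^sub>R (1 / radial_density n s)) \<partial>lborel) = ennreal (tail_const n r)" .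
  show I: "set_integrable lborel {r..} (\<lambda>s. 1 / radial_density n s)"
    unfolding set_integrable_def
    by (rule integrableI_nonneg) (use * in \<open>auto simp: radial_density_nonneg\<close>)
  have "0 \<le> tail_const n r" using k n by (simp add: tail_const_def)
  then show "(LINT s:{r..}|lborel. 1 / radial_density n s) = tail_const n r"
    using * unfolding set_lebesgue_integral_def
    by (subst integral_eq_nn_integral) (auto simp: radial_density_nonneg)
qed

lemma inverse_density_window:
  assumes n: "n \<ge> 3" and r: "0 < r" "r \<le> s"
  shows "set_integrable lborel {r..s} (\<lambda>t. 1 / radial_density n t)"
    and "(LINT t:{r..s}|lborel. 1 / radial_density n t) \<le> (s - r) / radial_density n r"
proof -
  have k: "surface_const n > 0" using n by (intro surface_const_pos) auto
  show I: "set_integrable lborel {r..s} (\<lambda>t. 1 / radial_density n t)"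
    by (rule set_integrable_subset[OF inverse_density_tail(1)[OF n r(1)]]) auto
  have "(LINT t:{r..s}|lborel. 1 / radial_density n t) \<le> (LINT t:{r..s}|lborel. 1 / radial_density n r)"
  proof (rule set_integral_mono[OF I])
    show "set_integrable lborel {r..s} (\<lambda>t. 1 / radial_density n r)"
      by (rule set_integrable_const_Icc)
    fix t assume "t \<in> {r..s}"
    then have "radial_density n r \<le> radial_density n t" "radial_density n r > 0"
      using r k n by (auto simp: radial_density_eq radial_density_pos intro!: power_mono mult_left_mono)
    then show "1 / radial_density n t \<le> 1 / radial_density n r" by (intro divide_left_mono) auto
  qed
  also have "\<dots> = (s - r) / radial_density n r"
    using r by (simp add: set_lebesgue_integral_def)
  finally show "(LINT t:{r..s}|lborel. 1 / radial_density n t) \<le> (s - r) / radial_density n r" .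
qed

text \<open>Parametrizing by the radial derivative gives each class of radial functions one
  representative, continuous for r > 0, whose values at single radii can be estimated. Only r > 0
  carries meaning: \<open>radial_measure\<close> gives no mass to the other r.\<close>

definition prof :: "(real \<Rightarrow> complex) \<Rightarrow> real \<Rightarrow> complex" where
  "prof G r = - (LINT s:{r..}|lborel. G s)"

definition rad_profile :: "nat \<Rightarrow> (real \<Rightarrow> complex) \<Rightarrow> bool" where
  "rad_profile n G \<longleftrightarrow> L2 (radial_measure n) G \<and> L2 (radial_measure n) (prof G)"

lemma L2_radial_borel [measurable_dest]: "L2 (radial_measure n) G \<Longrightarrow> G \<in> borel_measurable borel"
  using L2_measurable by (simp add: L2_def cong: measurable_cong_sets)

lemma prof_measurable [measurable]:
  assumes [measurable]: "G \<in> borel_measurable borel"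
  shows "prof G \<in> borel_measurable borel"
proof -
  have "(\<lambda>r. - (LINT s|lborel. (if r \<le> s then 1 else 0) *\<^sub>R G s)) \<in> borel_measurable borel"
    by measurable
  also have "(\<lambda>r. - (LINT s|lborel. (if r \<le> s then 1 else 0) *\<^sub>R G s)) = prof G"
    by (simp add: fun_eq_iff prof_def set_lebesgue_integral_def indicator_def of_bool_def)
  finally show ?thesis .
qed

lemma profile_integrable:
  assumes "n \<ge> 3" "L2 (radial_measure n) G" "r > 0"
  shows "set_integrable lborel {r..} G"
  by (rule weighted_Cauchy_Schwarz(1)[of n]) (use assms inverse_density_tail in auto)

lemma norm_prof_le: "norm (prof G r) \<le> (LINT s:{r..}|lborel. norm (G s))"
  unfolding prof_def set_lebesgue_integral_def
  using integral_norm_bound[of lborel "\<lambda>s. indicator {r..} s *\<^sub>R G s"] by simp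

lemma prof_tail_bound:
  assumes n: "n \<ge> 3" and G: "L2 (radial_measure n) G" and r: "r > 0"
  shows "(norm (prof G r))\<^sup>2 \<le> tail_const n r * L2sq (radial_measure n) G"
proof -
  have "(norm (prof G r))\<^sup>2 \<le> (LINT s:{r..}|lborel. norm (G s))\<^sup>2"
    by (intro power_mono norm_prof_le) auto
  also have "\<dots> \<le> (LINT s:{r..}|lborel. 1 / radial_density n s) * L2sq (radial_measure n) G"
    by (rule weighted_Cauchy_Schwarz(2)) (use assms inverse_density_tail in auto)
  finally show ?thesis using inverse_density_tail(2)[OF n r] by simp
qed

text \<open>The first bound is Hoelder continuity of exponent 1/2 away from the origin, with a
  constant depending only on the L2 norm of G: profiles of bounded norm are equicontinuous near each
  radius.\<close>

lemma prof_diff: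
  assumes n: "n \<ge> 3" and G: "L2 (radial_measure n) G" and r: "0 < r" "r \<le> s"
  shows "(norm (prof G r - prof G s))\<^sup>2 \<le> (s - r) / radial_density n r * L2sq (radial_measure n) G"
    and "norm (prof G r - prof G s) \<le> (LINT t:{r..s}|lborel. norm (G t))"
proof -
  have Ir: "set_integrable lborel {r..} G" and Is: "set_integrable lborel {s..} G"
    using profile_integrable[OF n G] r by auto
  have Irs: "set_integrable lborel {r..<s} G"
    by (rule set_integrable_subset[OF Ir]) auto
  have Irs': "set_integrable lborel {r..s} G"
    by (rule set_integrable_subset[OF Ir]) auto
  have disj: "{r..<s} \<inter> {s..} = {}" by auto
  have "{r..} = {r..<s} \<union> {s..}" using r by auto
  then have "(LINT t:{r..}|lborel. G t) = (LINT t:{r..<s}|lborel. G t) + (LINT t:{s..}|lborel. G t)"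
    using set_integral_Un[OF disj Irs Is] by simp
  then have "prof G r - prof G s = - (LINT t:{r..<s}|lborel. G t)"
    by (simp add: prof_def)
  then have "norm (prof G r - prof G s) \<le> (LINT t:{r..<s}|lborel. norm (G t))"
    using integral_norm_bound[of lborel "\<lambda>t. indicator {r..<s} t *\<^sub>R G t"]
    by (simp add: set_lebesgue_integral_def)
  also have "\<dots> \<le> (LINT t:{r..s}|lborel. norm (G t))"
    unfolding set_lebesgue_integral_def
  proof (rule integral_mono)
    show "integrable lborel (\<lambda>t. indicator {r..<s} t *\<^sub>R norm (G t))"
      using integrable_norm[OF Irs[unfolded set_integrable_def]] by simp
    show "integrable lborel (\<lambda>t. indicator {r..s} t *\<^sub>R norm (G t))"
      using integrable_norm[OF Irs'[unfolded set_integrable_def]] by simp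
  qed (auto simp: indicator_def)
  finally show le: "norm (prof G r - prof G s) \<le> (LINT t:{r..s}|lborel. norm (G t))" .
  have "(norm (prof G r - prof G s))\<^sup>2 \<le> (LINT t:{r..s}|lborel. norm (G t))\<^sup>2"
    by (intro power_mono le) auto
  also have "\<dots> \<le> (LINT t:{r..s}|lborel. 1 / radial_density n t) * L2sq (radial_measure n) G"
    by (rule weighted_Cauchy_Schwarz(2)) (use assms inverse_density_window in auto)
  also have "\<dots> \<le> (s - r) / radial_density n r * L2sq (radial_measure n) G"
    by (intro mult_right_mono inverse_density_window L2sq_nonneg n r)
  finally show "(norm (prof G r - prof G s))\<^sup>2 \<le> (s - r) / radial_density n r * L2sq (radial_measure n) G" .
qed

text \<open>Average over the window from r to r + 1: the value at r is at most the mean of the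
  profile plus its variation on the window. Each of the two is bounded by Cauchy-Schwarz, the
  inverse density being largest at r, and the factor 2 comes from squaring the sum.\<close>

lemma prof_decay_bound:
  assumes n: "n \<ge> 3" and G: "rad_profile n G" and r: "r > 0"
  shows "(norm (prof G r))\<^sup>2 \<le> 2 / radial_density n r * (L2sq (radial_measure n) (prof G) + L2sq (radial_measure n) G)"
proof -
  have L: "L2 (radial_measure n) G" "L2 (radial_measure n) (prof G)" using G by (auto simp: rad_profile_def)
  let ?A = "{r..r+1}"
  note win = inverse_density_window[OF n r, of "r + 1", simplified]
  have A: "?A \<subseteq> {0<..}" using r by auto
  have n1: "n \<ge> 1" using n by simp
  have If: "set_integrable lborel ?A (prof G)"
    by (rule weighted_Cauchy_Schwarz(1)[OF n1 L(2) _ A win(1)]) auto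
  then have Ifn: "set_integrable lborel ?A (\<lambda>s. norm (prof G s))" by (rule set_integrable_norm)
  have "(LINT s:?A|lborel. norm (prof G r)) \<le> (LINT s:?A|lborel. norm (prof G s) + (LINT t:?A|lborel. norm (G t)))"
  proof (rule set_integral_mono)
    show "set_integrable lborel ?A (\<lambda>s. norm (prof G r))"
      by (rule set_integrable_const_Icc)
    have "set_integrable lborel ?A (\<lambda>s. LINT t:?A|lborel. norm (G t))"
      by (rule set_integrable_const_Icc)
    then show "set_integrable lborel ?A (\<lambda>s. norm (prof G s) + (LINT t:?A|lborel. norm (G t)))"
      using Ifn by (rule set_integral_add(1)[rotated])
    fix s assume s: "s \<in> ?A"
    have IA: "set_integrable lborel ?A G" by (rule weighted_Cauchy_Schwarz(1)[OF n1 L(1) _ A win(1)]) auto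
    have "norm (prof G r) \<le> norm (prof G s) + norm (prof G r - prof G s)"
      using norm_triangle_ineq[of "prof G s" "prof G r - prof G s"] by simp
    also have "norm (prof G r - prof G s) \<le> (LINT t:{r..s}|lborel. norm (G t))"
      using prof_diff(2)[OF n L(1) r] s by auto
    also have "\<dots> \<le> (LINT t:?A|lborel. norm (G t))"
      unfolding set_lebesgue_integral_def
    proof (rule integral_mono)
      show "integrable lborel (\<lambda>t. indicator ?A t *\<^sub>R norm (G t))"
        using set_integrable_norm[OF IA] by (simp add: set_integrable_def)
      have "set_integrable lborel {r..s} (\<lambda>t. norm (G t))"
        using s by (intro set_integrable_subset[OF set_integrable_norm[OF IA]]) auto
      then show "integrable lborel (\<lambda>t. indicator {r..s} t *\<^sub>R norm (G t))"
        by (simp add: set_integrable_def)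
    qed (use s in \<open>auto simp: indicator_def\<close>)
    finally show "norm (prof G r) \<le> norm (prof G s) + (LINT t:?A|lborel. norm (G t))" by simp
  qed
  also have "\<dots> = (LINT s:?A|lborel. norm (prof G s)) + (LINT s:?A|lborel. (LINT t:?A|lborel. norm (G t)))"
    by (rule set_integral_add(2)[OF Ifn])
       (rule set_integrable_const_Icc)
  finally have "norm (prof G r) \<le> (LINT s:?A|lborel. norm (prof G s)) + (LINT t:?A|lborel. norm (G t))"
    by (simp add: set_lebesgue_integral_def)
  then have "(norm (prof G r))\<^sup>2 \<le> ((LINT s:?A|lborel. norm (prof G s)) + (LINT t:?A|lborel. norm (G t)))\<^sup>2"
    by (intro power_mono) auto
  also have "\<dots> \<le> 2 * (LINT s:?A|lborel. norm (prof G s))\<^sup>2 + 2 * (LINT t:?A|lborel. norm (G t))\<^sup>2"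
    using sum_squares_bound[of "LINT s:?A|lborel. norm (prof G s)" "LINT t:?A|lborel. norm (G t)"]
    by (simp add: power2_eq_square algebra_simps)
  also have "(LINT s:?A|lborel. norm (prof G s))\<^sup>2 \<le> (LINT t:?A|lborel. 1 / radial_density n t) * L2sq (radial_measure n) (prof G)"
    by (rule weighted_Cauchy_Schwarz(2)[OF n1 L(2) _ A win(1)]) auto
  also have "(LINT t:?A|lborel. norm (G t))\<^sup>2 \<le> (LINT t:?A|lborel. 1 / radial_density n t) * L2sq (radial_measure n) G"
    by (rule weighted_Cauchy_Schwarz(2)[OF n1 L(1) _ A win(1)]) auto
  finally have "(norm (prof G r))\<^sup>2 \<le> 2 * (LINT t:?A|lborel. 1 / radial_density n t) * (L2sq (radial_measure n) (prof G) + L2sq (radial_measure n) G)"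
    by (simp add: algebra_simps)
  also have "\<dots> \<le> 2 * (1 / radial_density n r) * (L2sq (radial_measure n) (prof G) + L2sq (radial_measure n) G)"
    using win(2) by (intro mult_right_mono mult_left_mono add_nonneg_nonneg L2sq_nonneg) auto
  finally show ?thesis by simp
qed

lemma prof_linear:
  assumes "n \<ge> 3" "L2 (radial_measure n) G" "L2 (radial_measure n) H" "r > 0"
  shows "prof (\<lambda>s. a * G s + b * H s) r = a * prof G r + b * prof H r"
  using profile_integrable[OF assms(1,2,4)] profile_integrable[OF assms(1,3,4)]
  unfolding prof_def set_lebesgue_integral_def set_integrable_def
  by (simp add: scaleR_add_right mult_scaleR_right[symmetric] del: mult_scaleR_right)

text \<open>The gradient of a radial function whose radial derivative is \<open>G\<close>.\<close>

definition radvec :: "(real \<Rightarrow> complex) \<Rightarrow> real ^ 'n \<Rightarrow> complex ^ 'n" where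
  "radvec G x = (\<chi> i. (sgn x $ i) *\<^sub>R G (norm x))"

lemma norm_radvec: "x \<noteq> 0 \<Longrightarrow> norm (radvec G x) = norm (G (norm x))"
proof -
  assume "x \<noteq> 0"
  have "norm (radvec G x) = L2_set (\<lambda>i. norm (G (norm x)) * \<bar>sgn x $ i\<bar>) UNIV"
    by (simp add: norm_vec_def radvec_def mult.commute)
  also have "\<dots> = norm (G (norm x)) * norm (sgn x)"
    by (simp add: L2_set_right_distrib[symmetric] norm_vec_def)
  finally show ?thesis using \<open>x \<noteq> 0\<close> by (simp add: norm_sgn)
qed

lemma radvec_measurable [measurable]:
  assumes [measurable]: "G \<in> borel_measurable borel"
  shows "(radvec G :: real ^ 'n \<Rightarrow> complex ^ 'n) \<in> borel_measurable borel"
proof -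
  have "continuous_on UNIV (\<lambda>p :: (real ^ 'n) \<times> complex. (\<chi> i. (fst p $ i) *\<^sub>R snd p))"
    by (intro continuous_intros)
  from borel_measurable_continuous_on[OF this, of "\<lambda>x. (sgn x, G (norm x))" borel] show ?thesis
    by (simp add: radvec_def[abs_def] borel_measurable_Pair)
qed

lemma radial_integral:
  fixes F :: "real \<Rightarrow> 'b::{banach, second_countable_topology}"
  assumes [measurable]: "F \<in> borel_measurable borel"
  shows "integrable lborel (\<lambda>x::'a::euclidean_space. F (norm x)) \<longleftrightarrow> integrable (radial_measure DIM('a)) F"
    and "(LINT x|lborel. F (norm (x::'a))) = (LINT r|radial_measure DIM('a). F r)"
  unfolding distr_norm_lborel[symmetric] by (simp_all add: integrable_distr_eq integral_distr)

lemma L2_radial_iff: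
  fixes F :: "real \<Rightarrow> 'b::euclidean_space"
  assumes [measurable]: "F \<in> borel_measurable borel"
  shows "L2 lborel (\<lambda>x::'a::euclidean_space. F (norm x)) \<longleftrightarrow> L2 (radial_measure DIM('a)) F"
    and "L2sq lborel (\<lambda>x::'a::euclidean_space. F (norm x)) = L2sq (radial_measure DIM('a)) F"
  using radial_integral[of "\<lambda>r. (norm (F r))\<^sup>2"] by (simp_all add: L2_def L2sq_def)

lemma measurable_radial [simp]:
  "f \<in> borel_measurable (radial_measure n) \<longleftrightarrow> f \<in> borel_measurable borel"
  by (simp cong: measurable_cong_sets)

lemma AE_norm_of_AE_radial:
  "AE r in radial_measure DIM('a). P r \<Longrightarrow> AE x in lborel. P (norm (x::'a::euclidean_space))"
  unfolding distr_norm_lborel[symmetric] by (rule AE_distrD[rotated]) auto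

lemma integrable_pair_product:
  fixes f :: "'a::euclidean_space \<Rightarrow> real" and g :: "'b::euclidean_space \<Rightarrow> real"
  assumes f: "integrable lborel f" and g: "integrable lborel g"
  shows "integrable (lborel \<Otimes>\<^sub>M lborel) (\<lambda>(x, y). f x * g y)"
proof -
  have [measurable]: "f \<in> borel_measurable borel" "g \<in> borel_measurable borel" using f g by auto
  have "(\<integral>\<^sup>+z. ennreal (norm (case z of (x, y) \<Rightarrow> f x * g y)) \<partial>(lborel \<Otimes>\<^sub>M lborel))
     = (\<integral>\<^sup>+x. \<integral>\<^sup>+y. ennreal (norm (f x)) * ennreal (norm (g y)) \<partial>lborel \<partial>lborel)"
    by (subst lborel.nn_integral_fst[symmetric]) (auto simp: case_prod_beta abs_mult ennreal_mult)
  also have "\<dots> = (\<integral>\<^sup>+x. ennreal (norm (f x)) \<partial>lborel) * (\<integral>\<^sup>+y. ennreal (norm (g y)) \<partial>lborel)"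
    by (simp add: nn_integral_cmult nn_integral_multc)
  also have "\<dots> < \<infinity>"
    using f g by (simp add: integrable_iff_bounded ennreal_mult_less_top)
  finally show ?thesis by (intro integrableI_bounded) measurable
qed

lemma integral_window_tail:
  assumes "a \<le> b"
  shows "(LINT s|lborel. indicator {a<..<b} s * indicator {t..} (s::real)) = tent a b t"
proof -
  have "(LINT s|lborel. indicator {a<..<b} s * indicator {t..} (s::real)) = (LINT s|lborel. indicator {max a t..b} s :: real)"
  proof (rule integral_cong_AE)
    have "AE s in lborel. s \<noteq> a" "AE s in lborel. s \<noteq> b" by (rule AE_lborel_singleton)+
    then show "AE s in lborel. indicator {a<..<b} s * indicator {t..} s = (indicator {max a t..b} s :: real)"
      by eventually_elim (auto simp: indicator_def)
  qed measurable
  also have "\<dots> = tent a b t"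
    by (cases "max a t \<le> b") (auto simp: tent_def)
  finally show ?thesis .
qed

section \<open>Spherical means and the divergence theorem on balls\<close>

definition sph_avg :: "('a::euclidean_space \<Rightarrow> 'b::{banach, second_countable_topology}) \<Rightarrow> real \<Rightarrow> 'b" where
  "sph_avg h r = (LINT \<theta>|sphere_measure. h (r *\<^sub>R \<theta>))"

lemma integral_sph_avg:
  fixes f :: "'a::euclidean_space \<Rightarrow> 'b::{banach, second_countable_topology}"
  assumes "integrable lborel f"
  shows "(LINT x|lborel. f x) = (LINT r|radial_measure DIM('a). sph_avg f r)"
    and "integrable (radial_measure DIM('a)) (sph_avg f)"
  unfolding sph_avg_def[abs_def] by (rule integral_polar[OF assms])+

lemma sph_avg_measurable [measurable]:
  fixes h :: "'a::euclidean_space \<Rightarrow> 'b::{banach, second_countable_topology}"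
  assumes [measurable]: "h \<in> borel_measurable borel"
  shows "sph_avg h \<in> borel_measurable borel"
proof -
  interpret prob_space "sphere_measure :: 'a measure" by (rule prob_space_sphere_measure)
  show ?thesis unfolding sph_avg_def[abs_def] by measurable
qed

lemma AE_polar_coords:
  "AE r in radial_measure DIM('a). AE \<theta> in (sphere_measure :: 'a::euclidean_space measure). r > 0 \<and> norm (r *\<^sub>R \<theta>) = r \<and> sgn (r *\<^sub>R \<theta>) = \<theta>"
proof -
  have n: "DIM('a) \<ge> 1" using DIM_positive by (simp add: Suc_le_eq)
  show ?thesis
    unfolding AE_radial_measure_iff[OF n]
  proof (rule AE_I2, rule impI)
    fix r :: real assume "0 < r"
    show "AE \<theta> in (sphere_measure :: 'a measure). r > 0 \<and> norm (r *\<^sub>R \<theta>) = r \<and> sgn (r *\<^sub>R \<theta>) = \<theta>"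
      using AE_sphere_measure_norm by eventually_elim (use \<open>0 < r\<close> in \<open>auto simp: sgn_scaleR sgn_div_norm\<close>)
  qed
qed

text \<open>The divergence theorem on the ball of radius s for the test function times the i-th unit
  vector, the indicator of the ball being written as a function of s. By Fubini and
  \<open>integral_tent_by_parts\<close> both sides have the same integral over every window of
  radii, so they agree for almost every s, which is enough for integration against a
  profile.\<close>

lemma Gauss_ball:
  fixes \<psi> :: "real ^ 'n \<Rightarrow> real"
  assumes \<psi>: "\<psi> \<in> test_functions"
  shows "AE s in lborel. (LINT x|lborel. pdiff i \<psi> x * indicator {norm x..} s)
     = radial_density CARD('n) s * sph_avg (\<lambda>x. \<psi> x * sgn x $ i) s"
proof -
  let ?n = "CARD('n)"
  note [measurable] = test_functions_borel[OF \<psi>] test_functions_borel[OF test_functions_pdiff[OF \<psi>]]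
  let ?w = "radial_density ?n" and ?J = "sph_avg (\<lambda>x. \<psi> x * sgn x $ i)"
  define I where "I s = (LINT x|lborel. pdiff i \<psi> x * indicator {norm x..} s)" for s
  have I_if: "I = (\<lambda>s. LINT x|lborel. pdiff i \<psi> x * (if norm x \<le> s then 1 else 0))"
    unfolding I_def by (auto simp: fun_eq_iff indicator_def of_bool_def)
  have [measurable]: "I \<in> borel_measurable borel" unfolding I_if by measurable
  have intp: "integrable lborel (pdiff i \<psi>)"
    using integrable_test_mult_bounded[OF test_functions_pdiff[OF \<psi>], of "\<lambda>_. 1" 1 i] by simp
  have win: "integrable lborel (\<lambda>s. indicator {a<..<b} s * (I s - ?w s * ?J s)) \<and>
      (LINT s|lborel. indicator {a<..<b} s * (I s - ?w s * ?J s)) = 0" if ab: "0 \<le> a" "a \<le> b" for a b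
  proof -
    let ?K = "\<lambda>(x, s). indicator {a<..<b} s * (pdiff i \<psi> x * indicator {norm x..} s)"
    have K: "integrable (lborel \<Otimes>\<^sub>M lborel) ?K"
    proof (rule Bochner_Integration.integrable_bound)
      show "integrable (lborel \<Otimes>\<^sub>M lborel) (\<lambda>(x, s). pdiff i \<psi> x * indicator {a..b} s)"
        by (rule integrable_pair_product[OF intp]) (use emeasure_lborel_cbox_finite[of a b] in \<open>auto intro!: integrable_real_indicator\<close>)
      have "(\<lambda>(x, s). indicator {a<..<b} s * (pdiff i \<psi> x * (if norm x \<le> s then 1 else 0))) \<in> borel_measurable (lborel \<Otimes>\<^sub>M lborel)"
        by measurable
      then show "?K \<in> borel_measurable (lborel \<Otimes>\<^sub>M lborel)"
        by (simp add: indicator_def of_bool_def case_prod_beta)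
    qed (auto simp: indicator_def)
    have 1: "integrable lborel (\<lambda>s. indicator {a<..<b} s * I s)"
      using lborel_pair.integrable_snd[OF K] by (simp add: I_def)
    have "(LINT s|lborel. indicator {a<..<b} s * I s) = (LINT s|lborel. LINT x|lborel. indicator {a<..<b} s * (pdiff i \<psi> x * indicator {norm x..} s))"
      by (simp add: I_def)
    also have "\<dots> = (LINT x|lborel. LINT s|lborel. indicator {a<..<b} s * (pdiff i \<psi> x * indicator {norm x..} s))"
      by (rule lborel_pair.Fubini_integral) (rule K)
    also have "\<dots> = (LINT x|lborel. pdiff i \<psi> x * tent a b (norm x))"
      by (simp add: mult.left_commute integral_window_tail[OF ab(2)])
    also have "\<dots> = (LINT x|lborel. \<psi> x * (sgn x $ i * indicator {a<..<b} (norm x)))"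
      by (rule integral_tent_by_parts[OF \<psi> ab])
    finally have 2: "(LINT s|lborel. indicator {a<..<b} s * I s) = (LINT x|lborel. \<psi> x * (sgn x $ i * indicator {a<..<b} (norm x)))" .
    let ?F = "\<lambda>x. \<psi> x * (sgn x $ i * indicator {a<..<b} (norm x))"
    have F: "integrable lborel ?F"
      by (rule integrable_test_mult_bounded[OF \<psi> _ sgn_nth_indicator_le]) measurable
    have aeq: "AE r in radial_measure ?n. sph_avg ?F r = indicator {a<..<b} r * ?J r"
      using AE_polar_coords[where 'a="real^'n"] unfolding DIM_cart DIM_real mult_1_right
    proof eventually_elim
      fix r :: real
      assume "AE \<theta> in (sphere_measure :: (real ^ 'n) measure). r > 0 \<and> norm (r *\<^sub>R \<theta>) = r \<and> sgn (r *\<^sub>R \<theta>) = \<theta>"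
      then have "(LINT \<theta>|sphere_measure. ?F (r *\<^sub>R \<theta>)) = (LINT \<theta>|(sphere_measure :: (real^'n) measure). indicator {a<..<b} r * (\<psi> (r *\<^sub>R \<theta>) * sgn (r *\<^sub>R \<theta>) $ i))"
        by (intro integral_cong_AE) auto
      then show "sph_avg ?F r = indicator {a<..<b} r * ?J r"
        by (simp add: sph_avg_def)
    qed
    note P = integral_sph_avg[OF F, unfolded DIM_cart DIM_real mult_1_right]
    have 3: "integrable (radial_measure ?n) (\<lambda>r. indicator {a<..<b} r * ?J r)"
      by (rule integrable_cong_AE_imp[OF P(2)]) (use aeq in \<open>auto elim: eventually_mono\<close>)
    have 4: "(LINT x|lborel. ?F x) = (LINT r|radial_measure ?n. indicator {a<..<b} r * ?J r)"
      unfolding P(1) by (rule integral_cong_AE) (use aeq in auto)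
    have 5: "integrable lborel (\<lambda>s. ?w s * (indicator {a<..<b} s * ?J s))"
      using 3 by (simp add: integral_radial_measure(2))
    have 6: "(LINT r|radial_measure ?n. indicator {a<..<b} r * ?J r) = (LINT s|lborel. ?w s * (indicator {a<..<b} s * ?J s))"
      by (simp add: integral_radial_measure(1))
    have eq: "indicator {a<..<b} s * (I s - ?w s * ?J s) = indicator {a<..<b} s * I s - ?w s * (indicator {a<..<b} s * ?J s)" for s
      by (simp add: algebra_simps)
    show ?thesis unfolding eq using 1 5 2 4 6 by simp
  qed
  have neg: "I s = 0" if "s < 0" for s
  proof -
    have "indicator {norm x..} s = (0::real)" for x :: "real ^ 'n"
      using that norm_ge_zero[of x] by (simp add: indicator_def del: norm_ge_zero)
    then show ?thesis unfolding I_def by simp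
  qed
  have "AE s in lborel. I s - ?w s * ?J s = 0"
  proof (rule AE_zero_if_box_integrals_zero)
    fix a b :: real
    \<comment> \<open>Windows were treated for nonnegative endpoints only. At negative s both terms
      vanish, so cutting the box off at 0 changes neither integrability nor the integral.\<close>
    define a' where "a' = max a 0"
    have eq: "AE s in lborel. indicator (box a b) s *\<^sub>R (I s - ?w s * ?J s) = (if a' \<le> b then indicator {a'<..<b} s * (I s - ?w s * ?J s) else 0)"
      using AE_lborel_singleton[of 0]
    proof eventually_elim
      case (elim s)
      show ?case
      proof (cases "s > 0")
        case True then show ?thesis by (auto simp: indicator_def a'_def box_real)
      next
        case False
        then have "I s - ?w s * ?J s = 0" using elim neg[of s] by (simp add: radial_density_def)
        then show ?thesis by simp
      qed
    qed
    have i0: "integrable lborel (\<lambda>s. if a' \<le> b then indicator {a'<..<b} s * (I s - ?w s * ?J s) else 0)"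
      "(LINT s|lborel. (if a' \<le> b then indicator {a'<..<b} s * (I s - ?w s * ?J s) else 0)) = 0"
    proof -
      have "0 \<le> a'" by (simp add: a'_def)
      note w = win[OF this, of b]
      show "integrable lborel (\<lambda>s. if a' \<le> b then indicator {a'<..<b} s * (I s - ?w s * ?J s) else 0)"
        using w by (cases "a' \<le> b") simp_all
      show "(LINT s|lborel. (if a' \<le> b then indicator {a'<..<b} s * (I s - ?w s * ?J s) else 0)) = 0"
        using w by (cases "a' \<le> b") simp_all
    qed
    show "set_integrable lborel (box a b) (\<lambda>s. I s - ?w s * ?J s)"
      unfolding set_integrable_def
      by (rule integrable_cong_AE_imp[OF i0(1)]) (use eq in \<open>auto elim: eventually_mono\<close>)
    have "(LINT s:box a b|lborel. I s - ?w s * ?J s) = (LINT s|lborel. (if a' \<le> b then indicator {a'<..<b} s * (I s - ?w s * ?J s) else 0))"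
      unfolding set_lebesgue_integral_def
      by (rule integral_cong_AE) (use eq in auto)
    then show "(LINT s:box a b|lborel. I s - ?w s * ?J s) = 0" unfolding i0(2) .
  qed
  then show ?thesis unfolding I_def by eventually_elim simp
qed

section \<open>The correspondence between profiles and radial functions in H1\<close>

lemma ray_tail_radvec:
  fixes x :: "real ^ 'n" and G :: "real \<Rightarrow> complex"
  assumes [measurable]: "G \<in> borel_measurable borel" and x: "x \<noteq> 0"
  shows "ennreal (norm x) * ray_tail (radvec G) x = (\<integral>\<^sup>+s. indicator {norm x..} s * ennreal (norm (G s)) \<partial>lborel)"
proof -
  have "ray_tail (radvec G) x = (\<integral>\<^sup>+t. (\<lambda>s. indicator {norm x..} s * ennreal (norm (G s))) (norm x *\<^sub>R t) \<partial>lborel)"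
    unfolding ray_tail_def
  proof (rule nn_integral_cong)
    fix t :: real
    show "indicator {1..} t * ennreal (norm (radvec G (t *\<^sub>R x))) = indicator {norm x..} (norm x *\<^sub>R t) * ennreal (norm (G (norm x *\<^sub>R t)))"
    proof (cases "t \<ge> 1")
      case True
      then show ?thesis using x norm_radvec[of "t *\<^sub>R x" G] by (simp add: mult.commute)
    qed (use x in \<open>auto simp: indicator_def\<close>)
  qed
  also have "\<dots> = ennreal (inverse (norm x ^ DIM(real))) * (\<integral>\<^sup>+s. indicator {norm x..} s * ennreal (norm (G s)) \<partial>lborel)"
    by (rule nn_integral_lborel_scale) (use x in auto)
  finally have *: "ray_tail (radvec G) x = ennreal (inverse (norm x)) * (\<integral>\<^sup>+s. indicator {norm x..} s * ennreal (norm (G s)) \<partial>lborel)"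
    by simp
  have "ennreal (norm x) * ennreal (inverse (norm x)) = 1"
    using x by (simp add: ennreal_mult[symmetric])
  then show ?thesis unfolding * mult.assoc[symmetric] by simp
qed

lemma radvec_L2:
  fixes G :: "real \<Rightarrow> complex"
  assumes "L2 (radial_measure CARD('n)) G"
  shows "L2 lborel (radvec G :: real ^ 'n \<Rightarrow> complex ^ 'n)"
    and "L2sq lborel (radvec G :: real ^ 'n \<Rightarrow> complex ^ 'n) = L2sq (radial_measure CARD('n)) G"
proof -
  note [measurable] = L2_radial_borel[OF assms]
  have "AE x in lborel. x \<noteq> (0 :: real ^ 'n)" by (rule AE_lborel_singleton)
  then have eq: "AE x in lborel. norm (radvec G x :: complex ^ 'n) = norm (G (norm x))"
    by eventually_elim (rule norm_radvec)
  have L: "L2 lborel (\<lambda>x :: real ^ 'n. G (norm x))"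
    using assms L2_radial_iff(1)[of G, where 'a="real^'n"] by simp
  show "L2 lborel (radvec G :: real ^ 'n \<Rightarrow> complex ^ 'n)"
    by (rule L2_bound[OF L, of _ 1]) (use eq in \<open>auto elim: eventually_mono\<close>)
  have "L2sq lborel (radvec G :: real ^ 'n \<Rightarrow> complex ^ 'n) = L2sq lborel (\<lambda>x :: real ^ 'n. G (norm x))"
    unfolding L2sq_def by (rule integral_cong_AE) (use eq in \<open>auto elim: eventually_mono\<close>)
  then show "L2sq lborel (radvec G :: real ^ 'n \<Rightarrow> complex ^ 'n) = L2sq (radial_measure CARD('n)) G"
    using L2_radial_iff(2)[of G, where 'a="real^'n"] by simp
qed

text \<open>By \<open>ray_tail_radvec\<close> the integral of the norm of G beyond
  \<open>norm x\<close> is \<open>norm x\<close> times \<open>ray_tail\<close>, so the square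
  integrability of \<open>ray_tail\<close> supplies what Fubini needs.\<close>

lemma integrable_test_profile:
  fixes f :: "real ^ 'n \<Rightarrow> real" and G :: "real \<Rightarrow> complex"
  assumes n: "CARD('n) \<ge> 3" and G: "L2 (radial_measure CARD('n)) G" and f: "f \<in> test_functions"
  shows "integrable (lborel \<Otimes>\<^sub>M lborel) (\<lambda>(x, s). indicator {norm x..} s *\<^sub>R (f x *\<^sub>R G s))"
proof -
  note [measurable] = L2_radial_borel[OF G] test_functions_borel[OF f]
  let ?g = "radvec G :: real ^ 'n \<Rightarrow> complex ^ 'n"
  note Lg = radvec_L2(1)[OF G]
  note ray = ray_tail_L2[OF n Lg]
  note L = test_functions_mult_norm_L2[OF f]
  have "(\<lambda>(x, s). (if norm x \<le> s then 1 else 0) *\<^sub>R (f x *\<^sub>R G s)) \<in> borel_measurable (lborel \<Otimes>\<^sub>M lborel)"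
    by measurable
  then have m: "(\<lambda>(x, s). indicator {norm x..} s *\<^sub>R (f x *\<^sub>R G s)) \<in> borel_measurable (lborel \<Otimes>\<^sub>M lborel)"
    by (simp add: indicator_def of_bool_def case_prod_beta)
  have m': "(\<lambda>z. ennreal (norm (case z of (x, s) \<Rightarrow> indicator {norm x..} s *\<^sub>R (f x *\<^sub>R G s)))) \<in> borel_measurable (lborel \<Otimes>\<^sub>M lborel)"
    by (rule measurable_compose[OF m]) measurable
  have "(\<integral>\<^sup>+z. ennreal (norm (case z of (x, s) \<Rightarrow> indicator {norm x..} s *\<^sub>R (f x *\<^sub>R G s))) \<partial>(lborel \<Otimes>\<^sub>M lborel))
     = (\<integral>\<^sup>+x. \<integral>\<^sup>+s. ennreal (norm (indicator {norm x..} s *\<^sub>R (f x *\<^sub>R G s))) \<partial>lborel \<partial>lborel)"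
    using lborel.nn_integral_fst[OF m', symmetric] by simp
  also have "\<dots> = (\<integral>\<^sup>+x. \<integral>\<^sup>+s. ennreal \<bar>f x\<bar> * (indicator {norm x..} s * ennreal (norm (G s))) \<partial>lborel \<partial>lborel)"
    by (intro nn_integral_cong) (auto simp: indicator_def ennreal_mult)
  also have "\<dots> = (\<integral>\<^sup>+x. ennreal \<bar>f x\<bar> * (\<integral>\<^sup>+s. indicator {norm x..} s * ennreal (norm (G s)) \<partial>lborel) \<partial>lborel)"
    by (intro nn_integral_cong nn_integral_cmult) measurable
  also have "\<dots> = (\<integral>\<^sup>+x. ennreal (norm (\<bar>f x\<bar> * norm x) * norm (enn2real (ray_tail ?g x))) \<partial>lborel)"
  proof (rule nn_integral_cong_AE)
    show "AE x in lborel. ennreal \<bar>f x\<bar> * (\<integral>\<^sup>+s. indicator {norm x..} s * ennreal (norm (G s)) \<partial>lborel) = ennreal (norm (\<bar>f x\<bar> * norm x) * norm (enn2real (ray_tail ?g x)))"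
      using ray(2) AE_lborel_singleton[of 0]
      by eventually_elim (simp add: ennreal_mult ray_tail_radvec[symmetric] mult.assoc)
  qed
  also have "\<dots> < \<infinity>"
    using L2_integrable_norm_mult[OF L ray(1)] by (simp add: nn_integral_eq_integral)
  finally show ?thesis by (intro integrableI_bounded m)
qed

text \<open>Up to sign, \<open>prof G (norm x)\<close> is a superposition of indicators of balls of
  radius s with weight G(s). \<open>Gauss_ball\<close> gives the derivative of each of them, and
  polar coordinates recombine the sphere integrals into an integral over the space.\<close>

theorem weak_pair_profile:
  assumes n: "CARD('n) \<ge> 3" and G: "rad_profile CARD('n) G"
  shows "weak_pair (\<lambda>x :: real ^ 'n. prof G (norm x)) (radvec G)"
  unfolding weak_pair_def
proof (intro conjI ballI allI)
  let ?n = "CARD('n)"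
  have L: "L2 (radial_measure ?n) G" "L2 (radial_measure ?n) (prof G)" using G by (auto simp: rad_profile_def)
  note [measurable] = L2_radial_borel[OF L(1)]
  show "L2 lborel (\<lambda>x :: real ^ 'n. prof G (norm x))"
    using L(2) L2_radial_iff(1)[of "prof G", where 'a="real^'n"] by simp
  show Lr: "L2 lborel (radvec G :: real ^ 'n \<Rightarrow> complex ^ 'n)" by (rule radvec_L2(1)[OF L(1)])
  fix \<psi> :: "real ^ 'n \<Rightarrow> real" and i assume \<psi>: "\<psi> \<in> test_functions"
  note p = test_functions_pdiff[OF \<psi>, of i]
  note [measurable] = test_functions_borel[OF \<psi>] test_functions_borel[OF p]
  let ?J = "sph_avg (\<lambda>x. \<psi> x * sgn x $ i)"
  have "(LINT x|lborel. pdiff i \<psi> x *\<^sub>R prof G (norm x)) = - (LINT x|lborel. LINT s|lborel. indicator {norm x..} s *\<^sub>R (pdiff i \<psi> x *\<^sub>R G s))"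
    unfolding prof_def set_lebesgue_integral_def
    by (simp only: scaleR_minus_right integral_scaleR_right[symmetric] integral_minus scaleR_left_commute)
  also have "(LINT x|lborel. LINT s|lborel. indicator {norm x..} s *\<^sub>R (pdiff i \<psi> x *\<^sub>R G s)) = (LINT s|lborel. LINT x|lborel. indicator {norm x..} s *\<^sub>R (pdiff i \<psi> x *\<^sub>R G s))"
    by (rule lborel_pair.Fubini_integral[symmetric]) (rule integrable_test_profile[OF n L(1) p])
  also have "\<dots> = (LINT s|lborel. radial_density ?n s *\<^sub>R (?J s *\<^sub>R G s))"
  proof (rule integral_cong_AE)
    have m: "(\<lambda>s. LINT x|lborel. (if norm x \<le> s then 1 else 0) *\<^sub>R (pdiff i \<psi> x *\<^sub>R G s)) \<in> borel_measurable lborel"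
      by measurable
    then show "(\<lambda>s. LINT x|lborel. indicator {norm x..} s *\<^sub>R (pdiff i \<psi> x *\<^sub>R G s)) \<in> borel_measurable lborel"
      by (simp add: indicator_def of_bool_def)
    show "AE s in lborel. (LINT x|lborel. indicator {norm x..} s *\<^sub>R (pdiff i \<psi> x *\<^sub>R G s)) = radial_density ?n s *\<^sub>R (?J s *\<^sub>R G s)"
      using Gauss_ball[OF \<psi>, of i]
    proof eventually_elim
      case (elim s)
      have "(\<lambda>x :: real ^ 'n. if norm x \<le> s then 1 else 0 :: real) \<in> borel_measurable borel" by measurable
      then have "(\<lambda>x :: real ^ 'n. indicator {norm x..} s :: real) \<in> borel_measurable borel"
        by (simp add: indicator_def of_bool_def)
      then have "integrable lborel (\<lambda>x. pdiff i \<psi> x * indicator {norm x..} s)"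
        by (rule integrable_test_mult_bounded[OF p, of _ 1]) (simp add: indicator_def)
      then have "(LINT x|lborel. (pdiff i \<psi> x * indicator {norm x..} s) *\<^sub>R G s) = (LINT x|lborel. pdiff i \<psi> x * indicator {norm x..} s) *\<^sub>R G s"
        by (intro integral_scaleR_left)
      then show ?case unfolding elim by (simp add: mult.commute)
    qed
  qed measurable
  also have "\<dots> = (LINT r|radial_measure ?n. ?J r *\<^sub>R G r)"
    by (simp add: integral_radial_measure(1))
  also have "\<dots> = (LINT x|lborel. \<psi> x *\<^sub>R (radvec G x $ i))"
  proof -
    have "integrable lborel (\<lambda>x. \<psi> x *\<^sub>R (radvec G x $ i))"
      by (rule test_functions_integrable[OF \<psi> L2_nth[OF Lr]])
    from integral_polar(1)[OF this]
    have "(LINT x|lborel. \<psi> x *\<^sub>R (radvec G x $ i)) = (LINT r|radial_measure ?n. LINT \<theta>|sphere_measure. \<psi> (r *\<^sub>R \<theta>) *\<^sub>R (radvec G (r *\<^sub>R \<theta>) $ i))"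
      by simp
    also have "\<dots> = (LINT r|radial_measure ?n. ?J r *\<^sub>R G r)"
    proof (rule integral_cong_AE)
      interpret prob_space "sphere_measure :: (real ^ 'n) measure" by (rule prob_space_sphere_measure)
      show "(\<lambda>r. LINT \<theta>|sphere_measure. \<psi> (r *\<^sub>R \<theta>) *\<^sub>R (radvec G (r *\<^sub>R \<theta>) $ i)) \<in> borel_measurable (radial_measure ?n)"
        unfolding measurable_radial by measurable
      show "(\<lambda>r. ?J r *\<^sub>R G r) \<in> borel_measurable (radial_measure ?n)"
        unfolding measurable_radial by measurable
      show "AE r in radial_measure ?n. (LINT \<theta>|sphere_measure. \<psi> (r *\<^sub>R \<theta>) *\<^sub>R (radvec G (r *\<^sub>R \<theta>) $ i)) = ?J r *\<^sub>R G r"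
        using AE_polar_coords[where 'a="real^'n"] unfolding DIM_cart DIM_real mult_1_right
      proof eventually_elim
        fix r :: real
        assume ae: "AE \<theta> in (sphere_measure :: (real ^ 'n) measure). r > 0 \<and> norm (r *\<^sub>R \<theta>) = r \<and> sgn (r *\<^sub>R \<theta>) = \<theta>"
        have "(LINT \<theta>|sphere_measure. \<psi> (r *\<^sub>R \<theta>) *\<^sub>R (radvec G (r *\<^sub>R \<theta>) $ i))
           = (LINT \<theta>|(sphere_measure :: (real^'n) measure). (\<psi> (r *\<^sub>R \<theta>) * sgn (r *\<^sub>R \<theta>) $ i) *\<^sub>R G r)"
          by (rule integral_cong_AE) (use ae in \<open>auto simp: radvec_def elim!: eventually_mono\<close>)
        also have "\<dots> = ?J r *\<^sub>R G r"
          unfolding sph_avg_def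
        proof (rule integral_scaleR_left)
          obtain B where B: "\<And>x. \<bar>\<psi> x\<bar> \<le> B" using test_functions_bounded[OF \<psi>] by metis
          have "\<bar>\<psi> x * sgn x $ i\<bar> \<le> B * 1" for x
            unfolding abs_mult using B[of x] component_le_norm_cart[of "sgn x" i]
            by (intro mult_mono) (auto simp: norm_sgn split: if_splits)
          then show "integrable sphere_measure (\<lambda>\<theta>. \<psi> (r *\<^sub>R \<theta>) * sgn (r *\<^sub>R \<theta>) $ i)"
            by (intro integrable_const_bound[of _ B]) auto
        qed
        finally show "(LINT \<theta>|sphere_measure. \<psi> (r *\<^sub>R \<theta>) *\<^sub>R (radvec G (r *\<^sub>R \<theta>) $ i)) = ?J r *\<^sub>R G r" .
      qed
    qed
    finally show ?thesis by simp
  qed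
  finally show "(LINT x|lborel. pdiff i \<psi> x *\<^sub>R prof G (norm x)) = - (LINT x|lborel. \<psi> x *\<^sub>R (radvec G x $ i))" .
qed

lemma sph_avg_L2:
  fixes h :: "'a::euclidean_space \<Rightarrow> 'b::euclidean_space"
  assumes h: "L2 lborel h"
  shows "L2 (radial_measure DIM('a)) (sph_avg h)"
    and "AE r in radial_measure DIM('a). integrable sphere_measure (\<lambda>\<theta>. h (r *\<^sub>R \<theta>))"
proof -
  interpret prob_space "sphere_measure :: 'a measure" by (rule prob_space_sphere_measure)
  have [measurable]: "h \<in> borel_measurable borel" using L2_measurable[OF h] by simp
  note I = L2_integrable[OF h]
  have *: "AE r in radial_measure DIM('a). integrable sphere_measure (\<lambda>\<theta>. h (r *\<^sub>R \<theta>)) \<and>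
      (norm (sph_avg h r))\<^sup>2 \<le> sph_avg (\<lambda>x. (norm (h x))\<^sup>2) r"
    using integral_polar(2)[OF I]
  proof eventually_elim
    case (elim r)
    have L: "L2 sphere_measure (\<lambda>\<theta>. h (r *\<^sub>R \<theta>))" using elim by (simp add: L2_def)
    have L1: "L2 (sphere_measure :: 'a measure) (\<lambda>\<theta>. 1 :: real)" by (simp add: L2_def)
    have In: "integrable sphere_measure (\<lambda>\<theta>. norm (h (r *\<^sub>R \<theta>)))"
      using L2_integrable_norm_mult[OF L L1] by simp
    then have Ih: "integrable sphere_measure (\<lambda>\<theta>. h (r *\<^sub>R \<theta>))"
      by (subst (asm) integrable_norm_iff) auto
    have "(norm (sph_avg h r))\<^sup>2 \<le> (LINT \<theta>|sphere_measure. norm (h (r *\<^sub>R \<theta>)))\<^sup>2"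
      unfolding sph_avg_def by (intro power_mono integral_norm_bound) auto
    also have "\<dots> \<le> sph_avg (\<lambda>x. (norm (h x))\<^sup>2) r"
      using L2_Cauchy_Schwarz[OF L L1] prob_space by (simp add: L2sq_def sph_avg_def)
    finally show ?case using Ih by simp
  qed
  then show "AE r in radial_measure DIM('a). integrable sphere_measure (\<lambda>\<theta>. h (r *\<^sub>R \<theta>))"
    by eventually_elim simp
  have "integrable (radial_measure DIM('a)) (\<lambda>r. (norm (sph_avg h r))\<^sup>2)"
  proof (rule Bochner_Integration.integrable_bound[OF integral_sph_avg(2)[OF I]])
    show "AE r in radial_measure DIM('a). norm ((norm (sph_avg h r))\<^sup>2) \<le> norm (sph_avg (\<lambda>x. (norm (h x))\<^sup>2) r)"
      using * by eventually_elim (auto intro: order_trans[OF _ abs_ge_self])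
  qed simp
  then show "L2 (radial_measure DIM('a)) (sph_avg h)" by (simp add: L2_def)
qed

definition radial_deriv :: "(real ^ 'n \<Rightarrow> complex ^ 'n) \<Rightarrow> real ^ 'n \<Rightarrow> complex" where
  "radial_deriv g x = cdot (sgn x) (g x)"

lemma radial_deriv_measurable [measurable]:
  assumes [measurable]: "g \<in> borel_measurable borel"
  shows "radial_deriv g \<in> borel_measurable borel"
  unfolding radial_deriv_def[abs_def] by measurable

lemma radial_deriv_L2: "L2 lborel g \<Longrightarrow> L2 lborel (radial_deriv g)"
proof (rule L2_bound[of lborel g _ 1])
  assume g: "L2 lborel g"
  note [measurable] = L2_measurable[OF g, unfolded measurable_lborel2]
  show "radial_deriv g \<in> borel_measurable lborel" by measurable
  have "norm (radial_deriv g x) \<le> norm (g x)" for x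
    using norm_cdot_le[of "sgn x" "g x"] by (cases "x = 0") (auto simp: radial_deriv_def norm_sgn cdot_def)
  then show "AE x in lborel. norm (radial_deriv g x) \<le> 1 * norm (g x)" by simp
qed

lemma integrable_ray_annulus:
  fixes h :: "real ^ 'n \<Rightarrow> complex"
  assumes n: "CARD('n) \<ge> 3" and h: "L2 lborel h" and r: "r > 0"
  shows "integrable (sphere_measure \<Otimes>\<^sub>M lborel) (\<lambda>(\<theta>, s). indicator {r..} s *\<^sub>R h (s *\<^sub>R \<theta>))"
proof -
  let ?n = "CARD('n)"
  let ?S = "sphere_measure :: (real ^ 'n) measure"
  have n1: "?n \<ge> 1" using n by simp
  interpret S: prob_space ?S by (rule prob_space_sphere_measure)
  interpret P: pair_sigma_finite ?S "lborel :: real measure" ..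
  have [measurable]: "h \<in> borel_measurable borel" using L2_measurable[OF h] by simp
  \<comment> \<open>Multiplication by the inverse density converts the unweighted integral in s into
    a Lebesgue integral over the space. Beyond r this factor is square integrable by
    \<open>inverse_density_tail\<close>, so it can be paired with h.\<close>
  define u where "u s = indicator {r..} s / radial_density ?n s" for s
  have [measurable]: "u \<in> borel_measurable borel" unfolding u_def by measurable
  have u0: "0 \<le> u s" for s by (simp add: u_def radial_density_nonneg)
  have wu: "radial_density ?n s * u s = indicator {r..} s" for s
    using radial_density_pos[OF n1, of s] r by (auto simp: u_def indicator_def)
  have "L2 (radial_measure ?n) u"
  proof -
    have "radial_density ?n s *\<^sub>R (norm (u s))\<^sup>2 = indicator {r..} s *\<^sub>R (1 / radial_density ?n s)" for s
      using radial_density_pos[OF n1, of s] r by (cases "s \<ge> r") (simp_all add: u_def power2_eq_square)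
    then show ?thesis
      using inverse_density_tail(1)[OF n r] by (simp add: L2_def integral_radial_measure(2) set_integrable_def)
  qed
  then have Lu: "L2 lborel (\<lambda>x :: real ^ 'n. u (norm x))"
    using L2_radial_iff(1)[of u, where 'a="real^'n"] by simp
  have "(\<integral>\<^sup>+z. ennreal (norm (case z of (\<theta>, s) \<Rightarrow> indicator {r..} s *\<^sub>R h (s *\<^sub>R \<theta>))) \<partial>(?S \<Otimes>\<^sub>M lborel))
     = (\<integral>\<^sup>+s. \<integral>\<^sup>+\<theta>. ennreal (norm (indicator {r..} s *\<^sub>R h (s *\<^sub>R \<theta>))) \<partial>?S \<partial>lborel)"
    by (subst P.nn_integral_snd[symmetric]) (auto simp: case_prod_beta)
  also have "\<dots> = (\<integral>\<^sup>+s. ennreal (radial_density ?n s) * (\<integral>\<^sup>+\<theta>. ennreal (u s * norm (h (s *\<^sub>R \<theta>))) \<partial>?S) \<partial>lborel)"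
  proof (rule nn_integral_cong)
    fix s :: real
    have "ennreal (norm (indicator {r..} s *\<^sub>R h (s *\<^sub>R \<theta>))) = ennreal (radial_density ?n s) * ennreal (u s * norm (h (s *\<^sub>R \<theta>)))" for \<theta>
      using wu[of s] by (simp add: ennreal_mult[symmetric] radial_density_nonneg u0 mult.assoc[symmetric])
    then show "(\<integral>\<^sup>+\<theta>. ennreal (norm (indicator {r..} s *\<^sub>R h (s *\<^sub>R \<theta>))) \<partial>?S)
       = ennreal (radial_density ?n s) * (\<integral>\<^sup>+\<theta>. ennreal (u s * norm (h (s *\<^sub>R \<theta>))) \<partial>?S)"
      by (simp add: nn_integral_cmult)
  qed
  also have "\<dots> = (\<integral>\<^sup>+s. \<integral>\<^sup>+\<theta>. ennreal (u s * norm (h (s *\<^sub>R \<theta>))) \<partial>?S \<partial>radial_measure ?n)"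
    unfolding radial_measure_def by (subst nn_integral_density) auto
  also have "\<dots> = (\<integral>\<^sup>+s. \<integral>\<^sup>+\<theta>. ennreal (u (norm (s *\<^sub>R \<theta>)) * norm (h (s *\<^sub>R \<theta>))) \<partial>?S \<partial>radial_measure ?n)"
  proof (rule nn_integral_cong_AE)
    show "AE s in radial_measure ?n. (\<integral>\<^sup>+\<theta>. ennreal (u s * norm (h (s *\<^sub>R \<theta>))) \<partial>?S) = (\<integral>\<^sup>+\<theta>. ennreal (u (norm (s *\<^sub>R \<theta>)) * norm (h (s *\<^sub>R \<theta>))) \<partial>?S)"
      using AE_polar_coords[where 'a="real^'n"] unfolding DIM_cart DIM_real mult_1_right
    proof eventually_elim
      case (elim s)
      show ?case by (rule nn_integral_cong_AE) (use elim in \<open>auto elim!: eventually_mono\<close>)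
    qed
  qed
  also have "\<dots> = (\<integral>\<^sup>+x. ennreal (norm (u (norm x)) * norm (h x)) \<partial>lborel)"
    using nn_integral_polar[of "\<lambda>x :: real^'n. ennreal (u (norm x) * norm (h x))"] u0 by simp
  also have "\<dots> < \<infinity>"
    using L2_integrable_norm_mult[OF Lu h] by (simp add: nn_integral_eq_integral)
  finally show ?thesis by (intro integrableI_bounded) measurable
qed

text \<open>Serves two ends: it extracts the profile of a radial function, and it replaces an
  arbitrary test function by a profile when the equation is tested. The substitution s = r t turns
  the ray from \<open>r *\<^sub>R \<theta>\<close> into the half-line from r, so that averaging over
  directions acts on the derivative alone.\<close>

theorem sph_avg_weak_pair:
  fixes v :: "real ^ 'n \<Rightarrow> complex"
  assumes n: "CARD('n) \<ge> 3" and W: "weak_pair v g"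
  defines "G \<equiv> sph_avg (radial_deriv g)"
  shows "AE r in radial_measure CARD('n). sph_avg v r = prof G r" and "rad_profile CARD('n) G"
proof -
  let ?n = "CARD('n)"
  let ?S = "sphere_measure :: (real ^ 'n) measure"
  interpret S: prob_space ?S by (rule prob_space_sphere_measure)
  interpret P: pair_sigma_finite ?S "lborel :: real measure" ..
  have L: "L2 lborel v" "L2 lborel g" using W by (auto simp: weak_pair_def)
  note [measurable] = L[THEN L2_measurable, unfolded measurable_lborel2]
  note Lh = radial_deriv_L2[OF L(2)]
  have LG: "L2 (radial_measure ?n) G" unfolding G_def using sph_avg_L2(1)[OF Lh] by simp
  note [measurable] = L2_radial_borel[OF LG]
  have ray: "ray_integral g (r *\<^sub>R \<theta>) = (LINT s|lborel. indicator {r..} s *\<^sub>R radial_deriv g (s *\<^sub>R \<theta>))"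
    if r: "r > 0" and \<theta>: "norm \<theta> = 1" for r \<theta>
  proof -
    have sg: "sgn (s *\<^sub>R \<theta>) = \<theta>" if "s > 0" for s using that \<theta> by (simp add: sgn_scaleR) (simp add: sgn_div_norm)
    have "ray_integral g (r *\<^sub>R \<theta>) = (LINT t|lborel. r *\<^sub>R ((\<lambda>s. indicator {r..} s *\<^sub>R radial_deriv g (s *\<^sub>R \<theta>)) (r *\<^sub>R t)))"
      unfolding ray_integral_def
    proof (rule Bochner_Integration.integral_cong[OF refl])
      fix t :: real
      show "indicator {1..} t *\<^sub>R cdot (r *\<^sub>R \<theta>) (g (t *\<^sub>R r *\<^sub>R \<theta>)) = r *\<^sub>R ((\<lambda>s. indicator {r..} s *\<^sub>R radial_deriv g (s *\<^sub>R \<theta>)) (r *\<^sub>R t))"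
      proof (cases "t \<ge> 1")
        case True
        then have "r * t > 0" using r by simp
        from sg[OF this] show ?thesis
          using True r by (simp add: cdot_scaleR_left radial_deriv_def mult.commute)
      qed (use r in \<open>auto simp: indicator_def\<close>)
    qed
    also have "\<dots> = r *\<^sub>R (inverse (r ^ DIM(real)) *\<^sub>R (LINT s|lborel. indicator {r..} s *\<^sub>R radial_deriv g (s *\<^sub>R \<theta>)))"
      by (subst integral_scaleR_right, subst integral_lborel_scale[OF _ r]) auto
    finally show ?thesis using r by simp
  qed
  show ae: "AE r in radial_measure ?n. sph_avg v r = prof G r"
    using AE_polar[OF ray_representation[OF n W]] AE_polar_coords[where 'a="real^'n"]
    unfolding DIM_cart DIM_real mult_1_right
  proof eventually_elim
    case (elim r)
    have "r > 0"
    proof -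
      have "AE \<theta> in ?S. r > 0" using elim(2) by eventually_elim simp
      then show ?thesis by simp
    qed
    have "sph_avg v r = (LINT \<theta>|?S. - (LINT s|lborel. indicator {r..} s *\<^sub>R radial_deriv g (s *\<^sub>R \<theta>)))"
      unfolding sph_avg_def
    proof (rule integral_cong_AE)
      show "AE \<theta> in ?S. v (r *\<^sub>R \<theta>) = - (LINT s|lborel. indicator {r..} s *\<^sub>R radial_deriv g (s *\<^sub>R \<theta>))"
        using elim(1) AE_sphere_measure_norm by eventually_elim (simp add: ray[OF \<open>r > 0\<close>])
    qed measurable
    also have "\<dots> = - (LINT \<theta>|?S. LINT s|lborel. indicator {r..} s *\<^sub>R radial_deriv g (s *\<^sub>R \<theta>))" by simp
    also have "(LINT \<theta>|?S. LINT s|lborel. indicator {r..} s *\<^sub>R radial_deriv g (s *\<^sub>R \<theta>))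
       = (LINT s|lborel. LINT \<theta>|?S. indicator {r..} s *\<^sub>R radial_deriv g (s *\<^sub>R \<theta>))"
      by (rule P.Fubini_integral[symmetric]) (rule integrable_ray_annulus[OF n Lh \<open>r > 0\<close>])
    finally show ?case
      by (simp add: prof_def set_lebesgue_integral_def G_def sph_avg_def)
  qed
  have "L2 (radial_measure ?n) (sph_avg v)" using sph_avg_L2(1)[OF L(1)] by simp
  from L2_cong_AE[OF this _ ae] LG show "rad_profile ?n G"
    by (simp add: rad_profile_def)
qed

text \<open>The mean of v over the sphere of radius r is f(r) for almost every r, which identifies
  the arbitrary function f with a profile; uniqueness of the weak gradient then determines
  g.\<close>

theorem radial_weak_pair:
  fixes v :: "real ^ 'n \<Rightarrow> complex"
  assumes n: "CARD('n) \<ge> 3" and W: "weak_pair v g" and rad: "AE x in lborel. v x = f (norm x)"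
  obtains G where "rad_profile CARD('n) G" "AE x in lborel. v x = prof G (norm x)" "AE x in lborel. g x = radvec G x"
proof -
  let ?n = "CARD('n)"
  let ?S = "sphere_measure :: (real ^ 'n) measure"
  interpret S: prob_space ?S by (rule prob_space_sphere_measure)
  define G where "G = sph_avg (radial_deriv g)"
  note G = sph_avg_weak_pair[OF n W, folded G_def]
  have L: "L2 lborel v" "L2 lborel g" using W by (auto simp: weak_pair_def)
  note [measurable] = L[THEN L2_measurable, unfolded measurable_lborel2]
  have "AE r in radial_measure ?n. f r = prof G r"
    using AE_polar[OF rad] AE_polar_coords[where 'a="real^'n"] G(1)
    unfolding DIM_cart DIM_real mult_1_right
  proof eventually_elim
    case (elim r)
    have "sph_avg v r = (LINT \<theta>|?S. f r)"
      unfolding sph_avg_def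
    proof (rule integral_cong_AE)
      show "AE \<theta> in ?S. v (r *\<^sub>R \<theta>) = f r"
        using elim(1,2) by eventually_elim metis
    qed measurable
    then show ?case using elim(3) S.prob_space by simp
  qed
  from AE_norm_of_AE_radial[where 'a="real^'n", unfolded DIM_cart DIM_real mult_1_right, OF this]
  have "AE x in lborel. f (norm (x :: real ^ 'n)) = prof G (norm x)" .
  with rad have v: "AE x in lborel. v x = prof G (norm x)" by eventually_elim simp
  show ?thesis
    by (rule that[OF G(2) v weak_pair_unique[OF W weak_pair_profile[OF n G(2)] v]])
qed

section \<open>The variational problem for profiles\<close>

lemma L2sq_cong_AE:
  assumes "f \<in> borel_measurable M" "g \<in> borel_measurable M" "AE x in M. f x = g x"
  shows "L2sq M f = L2sq M g"
  unfolding L2sq_def by (rule integral_cong_AE) (use assms in \<open>auto elim: eventually_mono\<close>)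

lemma AE_radial_pos: "n \<ge> 1 \<Longrightarrow> AE r in radial_measure n. r > 0"
  by (simp add: AE_radial_measure_iff)

lemma set_integrable_powr_atLeast:
  fixes a b :: real
  assumes "b > 1" "a > 0"
  shows "set_integrable lborel {a..} (\<lambda>t. t powr - b)"
  unfolding set_integrable_def
proof (rule integrableI_nonneg)
  have "(\<integral>\<^sup>+t. ennreal (indicator {a..} t *\<^sub>R t powr - b) \<partial>lborel) = (\<integral>\<^sup>+t. indicator {a..} t * ennreal (t powr - b) \<partial>lborel)"
    by (intro nn_integral_cong) (auto simp: indicator_def)
  also have "\<dots> < \<infinity>" by (subst nn_integral_powr_atLeast[OF assms]) simp
  finally show "(\<integral>\<^sup>+t. ennreal (indicator {a..} t *\<^sub>R t powr - b) \<partial>lborel) < \<infinity>" .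
qed auto

lemma set_integrable_powr_from_0:
  assumes "b > - 1"
  shows "set_integrable lborel {0<..1} (\<lambda>t::real. t powr b)"
  unfolding set_integrable_def
proof (rule integrableI_nonneg)
  have "((\<lambda>x. x powr b) has_integral (1 powr (b+1) / (b+1))) {0..1::real}"
    by (rule has_integral_powr_from_0) (use assms in auto)
  then have "((\<lambda>t. if t \<in> {0..1} then t powr b else 0) has_integral (1 powr (b+1) / (b+1))) UNIV"
    by (simp only: has_integral_restrict_UNIV)
  then have "((\<lambda>t. indicator {0..1} t * t powr b) has_integral (1 powr (b+1) / (b+1))) UNIV"
    by (rule has_integral_eq[rotated]) auto
  then have "(\<integral>\<^sup>+t. ennreal (indicator {0..1} t * t powr b) \<partial>lborel) = ennreal (1 powr (b+1) / (b+1))"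
    by (intro nn_integral_has_integral_lborel) auto
  moreover have "(\<integral>\<^sup>+t. ennreal (indicator {0<..1} t *\<^sub>R t powr b) \<partial>lborel) \<le> (\<integral>\<^sup>+t. ennreal (indicator {0..1} t * t powr b) \<partial>lborel)"
    by (intro nn_integral_mono) (auto simp: indicator_def)
  ultimately show "(\<integral>\<^sup>+t. ennreal (indicator {0<..1} t *\<^sub>R t powr b) \<partial>lborel) < \<infinity>"
    by (simp add: le_less_trans)
qed auto

definition hprof :: "(real \<Rightarrow> complex) \<Rightarrow> real \<Rightarrow> complex" where
  "hprof G r = inverse r *\<^sub>R prof G r"

lemma hprof_measurable [measurable]: "G \<in> borel_measurable borel \<Longrightarrow> hprof G \<in> borel_measurable borel"
  unfolding hprof_def[abs_def] by measurable

text \<open>The dimension is a number here and not a type, so the Hardy inequality, which is proved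
  on \<open>real ^ 'n\<close>, enters as an assumption; \<open>profile_Hardy\<close> discharges it.
  The minimization itself takes place on the half-line.\<close>

locale radial_variational =
  fixes n :: nat and c \<alpha> \<omega> :: real
  assumes n: "n \<ge> 3" and c: "c < ((real n - 2) / 2)\<^sup>2"
    and \<alpha>: "4 / real n < \<alpha>" "\<alpha> < 4 / (real n - 2)" and \<omega>: "\<omega> > 0"
    and Hardy: "\<And>G. rad_profile n G \<Longrightarrow> L2 (radial_measure n) (hprof G) \<and>
       L2sq (radial_measure n) (hprof G) \<le> (2 / (real n - 2))\<^sup>2 * L2sq (radial_measure n) G"
begin

abbreviation "\<mu> \<equiv> radial_measure n"
abbreviation "rp \<equiv> rad_profile n"

text \<open>For \<open>v x = prof G (norm x)\<close> these are \<open>E G = \<parallel>v\<parallel>\<^sup>2 + \<omega> \<parallel>v\<parallel>\<^sup>2\<close>, the first norm being that of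
  \<open>Hc_norm_sq\<close> and the second that of \<open>L\<^sup>2\<close>, its polar form \<open>B\<close>, and \<open>N G = \<parallel>v\<parallel> powr (\<alpha> + 2)\<close> for
  the norm of \<open>L\<^bsup>\<alpha>+2\<^esup>\<close>; up to the factor \<open>\<alpha> + 2\<close>, \<open>R G\<close> is the differential of \<open>N\<close> at \<open>G\<close>. The square
  of the norm of \<open>H1\<close> is \<open>Q\<close>, and \<open>D\<close> dominates every profile with \<open>Q G \<le> 1\<close>.\<close>

definition "E G = L2sq \<mu> G - c * L2sq \<mu> (hprof G) + \<omega> * L2sq \<mu> (prof G)"
definition "B G H = L2inner \<mu> G H - c * L2inner \<mu> (hprof G) (hprof H) + \<omega> * L2inner \<mu> (prof G) (prof H)"
definition "N G = (LINT r|\<mu>. norm (prof G r) powr (\<alpha> + 2))"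
definition "R G H = (LINT r|\<mu>. norm (prof G r) powr \<alpha> * (prof G r \<bullet> prof H r))"
definition "Q G = L2sq \<mu> G + L2sq \<mu> (prof G)"
definition "D r = (if r \<le> 1 then sqrt (tail_const n r) else sqrt (2 / radial_density n r))"

lemma n1: "n \<ge> 1" using n by simp

lemma \<alpha>pos: "\<alpha> > 0"
proof -
  have "0 < 4 / real n" using n by simp
  then show ?thesis using \<alpha>(1) by (rule less_trans)
qed

lemma rpD:
  assumes "rp G"
  shows "L2 \<mu> G" "L2 \<mu> (prof G)" "L2 \<mu> (hprof G)" "G \<in> borel_measurable borel" "prof G \<in> borel_measurable borel"
    "hprof G \<in> borel_measurable borel"
  using assms Hardy L2_radial_borel by (auto simp: rad_profile_def)

lemma rp_linear:
  assumes G: "rp G" and H: "rp H"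
  shows "rp (\<lambda>s. a * G s + b * H s)"
    and "AE r in \<mu>. prof (\<lambda>s. a * G s + b * H s) r = a * prof G r + b * prof H r"
    and "AE r in \<mu>. hprof (\<lambda>s. a * G s + b * H s) r = a * hprof G r + b * hprof H r"
proof -
  note [measurable] = rpD(4,5)[OF G] rpD(4,5)[OF H]
  show ae: "AE r in \<mu>. prof (\<lambda>s. a * G s + b * H s) r = a * prof G r + b * prof H r"
    using AE_radial_pos[OF n1] by eventually_elim (rule prof_linear[OF n rpD(1)[OF G] rpD(1)[OF H]])
  then show "AE r in \<mu>. hprof (\<lambda>s. a * G s + b * H s) r = a * hprof G r + b * hprof H r"
    by eventually_elim (simp add: hprof_def scaleR_add_right)
  have "L2 \<mu> (\<lambda>s. a * G s + b * H s)"
    by (intro L2_add L2_cmult rpD G H)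
  moreover have "L2 \<mu> (prof (\<lambda>s. a * G s + b * H s))"
  proof (rule L2_cong_AE)
    show "L2 \<mu> (\<lambda>r. a * prof G r + b * prof H r)" by (intro L2_add L2_cmult rpD G H)
    show "prof (\<lambda>s. a * G s + b * H s) \<in> borel_measurable \<mu>" unfolding measurable_radial by measurable
    show "AE r in \<mu>. a * prof G r + b * prof H r = prof (\<lambda>s. a * G s + b * H s) r"
      using ae by eventually_elim simp
  qed
  ultimately show "rp (\<lambda>s. a * G s + b * H s)" by (simp add: rad_profile_def)
qed

lemma E_linear:
  fixes a b :: real
  assumes G: "rp G" and H: "rp H"
  shows "E (\<lambda>s. of_real a * G s + of_real b * H s) = a\<^sup>2 * E G + 2 * a * b * B G H + b\<^sup>2 * E H"
proof -
  note [measurable] = rpD(4-6)[OF G] rpD(4-6)[OF H]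
  let ?K = "\<lambda>s. of_real a * G s + of_real b * H s"
  note K = rp_linear[OF G H, of "of_real a" "of_real b"]
  note [measurable] = rpD(4-6)[OF K(1)]
  have 1: "L2sq \<mu> ?K = a\<^sup>2 * L2sq \<mu> G + 2 * a * b * L2inner \<mu> G H + b\<^sup>2 * L2sq \<mu> H"
    using L2sq_linear[OF rpD(1)[OF G] rpD(1)[OF H], of a b] by (simp add: scaleR_conv_of_real)
  have "L2sq \<mu> (prof ?K) = L2sq \<mu> (\<lambda>r. of_real a * prof G r + of_real b * prof H r)"
    by (rule L2sq_cong_AE[OF _ _ K(2)]) (unfold measurable_radial, measurable)
  also have "\<dots> = a\<^sup>2 * L2sq \<mu> (prof G) + 2 * a * b * L2inner \<mu> (prof G) (prof H) + b\<^sup>2 * L2sq \<mu> (prof H)"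
    using L2sq_linear[OF rpD(2)[OF G] rpD(2)[OF H], of a b] by (simp add: scaleR_conv_of_real)
  finally have 2: "L2sq \<mu> (prof ?K) = a\<^sup>2 * L2sq \<mu> (prof G) + 2 * a * b * L2inner \<mu> (prof G) (prof H) + b\<^sup>2 * L2sq \<mu> (prof H)" .
  have "L2sq \<mu> (hprof ?K) = L2sq \<mu> (\<lambda>r. of_real a * hprof G r + of_real b * hprof H r)"
    by (rule L2sq_cong_AE[OF _ _ K(3)]) (unfold measurable_radial, measurable)
  also have "\<dots> = a\<^sup>2 * L2sq \<mu> (hprof G) + 2 * a * b * L2inner \<mu> (hprof G) (hprof H) + b\<^sup>2 * L2sq \<mu> (hprof H)"
    using L2sq_linear[OF rpD(3)[OF G] rpD(3)[OF H], of a b] by (simp add: scaleR_conv_of_real)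
  finally have 3: "L2sq \<mu> (hprof ?K) = a\<^sup>2 * L2sq \<mu> (hprof G) + 2 * a * b * L2inner \<mu> (hprof G) (hprof H) + b\<^sup>2 * L2sq \<mu> (hprof H)" .
  show ?thesis unfolding E_def B_def 1 2 3 by (simp add: algebra_simps)
qed

lemma Q_nonneg: "0 \<le> Q G" by (simp add: Q_def L2sq_nonneg)

lemma E_coercive:
  obtains \<delta> where "\<delta> > 0" "\<And>G. rp G \<Longrightarrow> E G \<ge> \<delta> * Q G"
proof -
  define K where "K = (2 / (real n - 2))\<^sup>2"
  have K: "K > 0" using n by (simp add: K_def)
  \<comment> \<open>For negative c the Hardy term has the favourable sign, so only the positive part
    of c is charged to the gradient. The hypothesis on c says exactly that this charge stays below
    1.\<close>
  define c' where "c' = max c 0"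
  have cK: "c' * K < 1"
  proof (cases "c \<le> 0")
    case False
    have "c * K < ((real n - 2) / 2)\<^sup>2 * K" using c K by (intro mult_strict_right_mono) auto
    also have "\<dots> = 1" using n by (simp add: K_def power2_eq_square)
    finally show ?thesis using False by (simp add: c'_def)
  qed (simp add: c'_def max_def)
  define \<delta> where "\<delta> = min (1 - c' * K) \<omega>"
  have "E G \<ge> \<delta> * Q G" if G: "rp G" for G
  proof -
    have "c * L2sq \<mu> (hprof G) \<le> c' * L2sq \<mu> (hprof G)"
      by (intro mult_right_mono L2sq_nonneg) (simp add: c'_def)
    also have "\<dots> \<le> c' * (K * L2sq \<mu> G)"
      using Hardy[OF G] by (intro mult_left_mono) (auto simp: c'_def K_def)
    finally have 1: "L2sq \<mu> G - c * L2sq \<mu> (hprof G) \<ge> (1 - c' * K) * L2sq \<mu> G"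
      by (simp add: algebra_simps)
    have "\<delta> * L2sq \<mu> G \<le> (1 - c' * K) * L2sq \<mu> G" "\<delta> * L2sq \<mu> (prof G) \<le> \<omega> * L2sq \<mu> (prof G)"
      by (intro mult_right_mono L2sq_nonneg; simp add: \<delta>_def)+
    then show ?thesis using 1 by (simp add: E_def Q_def algebra_simps)
  qed
  moreover have "\<delta> > 0" using cK \<omega> by (simp add: \<delta>_def)
  ultimately show ?thesis by (rule that[rotated])
qed

lemma E_nonneg: "rp G \<Longrightarrow> 0 \<le> E G"
proof -
  assume "rp G"
  moreover obtain \<delta> where "\<delta> > 0" "\<And>G. rp G \<Longrightarrow> E G \<ge> \<delta> * Q G" by (rule E_coercive) blast
  ultimately show ?thesis using Q_nonneg[of G] by (meson less_imp_le mult_nonneg_nonneg order_trans)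
qed

lemma D_nonneg: "r > 0 \<Longrightarrow> 0 \<le> D r"
  using n surface_const_pos[OF n1] by (simp add: D_def tail_const_def radial_density_nonneg)

lemma D_pos: "r > 0 \<Longrightarrow> 0 < D r"
  using n surface_const_pos[OF n1] radial_density_pos[OF n1, of r] by (simp add: D_def tail_const_def)

lemma D_measurable [measurable]: "D \<in> borel_measurable borel"
  unfolding D_def[abs_def] tail_const_def by measurable

lemma prof_le_D:
  assumes G: "rp G" and r: "r > 0"
  shows "norm (prof G r) \<le> sqrt (Q G) * D r"
proof (rule power2_le_imp_le)
  show "0 \<le> sqrt (Q G) * D r" using D_nonneg[OF r] Q_nonneg[of G] by simp
  show "(norm (prof G r))\<^sup>2 \<le> (sqrt (Q G) * D r)\<^sup>2"
  proof (cases "r \<le> 1")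
    case True
    have t: "tail_const n r \<ge> 0" using n surface_const_pos[OF n1] by (simp add: tail_const_def)
    have "(norm (prof G r))\<^sup>2 \<le> tail_const n r * L2sq \<mu> G"
      by (rule prof_tail_bound[OF n rpD(1)[OF G] r])
    also have "\<dots> \<le> tail_const n r * Q G"
      using t by (intro mult_left_mono) (auto simp: Q_def L2sq_nonneg)
    finally show ?thesis using True t Q_nonneg[of G] by (simp add: D_def power_mult_distrib mult.commute)
  next
    case False
    have "(norm (prof G r))\<^sup>2 \<le> 2 / radial_density n r * Q G"
      using prof_decay_bound[OF n G r] by (simp add: Q_def add.commute)
    then show ?thesis using False Q_nonneg[of G]
      by (simp add: D_def power_mult_distrib mult.commute radial_density_nonneg)
  qed
qed

text \<open>Both bounds on \<alpha> enter. Near 0 the exponent is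
  \<open>b1 = 1 - (n - 2) * \<alpha> / 2\<close>, above -1 because \<alpha> < 4/(n-2). At infinity
  it is \<open>- b2\<close> with \<open>b2 = (n - 1) * \<alpha> / 2\<close>, and b2 > 1 means
  \<alpha> > 2/(n-1), which follows from \<alpha> > 4/n.\<close>

lemma D_powr_integrable: "integrable \<mu> (\<lambda>r. D r powr (\<alpha> + 2))"
proof -
  let ?k = "surface_const n" and ?p = "\<alpha> + 2"
  have k: "?k > 0" by (rule surface_const_pos[OF n1])
  have n2: "real n - 2 > 0" using n by simp
  define C1 where "C1 = ?k * (1 / ((real n - 2) * ?k)) powr (?p / 2)"
  define C2 where "C2 = ?k * (2 / ?k) powr (?p / 2)"
  define b1 where "b1 = (real n - 1) + (2 - real n) * (?p / 2)"
  define b2 where "b2 = (real n - 1) * (\<alpha> / 2)"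
  have sq: "sqrt x powr ?p = x powr (?p / 2)" if "x \<ge> 0" for x
    using that by (simp add: powr_half_sqrt[symmetric] powr_powr)
  have pn: "r ^ (n - 1) = r powr (real n - 1)" if "r > 0" for r
    using that n by (simp add: powr_realpow[symmetric] of_nat_diff)
  have rd: "radial_density n r = ?k * r powr (real n - 1)" if "r > 0" for r
    unfolding radial_density_eq[OF that] pn[OF that] ..
  have eq: "radial_density n r * D r powr ?p = C1 * (indicator {0<..1} r *\<^sub>R r powr b1) + C2 * (indicator {1<..} r *\<^sub>R r powr - b2)" for r
  proof -
    consider "r \<le> 0" | "0 < r" "r \<le> 1" | "r > 1" by linarith
    then show ?thesis
    proof cases
      case 1 then show ?thesis by (simp add: radial_density_def)
    next
      case 2
      have "D r powr ?p = (tail_const n r) powr (?p / 2)"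
        using 2 k n2 by (simp add: D_def sq tail_const_def)
      also have "tail_const n r = (1 / ((real n - 2) * ?k)) * r powr (2 - real n)"
        by (simp add: tail_const_def)
      also have "\<dots> powr (?p / 2) = (1 / ((real n - 2) * ?k)) powr (?p / 2) * r powr ((2 - real n) * (?p / 2))"
        using k n2 by (simp only: powr_mult powr_powr)
      finally have "radial_density n r * D r powr ?p = C1 * (r powr (real n - 1) * r powr ((2 - real n) * (?p / 2)))"
        using 2 by (simp add: rd C1_def)
      also have "r powr (real n - 1) * r powr ((2 - real n) * (?p / 2)) = r powr b1"
        by (simp only: b1_def powr_add)
      finally show ?thesis using 2 by simp
    next
      case 3
      have "D r powr ?p = (2 / radial_density n r) powr (?p / 2)"
        using 3 by (simp add: D_def sq radial_density_nonneg)
      also have "2 / radial_density n r = (2 / ?k) * r powr - (real n - 1)"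
        using 3 by (simp only: rd powr_minus) (simp add: divide_inverse)
      also have "\<dots> powr (?p / 2) = (2 / ?k) powr (?p / 2) * r powr (- (real n - 1) * (?p / 2))"
        using k by (simp only: powr_mult powr_powr)
      finally have "radial_density n r * D r powr ?p = C2 * (r powr (real n - 1) * r powr (- (real n - 1) * (?p / 2)))"
        using 3 by (simp add: rd C2_def)
      also have "r powr (real n - 1) * r powr (- (real n - 1) * (?p / 2)) = r powr ((real n - 1) + - (real n - 1) * (?p / 2))"
        by (simp only: powr_add)
      also have "(real n - 1) + - (real n - 1) * (?p / 2) = - b2"
        by (simp add: b2_def field_simps)
      finally show ?thesis using 3 by simp
    qed
  qed
  have b1: "b1 > - 1"
  proof -
    have "(real n - 2) * \<alpha> < 4" using \<alpha>(2) n2 by (simp add: field_simps)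
    moreover have "b1 = 1 - (real n - 2) * \<alpha> / 2" by (simp add: b1_def field_simps)
    ultimately show ?thesis by simp
  qed
  have b2: "b2 > 1"
  proof -
    have h1: "(real n - 1) * (4 / real n) / 2 < (real n - 1) * \<alpha> / 2"
      using \<alpha>(1) n by (intro divide_strict_right_mono mult_strict_left_mono) auto
    have h2: "1 \<le> (real n - 1) * (4 / real n) / 2" using n by (simp add: field_simps)
    from le_less_trans[OF h2 h1] show ?thesis by (simp add: b2_def)
  qed
  have "set_integrable lborel {1<..} (\<lambda>t. t powr - b2)"
    by (rule set_integrable_subset[OF set_integrable_powr_atLeast[OF b2, of 1]]) auto
  then have "integrable lborel (\<lambda>r. radial_density n r * D r powr ?p)"
    unfolding eq using set_integrable_powr_from_0[OF b1]
    by (simp add: set_integrable_def)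
  then show ?thesis by (simp add: integral_radial_measure(2))
qed

lemma powr_dominated:
  assumes "norm z \<le> M * d" "0 \<le> M" "0 \<le> d"
  shows "norm z powr (\<alpha> + 2) \<le> M powr (\<alpha> + 2) * d powr (\<alpha> + 2)"
proof -
  have "norm z powr (\<alpha> + 2) \<le> (M * d) powr (\<alpha> + 2)"
    using assms \<alpha>pos by (intro powr_mono2) auto
  then show ?thesis using assms by (simp add: powr_mult)
qed

lemma integrable_dominated_powr:
  fixes f :: "real \<Rightarrow> complex"
  assumes [measurable]: "f \<in> borel_measurable borel" and f: "\<And>r. r > 0 \<Longrightarrow> norm (f r) \<le> M * D r" and M: "M \<ge> 0"
  shows "integrable \<mu> (\<lambda>r. norm (f r) powr (\<alpha> + 2))"
    and "(LINT r|\<mu>. norm (f r) powr (\<alpha> + 2)) \<le> M powr (\<alpha> + 2) * (LINT r|\<mu>. D r powr (\<alpha> + 2))"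
proof -
  have ID: "integrable \<mu> (\<lambda>r. M powr (\<alpha> + 2) * D r powr (\<alpha> + 2))"
    using D_powr_integrable by simp
  have le: "AE r in \<mu>. norm (f r) powr (\<alpha> + 2) \<le> M powr (\<alpha> + 2) * D r powr (\<alpha> + 2)"
    using AE_radial_pos[OF n1] by eventually_elim (intro powr_dominated f M D_nonneg)
  show I: "integrable \<mu> (\<lambda>r. norm (f r) powr (\<alpha> + 2))"
    by (rule Bochner_Integration.integrable_bound[OF ID])
       (use le in \<open>auto elim!: eventually_mono\<close>)
  show "(LINT r|\<mu>. norm (f r) powr (\<alpha> + 2)) \<le> M powr (\<alpha> + 2) * (LINT r|\<mu>. D r powr (\<alpha> + 2))"
    using integral_mono_AE[OF I ID le] by simp
qed

lemma N_integrable: "rp G \<Longrightarrow> integrable \<mu> (\<lambda>r. norm (prof G r) powr (\<alpha> + 2))"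
  by (rule integrable_dominated_powr(1)[OF rpD(5) prof_le_D]) (simp_all add: Q_nonneg)

lemma N_nonneg: "0 \<le> N G"
  by (simp add: N_def)

lemma N_le_Q: "rp G \<Longrightarrow> N G \<le> sqrt (Q G) powr (\<alpha> + 2) * (LINT r|\<mu>. D r powr (\<alpha> + 2))"
  unfolding N_def
  by (rule integrable_dominated_powr(2)[OF rpD(5) prof_le_D]) (simp_all add: Q_nonneg)

text \<open>The compactness statement: pointwise convergence below a multiple of D preserves the
  constraint. It speaks of arbitrary functions because it is applied to midpoints of two members of
  a sequence and to a pointwise limit not yet known to be a profile.\<close>

lemma N_tendsto:
  fixes f :: "nat \<Rightarrow> real \<Rightarrow> complex"
  assumes [measurable]: "\<And>k. f k \<in> borel_measurable borel" "F \<in> borel_measurable borel"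
    and f: "\<And>k r. r > 0 \<Longrightarrow> norm (f k r) \<le> M * D r" and M: "M \<ge> 0"
    and lim: "\<And>r. r > 0 \<Longrightarrow> (\<lambda>k. f k r) \<longlonglongrightarrow> F r"
  shows "(\<lambda>k. LINT r|\<mu>. norm (f k r) powr (\<alpha> + 2)) \<longlonglongrightarrow> (LINT r|\<mu>. norm (F r) powr (\<alpha> + 2))"
proof (rule integral_dominated_convergence)
  show "integrable \<mu> (\<lambda>r. M powr (\<alpha> + 2) * D r powr (\<alpha> + 2))" using D_powr_integrable by simp
  show "AE r in \<mu>. (\<lambda>k. norm (f k r) powr (\<alpha> + 2)) \<longlonglongrightarrow> norm (F r) powr (\<alpha> + 2)"
    using AE_radial_pos[OF n1]
  proof eventually_elim
    case (elim r)
    have "continuous_on UNIV (\<lambda>z::complex. norm z powr (\<alpha> + 2))"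
      using \<alpha>pos by (intro continuous_on_powr' continuous_intros) auto
    from continuous_on_tendsto_compose[OF this lim[OF elim]] show ?case by simp
  qed
  show "AE r in \<mu>. norm (norm (f k r) powr (\<alpha> + 2)) \<le> M powr (\<alpha> + 2) * D r powr (\<alpha> + 2)" for k
    using AE_radial_pos[OF n1] by eventually_elim (simp add: powr_dominated f M D_nonneg)
qed (unfold measurable_radial, measurable)

lemma N_scale:
  assumes G: "rp G"
  shows "N (\<lambda>s. of_real a * G s) = \<bar>a\<bar> powr (\<alpha> + 2) * N G" and "rp (\<lambda>s. of_real a * G s)"
    and "E (\<lambda>s. of_real a * G s) = a\<^sup>2 * E G"
proof -
  note L = rp_linear[OF G G, of "of_real a" 0]
  show rpa: "rp (\<lambda>s. of_real a * G s)" using L(1) by simp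
  note [measurable] = rpD(5)[OF G] rpD(5)[OF rpa]
  have "N (\<lambda>s. of_real a * G s) = (LINT r|\<mu>. \<bar>a\<bar> powr (\<alpha> + 2) * norm (prof G r) powr (\<alpha> + 2))"
    unfolding N_def
  proof (rule integral_cong_AE)
    show "AE r in \<mu>. norm (prof (\<lambda>s. of_real a * G s) r) powr (\<alpha> + 2) = \<bar>a\<bar> powr (\<alpha> + 2) * norm (prof G r) powr (\<alpha> + 2)"
      using L(2) by eventually_elim (simp add: norm_mult powr_mult)
  qed (unfold measurable_radial, measurable)
  then show "N (\<lambda>s. of_real a * G s) = \<bar>a\<bar> powr (\<alpha> + 2) * N G"
    by (simp add: N_def)
  show "E (\<lambda>s. of_real a * G s) = a\<^sup>2 * E G"
    using E_linear[OF G G, of a 0] by simp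
qed

lemma N_pos_exists: "\<exists>G. rp G \<and> N G > 0"
proof -
  \<comment> \<open>The resulting function is minus \<open>tent 1 2\<close>, hence constantly -1 for
    r \<le> 1, a set of positive measure.\<close>
  define G :: "real \<Rightarrow> complex" where "G s = indicator {1<..<2} s" for s
  have [measurable]: "G \<in> borel_measurable borel" unfolding G_def by measurable
  have pG: "prof G r = - of_real (tent 1 2 r)" for r
  proof -
    have "(LINT s:{r..}|lborel. G s) = (LINT s|lborel. of_real (indicator {1<..<2} s * indicator {r..} s))"
      unfolding set_lebesgue_integral_def by (intro Bochner_Integration.integral_cong) (auto simp: G_def indicator_def)
    also have "\<dots> = of_real (LINT s|lborel. indicator {1<..<2} s * indicator {r..} s)"
      by (rule integral_complex_of_real)
    finally show ?thesis by (simp add: prof_def integral_window_tail)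
  qed
  have fin: "emeasure \<mu> {..2} < \<infinity>" using emeasure_radial_measure[OF n1, of 2] by simp
  have Li: "L2 \<mu> (indicator {..2} :: real \<Rightarrow> real)" by (rule L2_indicator) (use fin in auto)
  have "L2 \<mu> G" by (rule L2_bound[OF Li, of _ 1]) (auto simp: G_def indicator_def)
  moreover have "L2 \<mu> (prof G)"
    by (rule L2_bound[OF Li, of _ 1]) (auto simp: pG tent_def indicator_def)
  ultimately have G: "rp G" by (simp add: rad_profile_def)
  have "N G \<noteq> 0"
  proof
    assume "N G = 0"
    then have "AE r in \<mu>. norm (prof G r) powr (\<alpha> + 2) = 0"
      unfolding N_def by (subst (asm) integral_nonneg_eq_0_iff_AE[OF N_integrable[OF G]]) auto
    then have "AE r in \<mu>. \<not> r \<le> 1"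
      by eventually_elim (auto simp: pG tent_def)
    then have "{..1} \<in> null_sets \<mu>" using AE_iff_null_sets[of "{..1}" \<mu>] by simp
    moreover have "unit_ball_vol (real n) > 0" by simp
    ultimately show False using emeasure_radial_measure[OF n1, of 1] by (simp add: null_sets_def ennreal_eq_0_iff)
  qed
  then have "N G > 0" using N_nonneg[of G] by linarith
  with G show ?thesis by blast
qed

section \<open>The constrained minimum and the compactness of minimizing sequences\<close>

definition "m = Inf {E G |G. rp G \<and> N G = 1}"

lemma normalized_exists: "\<exists>G. rp G \<and> N G = 1"
proof -
  obtain G where G: "rp G" "N G > 0" using N_pos_exists by blast
  define a where "a = N G powr (- 1 / (\<alpha> + 2))"
  have "\<bar>a\<bar> powr (\<alpha> + 2) * N G = N G powr (- 1) * N G"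
    using \<alpha>pos by (simp add: a_def powr_powr)
  also have "\<dots> = 1" using G(2) by (simp add: powr_minus)
  finally show ?thesis using N_scale(1,2)[OF G(1), of a] by metis
qed

lemma m_le: "rp G \<Longrightarrow> N G = 1 \<Longrightarrow> m \<le> E G"
  unfolding m_def by (rule cInf_lower) (auto intro!: bdd_belowI[of _ 0] E_nonneg)

lemma m_nonneg: "0 \<le> m"
  unfolding m_def by (rule cInf_greatest) (use normalized_exists E_nonneg in auto)

text \<open>Rescaling to N = 1 shows that m is the constant of a Sobolev-type inequality: the power
  2/(\<alpha>+2) equalizes the degrees of homogeneity of the two sides.\<close>

lemma E_ge:
  assumes G: "rp G"
  shows "m * N G powr (2 / (\<alpha> + 2)) \<le> E G"
proof (cases "N G = 0")
  case True then show ?thesis using E_nonneg[OF G] by simp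
next
  case False
  then have Np: "N G > 0" using N_nonneg[of G] by linarith
  define a where "a = N G powr (- 1 / (\<alpha> + 2))"
  have a: "a > 0" using Np by (simp add: a_def)
  have "\<bar>a\<bar> powr (\<alpha> + 2) * N G = N G powr (- 1) * N G"
    using \<alpha>pos by (simp add: a_def powr_powr)
  also have "\<dots> = 1" using Np by (simp add: powr_minus)
  finally have "m \<le> a\<^sup>2 * E G"
    using m_le[OF N_scale(2)[OF G, of a]] N_scale(1,3)[OF G, of a] by simp
  then have "m * N G powr (2 / (\<alpha> + 2)) \<le> (a\<^sup>2 * E G) * N G powr (2 / (\<alpha> + 2))"
    by (intro mult_right_mono) auto
  also have "\<dots> = (a * a * N G powr (2 / (\<alpha> + 2))) * E G" by (simp add: power2_eq_square)
  also have "a * a * N G powr (2 / (\<alpha> + 2)) = N G powr (- 1 / (\<alpha> + 2) + - 1 / (\<alpha> + 2) + 2 / (\<alpha> + 2))"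
    unfolding a_def by (simp only: powr_add)
  also have "- 1 / (\<alpha> + 2) + - 1 / (\<alpha> + 2) + 2 / (\<alpha> + 2) = 0"
    using \<alpha>pos by (simp add: field_simps)
  finally show ?thesis using Np by simp
qed

text \<open>The equicontinuity half of the Arzela-Ascoli argument. A rational q slightly to the
  right of r is taken because the modulus of continuity in \<open>prof_diff\<close> is governed by
  the density at the smaller radius.\<close>

lemma Cauchy_of_Cauchy_on_rationals:
  fixes F :: "nat \<Rightarrow> real \<Rightarrow> complex"
  assumes F: "\<And>k. rp (F k)" and M: "\<And>k. Q (F k) \<le> M"
    and conv: "\<And>q. q \<in> \<rat> \<Longrightarrow> q > 0 \<Longrightarrow> convergent (\<lambda>k. prof (F k) q)"
    and r: "r > 0"
  shows "convergent (\<lambda>k. prof (F k) r)"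
proof (rule Cauchy_convergent, rule CauchyI)
  fix e :: real assume e: "e > 0"
  have M0: "M \<ge> 0" using M[of 0] Q_nonneg[of "F 0"] by linarith
  define w where "w = radial_density n r"
  have w: "w > 0" unfolding w_def by (rule radial_density_pos[OF n1 r])
  \<comment> \<open>Chosen so that the Hoelder bound over a distance below \<eta> is less than e/3;
    M + 1 in place of M keeps the quotient meaningful when M = 0.\<close>
  define \<eta> where "\<eta> = (e / 3)\<^sup>2 * w / (M + 1)"
  have \<eta>: "\<eta> > 0" using e w M0 by (simp add: \<eta>_def)
  obtain q where q: "q \<in> \<rat>" "r < q" "q < r + \<eta>" using Rats_dense_in_real[of r "r + \<eta>"] \<eta> by auto
  have d: "norm (prof (F k) r - prof (F k) q) < e / 3" for k
  proof (rule power2_less_imp_less)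
    have "(norm (prof (F k) r - prof (F k) q))\<^sup>2 \<le> (q - r) / w * L2sq \<mu> (F k)"
      unfolding w_def using prof_diff(1)[OF n rpD(1)[OF F] r, of q k] q by simp
    also have "\<dots> \<le> (q - r) / w * M"
      using q w M[of k] L2sq_nonneg[of \<mu> "prof (F k)"] by (intro mult_left_mono) (auto simp: Q_def)
    also have "\<dots> \<le> (q - r) / w * (M + 1)" using q w by (intro mult_left_mono) auto
    also have "\<dots> < \<eta> / w * (M + 1)"
      using q w M0 by (intro mult_strict_right_mono divide_strict_right_mono) auto
    also have "\<dots> = (e / 3)\<^sup>2" using w M0 by (simp add: \<eta>_def)
    finally show "(norm (prof (F k) r - prof (F k) q))\<^sup>2 < (e / 3)\<^sup>2" .
  qed (use e in auto)
  have "convergent (\<lambda>k. prof (F k) q)" using conv q r by auto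
  then have "Cauchy (\<lambda>k. prof (F k) q)" by (rule convergent_Cauchy)
  then obtain K where K: "\<And>k l. k \<ge> K \<Longrightarrow> l \<ge> K \<Longrightarrow> norm (prof (F k) q - prof (F l) q) < e / 3"
    using CauchyD[of _ "e / 3"] e by (metis divide_pos_pos zero_less_numeral)
  show "\<exists>K. \<forall>k\<ge>K. \<forall>l\<ge>K. norm (prof (F k) r - prof (F l) r) < e"
  proof (intro exI[of _ K] allI impI)
    fix k l assume kl: "K \<le> k" "K \<le> l"
    have "norm (prof (F k) r - prof (F l) r) \<le> norm (prof (F k) r - prof (F k) q) + norm (prof (F k) q - prof (F l) q) + norm (prof (F l) q - prof (F l) r)"
      using norm_triangle_ineq[of "prof (F k) r - prof (F k) q + (prof (F k) q - prof (F l) q)" "prof (F l) q - prof (F l) r"]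
        norm_triangle_ineq[of "prof (F k) r - prof (F k) q" "prof (F k) q - prof (F l) q"] by simp
    then show "norm (prof (F k) r - prof (F l) r) < e"
      using d[of k] d[of l] K[OF kl] by (simp add: norm_minus_commute)
  qed
qed

lemma pointwise_convergent_subsequence:
  fixes G :: "nat \<Rightarrow> real \<Rightarrow> complex"
  assumes G: "\<And>k. rp (G k)" and M: "\<And>k. Q (G k) \<le> M"
  obtains \<kappa> where "strict_mono (\<kappa> :: nat \<Rightarrow> nat)" "\<And>r. r > 0 \<Longrightarrow> convergent (\<lambda>k. prof (G (\<kappa> k)) r)"
proof -
  have M0: "M \<ge> 0" using M[of 0] Q_nonneg[of "G 0"] by linarith
  \<comment> \<open>The diagonal extraction wants one bound valid at all points, so the values are
    divided by their majorant; the summand 1 keeps the divisor positive when M = 0.\<close>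
  define a where "a r = (sqrt M + 1) * D r" for r
  have a: "a r > 0" if "r > 0" for r
    using D_pos[OF that] M0 by (simp add: a_def add_nonneg_pos)
  have "norm (prof (G k) r /\<^sub>R a r) \<le> 1" if "r \<in> \<rat> \<inter> {0<..}" for k r
  proof -
    have r: "r > 0" using that by simp
    have "norm (prof (G k) r) \<le> sqrt (Q (G k)) * D r" by (rule prof_le_D[OF G r])
    also have "\<dots> \<le> a r"
      unfolding a_def using M[of k] by (intro mult_right_mono D_nonneg[OF r]) (simp add: add_increasing2)
    finally show ?thesis using a[OF r] by (simp add: divide_simps)
  qed
  moreover have "countable (\<rat> \<inter> {0<..} :: real set)" by (intro countable_Int1 countable_rat)
  ultimately obtain \<kappa> where \<kappa>: "strict_mono \<kappa>"
    "\<And>r. r \<in> \<rat> \<inter> {0<..} \<Longrightarrow> \<exists>l. (\<lambda>k. prof (G (\<kappa> k)) r /\<^sub>R a r) \<longlonglongrightarrow> l"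
    using function_convergent_subsequence[of "\<rat> \<inter> {0<..}" "\<lambda>k r. prof (G k) r /\<^sub>R a r" 1] by metis
  have "convergent (\<lambda>k. prof (G (\<kappa> k)) q)" if q: "q \<in> \<rat>" "q > 0" for q
  proof -
    obtain l where "(\<lambda>k. prof (G (\<kappa> k)) q /\<^sub>R a q) \<longlonglongrightarrow> l" using \<kappa>(2) q by auto
    from tendsto_scaleR[OF tendsto_const[of "a q"] this]
    show ?thesis using a[OF q(2)] by (auto simp: convergent_def)
  qed
  then have "convergent (\<lambda>k. prof (G (\<kappa> k)) r)" if "r > 0" for r
    using Cauchy_of_Cauchy_on_rationals[of "\<lambda>k. G (\<kappa> k)" M r] G M that by blast
  with \<kappa>(1) show ?thesis by (rule that)
qed

lemma E_le_Q:
  obtains C where "C > 0" "\<And>G. rp G \<Longrightarrow> E G \<le> C * Q G"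
proof -
  define K where "K = (2 / (real n - 2))\<^sup>2"
  have K: "K \<ge> 0" by (simp add: K_def)
  have "E G \<le> (1 + \<bar>c\<bar> * K + \<omega>) * Q G" if G: "rp G" for G
  proof -
    have "- c * L2sq \<mu> (hprof G) \<le> \<bar>c\<bar> * L2sq \<mu> (hprof G)"
      by (intro mult_right_mono L2sq_nonneg) auto
    also have "\<dots> \<le> \<bar>c\<bar> * (K * L2sq \<mu> G)"
      using Hardy[OF G] by (intro mult_left_mono) (auto simp: K_def)
    finally have "E G \<le> (1 + \<bar>c\<bar> * K) * L2sq \<mu> G + \<omega> * L2sq \<mu> (prof G)"
      by (simp add: E_def algebra_simps)
    also have "\<dots> \<le> (1 + \<bar>c\<bar> * K + \<omega>) * L2sq \<mu> G + (1 + \<bar>c\<bar> * K + \<omega>) * L2sq \<mu> (prof G)"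
    proof (rule add_mono; rule mult_right_mono[OF _ L2sq_nonneg])
      have "0 \<le> \<bar>c\<bar> * K" using K by simp
      then show "1 + \<bar>c\<bar> * K \<le> 1 + \<bar>c\<bar> * K + \<omega>" "\<omega> \<le> 1 + \<bar>c\<bar> * K + \<omega>" using \<omega> by linarith+
    qed
    finally show ?thesis by (simp add: Q_def algebra_simps)
  qed
  moreover have "1 + \<bar>c\<bar> * K + \<omega> > 0" using K \<omega> by (simp add: add_nonneg_pos)
  ultimately show ?thesis by (rule that[rotated])
qed

definition "comb a G b H = (\<lambda>s::real. of_real a * G s + of_real b * H s :: complex)"

lemma comb_rp: "rp G \<Longrightarrow> rp H \<Longrightarrow> rp (comb a G b H)"
  unfolding comb_def by (rule rp_linear(1))

lemma comb_prof: "rp G \<Longrightarrow> rp H \<Longrightarrow> r > 0 \<Longrightarrow> prof (comb a G b H) r = of_real a * prof G r + of_real b * prof H r"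
  unfolding comb_def by (rule prof_linear[OF n]) (auto intro: rpD)

lemma comb_E: "rp G \<Longrightarrow> rp H \<Longrightarrow> E (comb a G b H) = a\<^sup>2 * E G + 2 * a * b * B G H + b\<^sup>2 * E H"
  unfolding comb_def by (rule E_linear)

lemma comb_L2sq:
  "L2 \<mu> G \<Longrightarrow> L2 \<mu> H \<Longrightarrow> L2sq \<mu> (comb a G (- a) H) = a\<^sup>2 * L2sq \<mu> (\<lambda>s. G s - H s)"
proof -
  have "(norm (comb a G (- a) H s))\<^sup>2 = a\<^sup>2 * (norm (G s - H s))\<^sup>2" for s
  proof -
    have "comb a G (- a) H s = of_real a * (G s - H s)" by (simp add: comb_def algebra_simps)
    then show ?thesis by (simp add: norm_mult power_mult_distrib)
  qed
  then show ?thesis by (simp add: L2sq_def)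
qed

lemma N_cong_pos:
  assumes [measurable]: "prof G \<in> borel_measurable borel" "f \<in> borel_measurable borel"
    and "\<And>r. r > 0 \<Longrightarrow> prof G r = f r"
  shows "N G = (LINT r|\<mu>. norm (f r) powr (\<alpha> + 2))"
  unfolding N_def
proof (rule integral_cong_AE)
  show "AE r in \<mu>. norm (prof G r) powr (\<alpha> + 2) = norm (f r) powr (\<alpha> + 2)"
    using AE_radial_pos[OF n1] by eventually_elim (simp add: assms(3))
qed (unfold measurable_radial, measurable)

text \<open>The exponent is at most 1, so a lower bound 1 - e on N of a midpoint passes to its power
  without any loss.\<close>

lemma min_powr_le: "0 \<le> x \<Longrightarrow> min x 1 \<le> x powr (2 / (\<alpha> + 2))" for x :: real
proof (cases "x \<le> 1")
  case True
  assume "0 \<le> x"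
  then have "x powr 1 \<le> x powr (2 / (\<alpha> + 2))"
    using True \<alpha>pos by (intro powr_mono') (simp_all add: field_simps)
  then show ?thesis using \<open>0 \<le> x\<close> True by (simp add: min_def)
next
  case False
  then have "1 \<le> x powr (2 / (\<alpha> + 2))" using \<alpha>pos by (intro ge_one_powr_ge_zero) auto
  then show ?thesis by simp
qed

theorem minimizer_exists: "\<exists>H. rp H \<and> N H = 1 \<and> E H = m"
proof -
  have "\<exists>G. rp G \<and> N G = 1 \<and> E G < m + 1 / real (Suc k)" for k
  proof -
    have "Inf {E G |G. rp G \<and> N G = 1} < m + 1 / real (Suc k)" by (simp add: m_def)
    from cInf_lessD[OF _ this] normalized_exists show ?thesis by auto
  qed
  then obtain G where G: "\<And>k. rp (G k)" "\<And>k. N (G k) = 1" "\<And>k. E (G k) < m + 1 / real (Suc k)" by metis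
  obtain \<delta> where \<delta>: "\<delta> > 0" "\<And>G. rp G \<Longrightarrow> E G \<ge> \<delta> * Q G" by (rule E_coercive) blast
  define M where "M = (m + 1) / \<delta>"
  have QM: "Q (G k) \<le> M" for k
  proof -
    have "\<delta> * Q (G k) \<le> m + 1 / real (Suc k)" using \<delta>(2)[OF G(1)] G(3)[of k] by (meson less_imp_le order_trans)
    also have "\<dots> \<le> m + 1" by simp
    finally show ?thesis using \<delta>(1) by (simp add: M_def field_simps)
  qed
  have M0: "M \<ge> 0" using m_nonneg \<delta>(1) by (simp add: M_def)
  obtain \<kappa> where \<kappa>: "strict_mono (\<kappa> :: nat \<Rightarrow> nat)" "\<And>r. r > 0 \<Longrightarrow> convergent (\<lambda>k. prof (G (\<kappa> k)) r)"
    by (rule pointwise_convergent_subsequence[OF G(1) QM], rule that)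
  define F where "F k = G (\<kappa> k)" for k
  have F: "rp (F k)" "N (F k) = 1" "Q (F k) \<le> M" for k by (simp_all add: F_def G QM)
  have EF: "E (F k) \<le> m + 1 / real (Suc k)" for k
  proof -
    have "1 / real (Suc (\<kappa> k)) \<le> 1 / real (Suc k)"
      using seq_suble[OF \<kappa>(1), of k] by (intro divide_left_mono) auto
    then show ?thesis using G(3)[of "\<kappa> k"] by (simp add: F_def)
  qed
  note [measurable] = rpD(4,5)[OF F(1)]
  define P where "P r = lim (\<lambda>k. prof (F k) r)" for r
  have Pm [measurable]: "P \<in> borel_measurable borel" unfolding P_def[abs_def] by measurable
  have P: "(\<lambda>k. prof (F k) r) \<longlonglongrightarrow> P r" if "r > 0" for r
    using \<kappa>(2)[OF that] by (simp add: P_def F_def convergent_LIMSEQ_iff)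
  have FD: "norm (prof (F k) r) \<le> sqrt M * D r" if "r > 0" for k r
    by (rule order_trans[OF prof_le_D[OF F(1) that]]) (intro mult_right_mono D_nonneg[OF that] real_sqrt_le_mono F(3))
  have NP: "(LINT r|\<mu>. norm (P r) powr (\<alpha> + 2)) = 1"
  proof (rule LIMSEQ_unique)
    show "(\<lambda>k. LINT r|\<mu>. norm (prof (F k) r) powr (\<alpha> + 2)) \<longlonglongrightarrow> (LINT r|\<mu>. norm (P r) powr (\<alpha> + 2))"
      by (rule N_tendsto[OF rpD(5)[OF F(1)] Pm FD _ P]) (simp_all add: M0)
    show "(\<lambda>k. LINT r|\<mu>. norm (prof (F k) r) powr (\<alpha> + 2)) \<longlonglongrightarrow> 1"
      using F(2) by (simp add: N_def)
  qed
  \<comment> \<open>Otherwise there are pairs of indices tending to infinity whose midpoints have N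
    at most 1 - e. These midpoints also converge pointwise to P below the same majorant, so their N
    tends to 1, a contradiction.\<close>
  have avg: "\<exists>K. \<forall>k\<ge>K. \<forall>l\<ge>K. N (comb (1/2) (F k) (1/2) (F l)) > 1 - e" if e: "e > 0" for e
  proof (rule ccontr)
    assume "\<not> ?thesis"
    then have "\<forall>K. \<exists>k l. k \<ge> K \<and> l \<ge> K \<and> N (comb (1/2) (F k) (1/2) (F l)) \<le> 1 - e"
      by (meson not_less)
    then obtain a b where ab: "\<And>K. a K \<ge> K" "\<And>K. b K \<ge> K" "\<And>K. N (comb (1/2) (F (a K)) (1/2) (F (b K))) \<le> 1 - e"
      by metis
    define f where "f j r = of_real (1/2) * prof (F (a j)) r + of_real (1/2) * prof (F (b j)) r" for j r
    have fm [measurable]: "f j \<in> borel_measurable borel" for j unfolding f_def[abs_def] by measurable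
    have "(\<lambda>j. LINT r|\<mu>. norm (f j r) powr (\<alpha> + 2)) \<longlonglongrightarrow> (LINT r|\<mu>. norm (P r) powr (\<alpha> + 2))"
    proof (rule N_tendsto[of _ _ "sqrt M"])
      fix r :: real assume r: "r > 0"
      show "norm (f j r) \<le> sqrt M * D r" for j
      proof -
        have "norm (f j r) \<le> 1/2 * norm (prof (F (a j)) r) + 1/2 * norm (prof (F (b j)) r)"
          unfolding f_def by (rule order_trans[OF norm_triangle_ineq]) (simp add: norm_mult)
        then show ?thesis using FD[OF r, of "a j"] FD[OF r, of "b j"] by linarith
      qed
      have "filterlim a at_top sequentially" "filterlim b at_top sequentially"
        using ab(1,2) by (auto intro!: filterlim_at_top_mono[OF filterlim_ident])
      then have "(\<lambda>j. prof (F (a j)) r) \<longlonglongrightarrow> P r" "(\<lambda>j. prof (F (b j)) r) \<longlonglongrightarrow> P r"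
        using filterlim_compose[OF P[OF r]] by blast+
      then have "(\<lambda>j. f j r) \<longlonglongrightarrow> of_real (1/2) * P r + of_real (1/2) * P r"
        unfolding f_def by (intro tendsto_intros)
      then show "(\<lambda>j. f j r) \<longlonglongrightarrow> P r" by simp
    qed (use M0 in auto)
    moreover have "(LINT r|\<mu>. norm (f j r) powr (\<alpha> + 2)) = N (comb (1/2) (F (a j)) (1/2) (F (b j)))" for j
      by (rule N_cong_pos[symmetric]) (use fm rpD(5)[OF comb_rp[OF F(1) F(1)]] in \<open>auto simp: f_def comb_prof F(1)\<close>)
    ultimately have "(\<lambda>j. N (comb (1/2) (F (a j)) (1/2) (F (b j)))) \<longlonglongrightarrow> 1" by (simp add: NP)
    from LIMSEQ_le_const2[OF this, of "1 - e"] ab(3) have "1 \<le> 1 - e" by auto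
    then show False using e by simp
  qed
  have QC: "\<exists>K. \<forall>k\<ge>K. \<forall>l\<ge>K. Q (comb (1/2) (F k) (- (1/2)) (F l)) < e" if e: "e > 0" for e
  proof -
    \<comment> \<open>Half of \<delta> e pays for the defect of the midpoint from the constraint, at
      most m \<epsilon>, the other half for the excess of the two energies over m. Dividing by m + 1
      avoids assuming m > 0, which is established only after the minimizer has been found.\<close>
    define \<epsilon> where "\<epsilon> = \<delta> * e / (2 * (m + 1))"
    have \<epsilon>: "\<epsilon> > 0" using \<delta> e m_nonneg by (simp add: \<epsilon>_def)
    obtain K1 where K1: "\<And>k l. k \<ge> K1 \<Longrightarrow> l \<ge> K1 \<Longrightarrow> N (comb (1/2) (F k) (1/2) (F l)) > 1 - \<epsilon>"
      using avg[OF \<epsilon>] by blast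
    obtain K2 where K2: "1 / real (Suc K2) < \<delta> * e / 2"
      using nat_approx_posE[of "\<delta> * e / 2"] \<delta> e by auto
    have "Q (comb (1/2) (F k) (- (1/2)) (F l)) < e" if kl: "k \<ge> max K1 K2" "l \<ge> max K1 K2" for k l
    proof -
      let ?p = "comb (1/2) (F k) (1/2) (F l)" and ?d = "comb (1/2) (F k) (- (1/2)) (F l)"
      have rpp: "rp ?p" "rp ?d" by (rule comb_rp[OF F(1) F(1)])+
      have "m * (1 - \<epsilon>) \<le> m * min (N ?p) 1"
        using K1[of k l] kl \<epsilon> m_nonneg by (intro mult_left_mono) (auto simp: min_def)
      also have "\<dots> \<le> m * N ?p powr (2 / (\<alpha> + 2))"
        by (intro mult_left_mono min_powr_le N_nonneg m_nonneg)
      also have "\<dots> \<le> E ?p" by (rule E_ge[OF rpp(1)])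
      finally have lower: "m * (1 - \<epsilon>) \<le> E ?p" .
      have small: "1 / real (Suc k) < \<delta> * e / 2" "1 / real (Suc l) < \<delta> * e / 2"
      proof -
        have "1 / real (Suc j) < \<delta> * e / 2" if "j \<ge> K2" for j
          by (rule le_less_trans[OF divide_left_mono K2]) (use that in auto)
        then show "1 / real (Suc k) < \<delta> * e / 2" "1 / real (Suc l) < \<delta> * e / 2" using kl by auto
      qed
      have "\<delta> * Q ?d \<le> E ?d" by (rule \<delta>(2)[OF rpp(2)])
      also have "E ?d = 1/2 * E (F k) + 1/2 * E (F l) - E ?p"
        unfolding comb_E[OF F(1) F(1)] by (simp add: power2_eq_square)
      also have "\<dots> \<le> 1/2 * (m + 1 / real (Suc k)) + 1/2 * (m + 1 / real (Suc l)) - m * (1 - \<epsilon>)"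
        by (intro diff_mono add_mono mult_left_mono EF lower) auto
      also have "\<dots> = m * \<epsilon> + 1/2 * (1 / real (Suc k)) + 1/2 * (1 / real (Suc l))"
        by (simp only: right_diff_distrib distrib_left)
      also have "\<dots> < \<delta> * e / 2 + m * \<epsilon>" using small by linarith
      also have "m * \<epsilon> \<le> (m + 1) * \<epsilon>" using \<epsilon> by simp
      also have "(m + 1) * \<epsilon> = \<delta> * e / 2" using m_nonneg by (simp add: \<epsilon>_def field_simps)
      finally have "\<delta> * Q ?d < \<delta> * e" by simp
      then show ?thesis using \<delta>(1) by simp
    qed
    then show ?thesis by blast
  qed
  have LQ: "L2sq \<mu> (\<lambda>s. F k s - F l s) \<le> 4 * Q (comb (1/2) (F k) (- (1/2)) (F l))" for k l
  proof -
    have "L2sq \<mu> (comb (1/2) (F k) (- (1/2)) (F l)) = (1/2)\<^sup>2 * L2sq \<mu> (\<lambda>s. F k s - F l s)"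
      using comb_L2sq[OF rpD(1)[OF F(1)] rpD(1)[OF F(1)], of "1/2" k l] by simp
    then show ?thesis using L2sq_nonneg[of \<mu> "prof (comb (1/2) (F k) (- (1/2)) (F l))"]
      by (simp add: Q_def power2_eq_square)
  qed
  have CF: "\<exists>K. \<forall>k\<ge>K. \<forall>l\<ge>K. L2sq \<mu> (\<lambda>s. F k s - F l s) < e" if e: "e > 0" for e
  proof -
    obtain K where K: "\<And>k l. k \<ge> K \<Longrightarrow> l \<ge> K \<Longrightarrow> Q (comb (1/2) (F k) (- (1/2)) (F l)) < e / 4"
      using QC[of "e / 4"] e by (metis divide_pos_pos zero_less_numeral)
    have "L2sq \<mu> (\<lambda>s. F k s - F l s) < e" if "k \<ge> K" "l \<ge> K" for k l
      using LQ[of k l] K[OF that] by linarith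
    then show ?thesis by blast
  qed
  obtain H where H: "L2 \<mu> H" "(\<lambda>k. L2sq \<mu> (\<lambda>s. F k s - H s)) \<longlonglongrightarrow> 0"
    by (rule L2_complete[of \<mu> F, OF rpD(1)[OF F(1)] CF], assumption, rule that)
  have [measurable]: "H \<in> borel_measurable borel" by (rule L2_radial_borel[OF H(1)])
  \<comment> \<open>By \<open>prof_tail_bound\<close>, L2 convergence of the derivatives implies
    convergence of the profiles at every radius, so the strong and the pointwise limit
    coincide.\<close>
  have HP: "prof H r = P r" if r: "r > 0" for r
  proof (rule LIMSEQ_unique[OF _ P[OF r]])
    have d: "prof (\<lambda>s. F k s - H s) r = prof (F k) r - prof H r" for k
      using prof_linear[OF n rpD(1)[OF F(1)] H(1) r, of 1 k "-1"] by simp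
    have b1: "(norm (prof (F k) r - prof H r))\<^sup>2 \<le> tail_const n r * L2sq \<mu> (\<lambda>s. F k s - H s)" for k
      using prof_tail_bound[OF n L2_diff[OF rpD(1)[OF F(1)] H(1)] r, of k] by (simp add: d)
    have b2: "(\<lambda>k. tail_const n r * L2sq \<mu> (\<lambda>s. F k s - H s)) \<longlonglongrightarrow> 0"
      using tendsto_mult[OF tendsto_const H(2), of "tail_const n r"] by simp
    have "(\<lambda>k. (norm (prof (F k) r - prof H r))\<^sup>2) \<longlonglongrightarrow> 0"
      by (rule Lim_null_comparison[OF always_eventually b2]) (use b1 in simp)
    then have "(\<lambda>k. sqrt ((norm (prof (F k) r - prof H r))\<^sup>2)) \<longlonglongrightarrow> sqrt 0" by (intro tendsto_intros)
    then have "(\<lambda>k. norm (prof (F k) r - prof H r)) \<longlonglongrightarrow> 0" by simp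
    from LIM_zero_cancel[OF tendsto_norm_zero_cancel[OF this]]
    show "(\<lambda>k. prof (F k) r) \<longlonglongrightarrow> prof H r" .
  qed
  have mH: "prof H \<in> borel_measurable \<mu>" unfolding measurable_radial by measurable
  have limH: "AE r in \<mu>. (\<lambda>k. prof (F k) r) \<longlonglongrightarrow> prof H r"
    using AE_radial_pos[OF n1] by eventually_elim (simp add: P HP)
  \<comment> \<open>Completeness was used for the derivatives only; the profile of the limit is
    square integrable by Fatou and the uniform bound on Q.\<close>
  have "L2 \<mu> (prof H)"
  proof (rule L2_Fatou(1)[OF rpD(2)[OF F(1)] mH limH, of M])
    have "L2sq \<mu> (prof (F k)) \<le> M" for k
      using F(3)[of k] L2sq_nonneg[of \<mu> "F k"] by (simp add: Q_def)
    then show "\<forall>\<^sub>F k in sequentially. L2sq \<mu> (prof (F k)) \<le> M" by simp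
  qed
  with H(1) have rpH: "rp H" by (simp add: rad_profile_def)
  have NH: "N H = 1" using N_cong_pos[OF _ Pm HP] mH NP by simp
  \<comment> \<open>The derivative part is small by the choice of H. For the profile part the Cauchy
    bound in k and l is carried over to l -> oo by Fatou.\<close>
  have Qk: "(\<lambda>k. Q (comb (1/2) (F k) (- (1/2)) H)) \<longlonglongrightarrow> 0"
  proof (rule LIMSEQ_I)
    fix e :: real assume e: "e > 0"
    obtain K1 where K1: "\<And>k l. k \<ge> K1 \<Longrightarrow> l \<ge> K1 \<Longrightarrow> Q (comb (1/2) (F k) (- (1/2)) (F l)) < e / 2"
      using QC[of "e / 2"] e by (metis divide_pos_pos zero_less_numeral)
    have "\<forall>\<^sub>F k in sequentially. L2sq \<mu> (\<lambda>s. F k s - H s) < e"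
      using order_tendstoD(2)[OF H(2) e] .
    then obtain K2 where K2: "\<And>k. k \<ge> K2 \<Longrightarrow> L2sq \<mu> (\<lambda>s. F k s - H s) < e"
      by (auto simp: eventually_sequentially)
    have "Q (comb (1/2) (F k) (- (1/2)) H) < e" if k: "k \<ge> max K1 K2" for k
    proof -
      have "L2sq \<mu> (comb (1/2) (F k) (- (1/2)) H) < e / 2"
        using comb_L2sq[OF rpD(1)[OF F(1)] H(1), of "1/2" k] K2[of k] k e by (simp add: power2_eq_square)
      moreover have "L2sq \<mu> (prof (comb (1/2) (F k) (- (1/2)) H)) \<le> e / 2"
      proof (rule L2_Fatou(2)[where h="\<lambda>l. prof (comb (1/2) (F k) (- (1/2)) (F l))"])
        show "L2 \<mu> (prof (comb (1/2) (F k) (- (1/2)) (F l)))" for l by (rule rpD(2)[OF comb_rp[OF F(1) F(1)]])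
        show "prof (comb (1/2) (F k) (- (1/2)) H) \<in> borel_measurable \<mu>"
          unfolding measurable_radial by (rule rpD(5)[OF comb_rp[OF F(1) rpH]])
        show "AE r in \<mu>. (\<lambda>l. prof (comb (1/2) (F k) (- (1/2)) (F l)) r) \<longlonglongrightarrow> prof (comb (1/2) (F k) (- (1/2)) H) r"
          using AE_radial_pos[OF n1]
        proof eventually_elim
          case (elim r)
          show ?case unfolding comb_prof[OF F(1) F(1) elim] comb_prof[OF F(1) rpH elim] HP[OF elim]
            by (intro tendsto_intros P elim)
        qed
        have "L2sq \<mu> (prof (comb (1/2) (F k) (- (1/2)) (F l))) \<le> e / 2" if "l \<ge> K1" for l
          using K1[of k l] k that L2sq_nonneg[of \<mu> "comb (1/2) (F k) (- (1/2)) (F l)"] by (simp add: Q_def)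
        then show "\<forall>\<^sub>F l in sequentially. L2sq \<mu> (prof (comb (1/2) (F k) (- (1/2)) (F l))) \<le> e / 2"
          by (auto simp: eventually_sequentially)
      qed
      ultimately show ?thesis by (simp add: Q_def)
    qed
    then show "\<exists>no. \<forall>k\<ge>no. norm (Q (comb (1/2) (F k) (- (1/2)) H) - 0) < e"
      using Q_nonneg by (intro exI[of _ "max K1 K2"]) auto
  qed
  obtain C where C: "C > 0" "\<And>G. rp G \<Longrightarrow> E G \<le> C * Q G" by (rule E_le_Q) blast
  define y where "y k = E (comb (1/2) (F k) (- (1/2)) H)" for k
  have y0: "y \<longlonglongrightarrow> 0"
  proof (rule tendsto_sandwich[OF always_eventually always_eventually tendsto_const])
    show "\<forall>k. 0 \<le> y k" using E_nonneg[OF comb_rp[OF F(1) rpH]] by (simp add: y_def)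
    show "\<forall>k. y k \<le> C * Q (comb (1/2) (F k) (- (1/2)) H)" using C(2)[OF comb_rp[OF F(1) rpH]] by (simp add: y_def)
    show "(\<lambda>k. C * Q (comb (1/2) (F k) (- (1/2)) H)) \<longlonglongrightarrow> 0" using tendsto_mult[OF tendsto_const[of C] Qk] by simp
  qed
  have Em: "(\<lambda>k. E (F k)) \<longlonglongrightarrow> m"
  proof (rule tendsto_sandwich[OF always_eventually always_eventually tendsto_const])
    show "\<forall>k. m \<le> E (F k)" using m_le[OF F(1,2)] by simp
    show "\<forall>k. E (F k) \<le> m + 1 / real (Suc k)" using EF by simp
    show "(\<lambda>k. m + 1 / real (Suc k)) \<longlonglongrightarrow> m"
      using tendsto_add[OF tendsto_const[of m] LIMSEQ_inverse_real_of_nat] by (simp add: inverse_eq_divide)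
  qed
  \<comment> \<open>Expanding \<open>0 \<le> E (F k - t H)\<close> and eliminating the mixed term by
    means of y gives an inequality that can be passed to the limit in k; the factor 1 - t then
    cancels and t tends to 1. Only nonnegativity of E is needed for this.\<close>
  have "E H \<le> m"
  proof (rule field_le_mult_one_interval)
    fix t :: real assume t: "0 < t" "t < 1"
    have le: "t * (1 - t) * E H \<le> (1 - t) * E (F k) + 4 * t * y k" for k
    proof -
      have hB: "B (F k) H = 1/2 * E (F k) + 1/2 * E H - 2 * y k"
        unfolding y_def comb_E[OF F(1) rpH] by (simp add: power2_eq_square)
      have "0 \<le> E (comb 1 (F k) (- t) H)" by (rule E_nonneg[OF comb_rp[OF F(1) rpH]])
      then have "0 \<le> E (F k) - 2 * t * B (F k) H + t * t * E H"
        unfolding comb_E[OF F(1) rpH] by (simp add: power2_eq_square)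
      then show ?thesis unfolding hB by (simp add: algebra_simps)
    qed
    have "(\<lambda>k. (1 - t) * E (F k) + 4 * t * y k) \<longlonglongrightarrow> (1 - t) * m + 4 * t * 0"
      by (intro tendsto_intros Em y0)
    from LIMSEQ_le_const[OF this] le have "t * (1 - t) * E H \<le> (1 - t) * m" by auto
    then have "(1 - t) * (t * E H) \<le> (1 - t) * m" by (simp add: mult_ac)
    then show "t * E H \<le> m" using t by simp
  qed
  with m_le[OF rpH NH] rpH NH show ?thesis by (intro exI[of _ H]) auto
qed

section \<open>The Euler-Lagrange equation and the Nehari level\<close>

lemma m_pos: "m > 0"
proof -
  obtain H where H: "rp H" "N H = 1" "E H = m" using minimizer_exists by blast
  obtain \<delta> where \<delta>: "\<delta> > 0" "\<And>G. rp G \<Longrightarrow> E G \<ge> \<delta> * Q G" by (rule E_coercive) blast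
  have "Q H \<noteq> 0"
  proof
    assume "Q H = 0"
    then show False using N_le_Q[OF H(1)] H(2) \<alpha>pos by simp
  qed
  then have "\<delta> * Q H > 0" using \<delta>(1) Q_nonneg[of H] by simp
  then show ?thesis using \<delta>(2)[OF H(1)] H(3) by simp
qed

text \<open>The tangent inequality of the convex function |z|^(\<alpha>+2). Cauchy-Schwarz bounds
  the inner product of z with z + t w, and Young's inequality with exponents \<alpha>+2 and
  (\<alpha>+2)/(\<alpha>+1) separates the resulting product. It holds for t of either sign, as a
  first variation requires.\<close>

lemma norm_powr_convex:
  fixes z w :: complex
  shows "norm (z + t *\<^sub>R w) powr (\<alpha> + 2) \<ge> norm z powr (\<alpha> + 2) + (\<alpha> + 2) * t * (norm z powr \<alpha> * (z \<bullet> w))"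
proof -
  let ?p = "\<alpha> + 2"
  define q where "q = ?p / (\<alpha> + 1)"
  have q: "q > 1" "1 / ?p + 1 / q = 1" "(\<alpha> + 1) * q = ?p"
    using \<alpha>pos by (auto simp: q_def field_simps)
  let ?s = "norm (z + t *\<^sub>R w)"
  have "?s * norm z powr (\<alpha> + 1) \<le> ?s powr ?p / ?p + (norm z powr (\<alpha> + 1)) powr q / q"
    by (rule Youngs_inequality) (use \<alpha>pos q in auto)
  also have "(norm z powr (\<alpha> + 1)) powr q = norm z powr ?p"
    by (simp add: powr_powr q(3))
  also have "?s powr ?p / ?p + norm z powr ?p / q = (?s powr ?p + (\<alpha> + 1) * norm z powr ?p) / ?p"
    unfolding q_def divide_divide_eq_right by (simp add: mult.commute add_divide_distrib[symmetric])
  finally have Y: "?p * (?s * norm z powr (\<alpha> + 1)) \<le> ?s powr ?p + (\<alpha> + 1) * norm z powr ?p"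
    using \<alpha>pos by (simp add: pos_le_divide_eq mult.commute)
  have "norm z powr ?p + t * (norm z powr \<alpha> * (z \<bullet> w)) = norm z powr \<alpha> * (z \<bullet> (z + t *\<^sub>R w))"
    by (simp add: inner_add_right power2_norm_eq_inner[symmetric] powr_add algebra_simps)
  also have "\<dots> \<le> norm z powr \<alpha> * (norm z * ?s)"
    by (intro mult_left_mono norm_cauchy_schwarz) auto
  also have "\<dots> = ?s * norm z powr (\<alpha> + 1)" by (simp add: powr_add mult_ac)
  finally have "?p * (norm z powr ?p + t * (norm z powr \<alpha> * (z \<bullet> w))) \<le> ?p * (?s * norm z powr (\<alpha> + 1))"
    using \<alpha>pos by (intro mult_left_mono) auto
  with Y show ?thesis by (simp add: algebra_simps)
qed

lemma R_integrable:
  assumes G: "rp G" and H: "rp H"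
  shows "integrable \<mu> (\<lambda>r. norm (prof G r) powr \<alpha> * (prof G r \<bullet> prof H r))"
proof (rule Bochner_Integration.integrable_bound)
  note [measurable] = rpD(5)[OF G] rpD(5)[OF H]
  show "integrable \<mu> (\<lambda>r. norm (prof G r) powr (\<alpha> + 2) + norm (prof H r) powr (\<alpha> + 2))"
    using N_integrable[OF G] N_integrable[OF H] by simp
  have young: "x powr \<alpha> * (x * y) \<le> x powr (\<alpha> + 2) + y powr (\<alpha> + 2)" if "x \<ge> 0" "y \<ge> 0" for x y :: real
  proof -
    have "x powr \<alpha> * (x * y) \<le> (max x y) powr \<alpha> * (max x y * max x y)"
      using that \<alpha>pos by (intro mult_mono powr_mono2) (auto simp: max_def)
    also have "\<dots> = (max x y) powr (\<alpha> + 2)"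
      using that by (simp add: powr_add power2_eq_square le_max_iff_disj)
    also have "\<dots> \<le> x powr (\<alpha> + 2) + y powr (\<alpha> + 2)" by (auto simp: max_def)
    finally show ?thesis .
  qed
  have "norm (prof G r) powr \<alpha> * \<bar>prof G r \<bullet> prof H r\<bar> \<le> norm (prof G r) powr (\<alpha> + 2) + norm (prof H r) powr (\<alpha> + 2)" for r
    by (rule order_trans[OF mult_left_mono[OF Cauchy_Schwarz_ineq2] young]) auto
  then show "AE r in \<mu>. norm (norm (prof G r) powr \<alpha> * (prof G r \<bullet> prof H r)) \<le> norm (norm (prof G r) powr (\<alpha> + 2) + norm (prof H r) powr (\<alpha> + 2))"
    by (simp add: abs_mult)
qed (use rpD(5)[OF G] rpD(5)[OF H] in measurable)

text \<open>Along the line through G in direction H, N is at least its affine tangent, so \<phi>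
  lies above the nonnegative difference between the two sides of \<open>E_ge\<close>. It vanishes at
  t = 0 and is given by an explicit formula, so its derivative there is zero. Near t = 0 the tangent
  is positive, which makes the power monotone and differentiable.\<close>

theorem Euler_Lagrange:
  assumes G: "rp G" and Np: "N G > 0" and EN: "E G = N G" and mN: "E G = m * N G powr (2 / (\<alpha> + 2))" and H: "rp H"
  shows "B G H = R G H"
proof -
  let ?p = "\<alpha> + 2"
  have Nt: "N (comb 1 G t H) \<ge> N G + ?p * t * R G H" for t
  proof -
    note K = comb_rp[OF G H, of 1 t]
    have "N G + ?p * t * R G H = (LINT r|\<mu>. norm (prof G r) powr ?p + ?p * t * (norm (prof G r) powr \<alpha> * (prof G r \<bullet> prof H r)))"
      unfolding N_def R_def using N_integrable[OF G] R_integrable[OF G H] by simp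
    also have "\<dots> \<le> N (comb 1 G t H)"
      unfolding N_def
    proof (rule integral_mono_AE)
      show "AE r in \<mu>. norm (prof G r) powr ?p + ?p * t * (norm (prof G r) powr \<alpha> * (prof G r \<bullet> prof H r)) \<le> norm (prof (comb 1 G t H) r) powr ?p"
        using AE_radial_pos[OF n1]
        by eventually_elim (use norm_powr_convex in \<open>simp add: comb_prof G H scaleR_conv_of_real\<close>)
    qed (use N_integrable[OF G] R_integrable[OF G H] N_integrable[OF K] in auto)
    finally show ?thesis .
  qed
  define \<phi> where "\<phi> t = E G + 2 * t * B G H + t\<^sup>2 * E H - m * (N G + ?p * t * R G H) powr (2 / ?p)" for t
  have \<phi>0: "\<phi> 0 = 0" using mN by (simp add: \<phi>_def)
  have pos: "\<exists>d>0. \<forall>t. \<bar>t\<bar> < d \<longrightarrow> N G + ?p * t * R G H > 0"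
  proof -
    define A where "A = \<bar>?p * R G H\<bar> + 1"
    have A: "A > 0" by (simp add: A_def add_nonneg_pos)
    have "N G + ?p * t * R G H > 0" if "\<bar>t\<bar> < N G / A" for t
    proof -
      have "\<bar>?p * t * R G H\<bar> = \<bar>t\<bar> * \<bar>?p * R G H\<bar>" by (simp add: abs_mult)
      also have "\<dots> \<le> \<bar>t\<bar> * A" by (intro mult_left_mono) (auto simp: A_def)
      also have "\<dots> < N G" using that A by (simp add: field_simps)
      finally show ?thesis by linarith
    qed
    then show ?thesis using Np A by (intro exI[of _ "N G / A"]) auto
  qed
  then obtain d where d: "d > 0" "\<And>t. \<bar>t\<bar> < d \<Longrightarrow> N G + ?p * t * R G H > 0" by blast
  have \<phi>_nonneg: "\<phi> t \<ge> 0" if "\<bar>t\<bar> < d" for t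
  proof -
    have "m * (N G + ?p * t * R G H) powr (2 / ?p) \<le> m * N (comb 1 G t H) powr (2 / ?p)"
      using Nt[of t] d(2)[OF that] \<alpha>pos m_nonneg by (intro mult_left_mono powr_mono2) auto
    also have "\<dots> \<le> E (comb 1 G t H)" by (rule E_ge[OF comb_rp[OF G H]])
    also have "\<dots> = E G + 2 * t * B G H + t\<^sup>2 * E H" unfolding comb_E[OF G H] by simp
    finally show ?thesis by (simp add: \<phi>_def)
  qed
  have "(\<phi> has_real_derivative (2 * B G H - m * ((2 / ?p) * N G powr (2 / ?p - 1) * (?p * R G H)))) (at 0)"
    unfolding \<phi>_def
    by (rule derivative_eq_intros refl | use Np in simp)+
  then have "2 * B G H - m * ((2 / ?p) * N G powr (2 / ?p - 1) * (?p * R G H)) = 0"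
    by (rule DERIV_local_min[OF _ d(1)]) (use \<phi>_nonneg \<phi>0 in auto)
  \<comment> \<open>This is the Lagrange multiplier: it equals 1 because E G = N G, which is what
    makes G solve the equation without a rescaling.\<close>
  moreover have "m * N G powr (2 / ?p - 1) = 1"
    using EN mN Np by (simp add: powr_diff)
  moreover have "m * ((2 / ?p) * N G powr (2 / ?p - 1) * (?p * R G H)) = 2 * (m * N G powr (2 / ?p - 1)) * R G H"
    using \<alpha>pos by simp
  ultimately show ?thesis by simp
qed

text \<open>On E = N the inequality \<open>E_ge\<close> reads
  \<open>m * N powr (2 / (\<alpha> + 2)) \<le> N\<close>, and d = m^((\<alpha>+2)/\<alpha>) is the
  positive solution of equality. The minimizer times m^(1/\<alpha>) reaches it, both E and N of this
  multiple being d. A profile at level d realizes equality in \<open>E_ge\<close>, which is the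
  hypothesis of \<open>Euler_Lagrange\<close>.\<close>

theorem ground_level:
  obtains d where "d > 0"
    "\<And>G. rp G \<Longrightarrow> N G > 0 \<Longrightarrow> E G = N G \<Longrightarrow> d \<le> N G"
    "\<exists>G. rp G \<and> E G = N G \<and> N G = d"
    "\<And>G H. rp G \<Longrightarrow> E G = N G \<Longrightarrow> N G = d \<Longrightarrow> rp H \<Longrightarrow> B G H = R G H"
proof -
  let ?p = "\<alpha> + 2"
  define d where "d = m powr (?p / \<alpha>)"
  have d: "d > 0" using m_pos by (simp add: d_def)
  have s1: "\<alpha> / ?p + 2 / ?p = 1" using \<alpha>pos by (simp add: add_divide_distrib[symmetric])
  then have e: "1 - 2 / ?p = \<alpha> / ?p" by linarith
  have md: "m = d powr (\<alpha> / ?p)" using m_pos \<alpha>pos by (simp add: d_def powr_powr)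
  have mE: "m * d powr (2 / ?p) = d"
  proof -
    have "m * d powr (2 / ?p) = d powr (\<alpha> / ?p + 2 / ?p)" unfolding md by (simp only: powr_add)
    then show ?thesis using d by (simp add: s1)
  qed
  show ?thesis
  proof (rule that[OF d])
    fix G assume G: "rp G" "N G > 0" "E G = N G"
    have "m * N G powr (2 / ?p) \<le> N G" using E_ge[OF G(1)] G(3) by simp
    then have "m \<le> N G / N G powr (2 / ?p)" using G(2) by (simp add: field_simps)
    also have "\<dots> = N G powr (\<alpha> / ?p)"
      using G(2) powr_diff[of "N G" 1 "2 / ?p"] by (simp only: e) simp
    finally have "m powr (?p / \<alpha>) \<le> (N G powr (\<alpha> / ?p)) powr (?p / \<alpha>)"
      using m_pos \<alpha>pos by (intro powr_mono2) auto
    then show "d \<le> N G" using G(2) \<alpha>pos by (simp add: d_def powr_powr)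
  next
    obtain H where H: "rp H" "N H = 1" "E H = m" using minimizer_exists by blast
    define a where "a = m powr (1 / \<alpha>)"
    have "\<bar>a\<bar> powr ?p = d" using m_pos by (simp add: a_def d_def powr_powr)
    moreover have "a\<^sup>2 * m = d"
    proof -
      have "a\<^sup>2 * m = m powr (1 / \<alpha> + 1 / \<alpha> + 1)"
      proof -
        have "a\<^sup>2 * m = m powr (1 / \<alpha>) * m powr (1 / \<alpha>) * m powr 1"
          using m_pos by (simp add: a_def power2_eq_square)
        then show ?thesis by (simp only: powr_add)
      qed
      also have "1 / \<alpha> + 1 / \<alpha> + 1 = ?p / \<alpha>" using \<alpha>pos by (simp add: field_simps)
      finally show ?thesis by (simp add: d_def)
    qed
    ultimately show "\<exists>G. rp G \<and> E G = N G \<and> N G = d"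
      using N_scale[OF H(1), of a] H by (intro exI[of _ "\<lambda>s. of_real a * H s"]) simp
  next
    fix G H assume G: "rp G" "E G = N G" "N G = d" and H: "rp H"
    show "B G H = R G H"
      by (rule Euler_Lagrange[OF G(1) _ G(2) _ H]) (use G d mE in auto)
  qed
qed

text \<open>Near 0 the pointwise bound r^(-(n-2)/2) to the power \<alpha> is at most r^-2, since
  \<alpha> < 4/(n-2); away from 0 it is bounded. Thus the nonlinear term can be paired with any
  function in H1 through the L2 and the Hardy norms.\<close>

lemma prof_powr_le:
  assumes G: "rp G"
  obtains K where "K \<ge> 0" "\<And>r. r > 0 \<Longrightarrow> norm (prof G r) powr \<alpha> \<le> K * (1 + inverse (r\<^sup>2))"
proof -
  let ?k = "surface_const n"
  have k: "?k > 0" by (rule surface_const_pos[OF n1])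
  have n2: "real n - 2 > 0" using n by simp
  define K1 where "K1 = (sqrt (Q G) * sqrt (1 / ((real n - 2) * ?k))) powr \<alpha>"
  define K2 where "K2 = (sqrt (Q G) * sqrt (2 / ?k)) powr \<alpha>"
  have "norm (prof G r) powr \<alpha> \<le> (K1 + K2) * (1 + inverse (r\<^sup>2))" if r: "r > 0" for r
  proof (cases "r \<le> 1")
    case True
    have "D r = sqrt (1 / ((real n - 2) * ?k)) * r powr ((2 - real n) / 2)"
      using True r by (simp add: D_def tail_const_def real_sqrt_divide powr_half_sqrt[symmetric] powr_powr)
    then have "norm (prof G r) \<le> (sqrt (Q G) * sqrt (1 / ((real n - 2) * ?k))) * r powr ((2 - real n) / 2)"
      using prof_le_D[OF G r] by (simp only: mult.assoc)
    then have "norm (prof G r) powr \<alpha> \<le> ((sqrt (Q G) * sqrt (1 / ((real n - 2) * ?k))) * r powr ((2 - real n) / 2)) powr \<alpha>"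
      using \<alpha>pos by (intro powr_mono2) auto
    also have "\<dots> = K1 * r powr ((2 - real n) / 2 * \<alpha>)"
      using Q_nonneg[of G] n2 k unfolding K1_def by (subst powr_mult) (auto simp: powr_powr)
    also have "\<dots> \<le> K1 * r powr (- 2)"
    proof (intro mult_left_mono powr_mono')
      have "(real n - 2) * \<alpha> < 4" using \<alpha>(2) n2 by (simp add: field_simps)
      then show "- 2 \<le> (2 - real n) / 2 * \<alpha>" by (simp add: algebra_simps)
    qed (use r True in \<open>auto simp: K1_def\<close>)
    also have "r powr (- 2) = inverse (r\<^sup>2)" using r by (simp add: powr_minus powr_numeral)
    also have "K1 * inverse (r\<^sup>2) \<le> (K1 + K2) * (1 + inverse (r\<^sup>2))"
      by (intro mult_mono) (auto simp: K1_def K2_def)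
    finally show ?thesis .
  next
    case False
    have "D r \<le> sqrt (2 / ?k)"
    proof -
      have "?k * 1 \<le> ?k * r ^ (n - 1)" using False k by (intro mult_left_mono one_le_power) auto
      then have "2 / radial_density n r \<le> 2 / ?k"
        unfolding radial_density_eq[OF r] using k by (intro divide_left_mono) auto
      then show ?thesis using False by (simp add: D_def)
    qed
    then have "norm (prof G r) \<le> sqrt (Q G) * sqrt (2 / ?k)"
      using prof_le_D[OF G r] by (rule_tac order_trans[OF _ mult_left_mono]) (auto simp: Q_nonneg)
    then have "norm (prof G r) powr \<alpha> \<le> K2"
      unfolding K2_def using \<alpha>pos by (intro powr_mono2) auto
    also have "K2 * 1 \<le> (K1 + K2) * (1 + inverse (r\<^sup>2))"
      by (intro mult_mono) (auto simp: K1_def K2_def)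
    then have "K2 \<le> (K1 + K2) * (1 + inverse (r\<^sup>2))" by simp
    finally show ?thesis .
  qed
  moreover have "K1 + K2 \<ge> 0" by (simp add: K1_def K2_def)
  ultimately show ?thesis by (rule that[rotated])
qed

end

section \<open>Back to the Sobolev space\<close>

lemma profile_Hardy:
  assumes n: "CARD('n::finite) \<ge> 3" and G: "rad_profile CARD('n) G"
  shows "L2 (radial_measure CARD('n)) (hprof G) \<and>
    L2sq (radial_measure CARD('n)) (hprof G) \<le> (2 / (real CARD('n) - 2))\<^sup>2 * L2sq (radial_measure CARD('n)) G"
proof -
  have L: "L2 (radial_measure CARD('n)) G" using G by (simp add: rad_profile_def)
  note [measurable] = L2_radial_borel[OF L]
  note H = Hardy_inequality[OF n weak_pair_profile[OF n G], folded hprof_def]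
  show ?thesis
    using H L2_radial_iff[of "hprof G", where 'a="real^'n"] radvec_L2(2)[OF L] by simp
qed

lemma lebesgue_integral_eq_lborel:
  fixes f f' :: "'a::euclidean_space \<Rightarrow> 'b::euclidean_space"
  assumes f': "f' \<in> borel_measurable borel" and ae: "AE x in lebesgue. f x = f' x"
  shows "(LINT x|lebesgue. f x) = (LINT x|lborel. f' x)"
proof -
  have "(LINT x|lebesgue. f x) = (LINT x|lebesgue. f' x)"
    using lebesgue_measurable_AE_borel[OF f' ae] f' ae
    by (intro integral_cong_AE) (auto simp: measurable_completion)
  also have "\<dots> = (LINT x|lborel. f' x)"
    by (rule integral_completion) (use f' in simp)
  finally show ?thesis .
qed

lemma Lp_norm_powr:
  assumes "p > 0" shows "Lp_norm p f powr p = (LINT x|lebesgue. norm (f x) powr p)"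
  using assms by (simp add: Lp_norm_def powr_powr)

lemma Lp_norm_2_sq: "(Lp_norm 2 f)\<^sup>2 = (LINT x|lebesgue. (norm (f x))\<^sup>2)"
proof -
  have "Lp_norm 2 f \<ge> 0" by (simp add: Lp_norm_def)
  then have "(Lp_norm 2 f)\<^sup>2 = Lp_norm 2 f powr 2" by simp
  then show ?thesis using Lp_norm_powr[of 2 f] by simp
qed

lemma Lp_norm_2_sq_eq:
  fixes f' :: "real ^ 'n \<Rightarrow> 'b::euclidean_space"
  assumes [measurable]: "f' \<in> borel_measurable borel" and ae: "AE x in lebesgue. f x = f' x"
  shows "(Lp_norm 2 f)\<^sup>2 = L2sq lborel f'"
  unfolding Lp_norm_2_sq L2sq_def
  by (rule lebesgue_integral_eq_lborel) (use ae in \<open>auto elim: eventually_mono\<close>)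

lemma Hc_norm_sq_eq:
  fixes v :: "real ^ 'n \<Rightarrow> complex"
  assumes W: "weak_pair w g" and v: "AE x in lebesgue. v x = w x"
  shows "Hc_norm_sq c v = L2sq lborel g - c * L2sq lborel (\<lambda>x. inverse (norm x) *\<^sub>R w x)"
proof -
  have L: "L2 lborel w" "L2 lborel g" using W by (auto simp: weak_pair_def)
  note [measurable] = L[THEN L2_measurable, unfolded measurable_lborel2]
  have "(Lp_norm 2 (weak_gradient v))\<^sup>2 = L2sq lborel g"
    by (rule Lp_norm_2_sq_eq[OF _ H1_weak_pair(2)[OF W v]]) measurable
  moreover have "(Lp_norm 2 (\<lambda>x. inverse (norm x) *\<^sub>R v x))\<^sup>2 = L2sq lborel (\<lambda>x. inverse (norm x) *\<^sub>R w x)"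
    by (rule Lp_norm_2_sq_eq) (use v in \<open>auto elim: eventually_mono\<close>)
  ultimately show ?thesis by (simp add: Hc_norm_sq_def)
qed

lemma action_scale:
  fixes v :: "real ^ 'n \<Rightarrow> complex"
  assumes v: "v \<in> H1" and \<alpha>: "\<alpha> > 0"
  shows "action c \<alpha> \<omega> (\<lambda>x. l *\<^sub>R v x) =
    l\<^sup>2 * (1 / 2 * (Hc_norm_sq c v + \<omega> * (Lp_norm 2 v)\<^sup>2)) - \<bar>l\<bar> powr (\<alpha> + 2) * (Lp_norm (\<alpha> + 2) v powr (\<alpha> + 2) / (\<alpha> + 2))"
proof -
  obtain w g where W: "weak_pair w g" and vw: "AE x in lebesgue. v x = w x"
    using H1_obtain[OF v] by metis
  have L: "L2 lborel w" "L2 lborel g" using W by (auto simp: weak_pair_def)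
  have Wl: "weak_pair (\<lambda>x. of_real l * w x) (\<lambda>x. of_real l *s g x)" by (rule weak_pair_cmult[OF W])
  have vl: "AE x in lebesgue. l *\<^sub>R v x = of_real l * w x"
    using vw by eventually_elim (simp add: scaleR_conv_of_real)
  have "L2sq lborel (\<lambda>x. of_real l *s g x) = l\<^sup>2 * L2sq lborel g"
    by (simp add: L2sq_def norm_vector_cmult power_mult_distrib)
  moreover have "L2sq lborel (\<lambda>x. inverse (norm x) *\<^sub>R (of_real l * w x)) = l\<^sup>2 * L2sq lborel (\<lambda>x. inverse (norm x) *\<^sub>R w x)"
    by (simp add: L2sq_def norm_mult power_mult_distrib mult.left_commute)
  ultimately have Hc: "Hc_norm_sq c (\<lambda>x. l *\<^sub>R v x) = l\<^sup>2 * Hc_norm_sq c v"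
    unfolding Hc_norm_sq_eq[OF Wl vl] Hc_norm_sq_eq[OF W vw] by (simp add: algebra_simps)
  have L2: "(Lp_norm 2 (\<lambda>x. l *\<^sub>R v x))\<^sup>2 = l\<^sup>2 * (Lp_norm 2 v)\<^sup>2"
    by (simp add: Lp_norm_2_sq power_mult_distrib)
  have Lp: "Lp_norm (\<alpha> + 2) (\<lambda>x. l *\<^sub>R v x) powr (\<alpha> + 2) = \<bar>l\<bar> powr (\<alpha> + 2) * Lp_norm (\<alpha> + 2) v powr (\<alpha> + 2)"
    using \<alpha> by (simp add: Lp_norm_powr powr_mult)
  show ?thesis unfolding action_def Hc L2 Lp by (simp add: algebra_simps)
qed

lemma action_has_derivative:
  fixes v :: "real ^ 'n \<Rightarrow> complex"
  assumes v: "v \<in> H1" and \<alpha>: "\<alpha> > 0"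
  shows "((\<lambda>l::real. action c \<alpha> \<omega> (\<lambda>x. l *\<^sub>R v x)) has_real_derivative
     Hc_norm_sq c v + \<omega> * (Lp_norm 2 v)\<^sup>2 - Lp_norm (\<alpha> + 2) v powr (\<alpha> + 2)) (at 1)"
proof -
  define a where "a = 1 / 2 * (Hc_norm_sq c v + \<omega> * (Lp_norm 2 v)\<^sup>2)"
  define b where "b = Lp_norm (\<alpha> + 2) v powr (\<alpha> + 2) / (\<alpha> + 2)"
  have "((\<lambda>l. l\<^sup>2 * a - l powr (\<alpha> + 2) * b) has_real_derivative 2 * a - (\<alpha> + 2) * b) (at 1)"
    by (auto intro!: derivative_eq_intros)
  then have "((\<lambda>l::real. action c \<alpha> \<omega> (\<lambda>x. l *\<^sub>R v x)) has_real_derivative 2 * a - (\<alpha> + 2) * b) (at 1)"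
    by (rule has_field_derivative_transform_within_open[of _ _ _ "{0<..}"])
       (auto simp: action_scale[OF v \<alpha>] a_def b_def)
  moreover have "2 * a = Hc_norm_sq c v + \<omega> * (Lp_norm 2 v)\<^sup>2" by (simp add: a_def)
  moreover have "(\<alpha> + 2) * b = Lp_norm (\<alpha> + 2) v powr (\<alpha> + 2)" using \<alpha> by (simp add: b_def)
  ultimately show ?thesis by simp
qed

lemma nehari_eq:
  fixes v :: "real ^ 'n \<Rightarrow> complex"
  assumes "v \<in> H1" "\<alpha> > 0"
  shows "nehari c \<alpha> \<omega> v = Hc_norm_sq c v + \<omega> * (Lp_norm 2 v)\<^sup>2 - Lp_norm (\<alpha> + 2) v powr (\<alpha> + 2)"
  unfolding nehari_def by (rule DERIV_imp_deriv[OF action_has_derivative[OF assms]])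

text \<open>A radial factor is constant on spheres, so only the spherical mean of the other factor
  is seen. The reduction of test functions to profiles rests on this.\<close>

lemma integral_radial_inner:
  fixes h :: "real ^ 'n \<Rightarrow> complex" and a :: "real \<Rightarrow> complex"
  assumes [measurable]: "a \<in> borel_measurable borel" and h: "L2 lborel h"
    and I: "integrable lborel (\<lambda>x. a (norm x) \<bullet> h x)"
  shows "(LINT x|lborel. a (norm x) \<bullet> h x) = (LINT r|radial_measure CARD('n). a r \<bullet> sph_avg h r)"
proof -
  note [measurable] = L2_measurable[OF h, unfolded measurable_lborel2]
  have "(LINT x|lborel. a (norm x) \<bullet> h x) = (LINT r|radial_measure CARD('n). sph_avg (\<lambda>x. a (norm x) \<bullet> h x) r)"
    using integral_sph_avg(1)[OF I] by simp
  also have "\<dots> = (LINT r|radial_measure CARD('n). a r \<bullet> sph_avg h r)"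
  proof (rule integral_cong_AE)
    show "AE r in radial_measure CARD('n). sph_avg (\<lambda>x. a (norm x) \<bullet> h x) r = a r \<bullet> sph_avg h r"
      using AE_polar_coords[where 'a="real^'n"] sph_avg_L2(2)[OF h] unfolding DIM_cart DIM_real mult_1_right
    proof eventually_elim
      case (elim r)
      have ae: "AE \<theta> in (sphere_measure :: (real ^ 'n) measure). a (norm (r *\<^sub>R \<theta>)) \<bullet> h (r *\<^sub>R \<theta>) = a r \<bullet> h (r *\<^sub>R \<theta>)"
        using elim(1) by eventually_elim metis
      have "sph_avg (\<lambda>x. a (norm x) \<bullet> h x) r = (LINT \<theta>|sphere_measure. a r \<bullet> h (r *\<^sub>R \<theta>))"
        unfolding sph_avg_def by (rule integral_cong_AE[OF _ _ ae]) measurable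
      also have "\<dots> = a r \<bullet> sph_avg h r"
        unfolding sph_avg_def by (rule integral_inner_right) (use elim(2) in simp)
      finally show ?case .
    qed
  qed (unfold measurable_radial, measurable)
  finally show ?thesis .
qed

section \<open>The weak equation for radial functions\<close>

lemma radvec_inner: "radvec G x \<bullet> \<gamma> = G (norm x) \<bullet> cdot (sgn x) \<gamma>"
  by (simp add: inner_vec_def radvec_def cdot_def inner_sum_right)

definition energy_form ::
  "real \<Rightarrow> real \<Rightarrow> real \<Rightarrow> (real ^ 'n \<Rightarrow> complex) \<Rightarrow> (real ^ 'n \<Rightarrow> complex ^ 'n) \<Rightarrow>
     (real ^ 'n \<Rightarrow> complex) \<Rightarrow> (real ^ 'n \<Rightarrow> complex ^ 'n) \<Rightarrow> complex" where
  "energy_form c \<alpha> \<omega> v g w \<gamma> =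
     (\<Sum>i\<in>UNIV. LINT x|lborel. g x $ i * cnj (\<gamma> x $ i))
     + complex_of_real \<omega> * (LINT x|lborel. v x * cnj (w x))
     - complex_of_real c * (LINT x|lborel. inverse ((norm x)\<^sup>2) *\<^sub>R (v x * cnj (w x)))
     - (LINT x|lborel. (norm (v x) powr \<alpha>) *\<^sub>R (v x * cnj (w x)))"

text \<open>The variational argument sees real parts only; the choice z = i recovers the imaginary
  part of the equation from the real one.\<close>

lemma energy_form_cmult:
  "energy_form c \<alpha> \<omega> v g (\<lambda>x. z * w x) (\<lambda>x. z *s \<gamma> x) = cnj z * energy_form c \<alpha> \<omega> v g w \<gamma>"
proof -
  have 1: "g x $ i * cnj ((z *s \<gamma> x) $ i) = cnj z * (g x $ i * cnj (\<gamma> x $ i))" for x i by simp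
  have 2: "v x * cnj (z * w x) = cnj z * (v x * cnj (w x))" for x by simp
  have 3: "a *\<^sub>R (cnj z * y) = cnj z * (a *\<^sub>R y)" for a :: real and y by simp
  show ?thesis unfolding energy_form_def 1 2 3 integral_mult_right_zero
    by (simp add: sum_distrib_left[symmetric] algebra_simps)
qed

lemma cnj_measurable [measurable (raw)]: "f \<in> borel_measurable M \<Longrightarrow> (\<lambda>x. cnj (f x)) \<in> borel_measurable M"
  by (rule borel_measurable_continuous_on[of cnj]) (auto intro: continuous_intros)

text \<open>Frees the equation from Lebesgue representatives and from the choice operator in
  \<open>weak_gradient\<close>, both for the solution and for the test function.\<close>

lemma weak_solution_iff:
  fixes v :: "real ^ 'n \<Rightarrow> complex"
  assumes W: "weak_pair w g" and v: "AE x in lebesgue. v x = w x"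
  shows "weak_solution c \<alpha> \<omega> v \<longleftrightarrow> (\<forall>u \<gamma>. weak_pair u \<gamma> \<longrightarrow> energy_form c \<alpha> \<omega> w g u \<gamma> = 0)"
proof -
  have L: "L2 lborel w" "L2 lborel g" using W by (auto simp: weak_pair_def)
  note [measurable] = L[THEN L2_measurable, unfolded measurable_lborel2]
  note vH = H1_weak_pair[OF W v]
  let ?T = "\<lambda>\<phi>. (\<Sum>i\<in>UNIV. LINT x|lebesgue. weak_gradient v x $ i * cnj (weak_gradient \<phi> x $ i))
        + complex_of_real \<omega> * (LINT x|lebesgue. v x * cnj (\<phi> x))
        - complex_of_real c * (LINT x|lebesgue. inverse ((norm x)\<^sup>2) *\<^sub>R (v x * cnj (\<phi> x)))
        - (LINT x|lebesgue. (norm (v x) powr \<alpha>) *\<^sub>R (v x * cnj (\<phi> x)))"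
  have eq: "?T \<phi> = energy_form c \<alpha> \<omega> w g u \<gamma>"
    if U: "weak_pair u \<gamma>" and \<phi>: "AE x in lebesgue. \<phi> x = u x" for \<phi> u \<gamma>
  proof -
    have LU: "L2 lborel u" "L2 lborel \<gamma>" using U by (auto simp: weak_pair_def)
    note [measurable] = LU[THEN L2_measurable, unfolded measurable_lborel2]
    note d\<phi> = H1_weak_pair(2)[OF U \<phi>]
    have 1: "(LINT x|lebesgue. weak_gradient v x $ i * cnj (weak_gradient \<phi> x $ i)) = (LINT x|lborel. g x $ i * cnj (\<gamma> x $ i))" for i
      by (rule lebesgue_integral_eq_lborel, measurable) (use vH(2) d\<phi> in \<open>eventually_elim, simp\<close>)
    have 2: "(LINT x|lebesgue. v x * cnj (\<phi> x)) = (LINT x|lborel. w x * cnj (u x))"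
      by (rule lebesgue_integral_eq_lborel, measurable) (use v \<phi> in \<open>eventually_elim, simp\<close>)
    have 3: "(LINT x|lebesgue. inverse ((norm x)\<^sup>2) *\<^sub>R (v x * cnj (\<phi> x))) = (LINT x|lborel. inverse ((norm x)\<^sup>2) *\<^sub>R (w x * cnj (u x)))"
      by (rule lebesgue_integral_eq_lborel, measurable) (use v \<phi> in \<open>eventually_elim, simp\<close>)
    have 4: "(LINT x|lebesgue. (norm (v x) powr \<alpha>) *\<^sub>R (v x * cnj (\<phi> x))) = (LINT x|lborel. (norm (w x) powr \<alpha>) *\<^sub>R (w x * cnj (u x)))"
      by (rule lebesgue_integral_eq_lborel, measurable) (use v \<phi> in \<open>eventually_elim, simp\<close>)
    show ?thesis unfolding energy_form_def 1 2 3 4 ..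
  qed
  show ?thesis
  proof
    assume S: "weak_solution c \<alpha> \<omega> v"
    show "\<forall>u \<gamma>. weak_pair u \<gamma> \<longrightarrow> energy_form c \<alpha> \<omega> w g u \<gamma> = 0"
    proof (intro allI impI)
      fix u :: "real ^ 'n \<Rightarrow> complex" and \<gamma> assume U: "weak_pair u \<gamma>"
      have ae: "AE x in lebesgue. u x = u x" by simp
      have "?T u = 0" using S H1_weak_pair(1)[OF U ae] unfolding weak_solution_def by blast
      then show "energy_form c \<alpha> \<omega> w g u \<gamma> = 0" unfolding eq[OF U ae] .
    qed
  next
    assume T: "\<forall>u \<gamma>. weak_pair u \<gamma> \<longrightarrow> energy_form c \<alpha> \<omega> w g u \<gamma> = 0"
    have "?T \<phi> = 0" if \<phi>: "\<phi> \<in> H1" for \<phi>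
    proof -
      obtain u \<gamma> where U: "weak_pair u \<gamma>" "AE x in lebesgue. \<phi> x = u x" using H1_obtain[OF \<phi>] by metis
      then show ?thesis using T eq by simp
    qed
    then show "weak_solution c \<alpha> \<omega> v" unfolding weak_solution_def using vH(1) by blast
  qed
qed

lemma H1_rad_obtain_profile:
  fixes v :: "real ^ 'n \<Rightarrow> complex"
  assumes n: "CARD('n) \<ge> 3" and v: "v \<in> H1_rad"
  obtains G where "rad_profile CARD('n) G" "AE x in lebesgue. v x = prof G (norm x)"
proof -
  obtain f where "v \<in> H1" and f: "AE x in lebesgue. v x = f (norm x)" using v by (auto simp: H1_rad_def)
  then obtain w g where W: "weak_pair w g" and vw: "AE x in lebesgue. v x = w x" using H1_obtain by metis
  from vw f have "AE x in lebesgue. w x = f (norm x)" by eventually_elim simp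
  then have "AE x in lborel. w x = f (norm x)" by (simp add: AE_completion_iff)
  then obtain G where G: "rad_profile CARD('n) G" "AE x in lborel. w x = prof G (norm x)"
    using radial_weak_pair[OF n W] by metis
  from vw AE_completion[OF G(2)] have "AE x in lebesgue. v x = prof G (norm x)" by eventually_elim simp
  with G(1) show ?thesis by (rule that)
qed

lemma profile_in_H1_rad:
  fixes v :: "real ^ 'n \<Rightarrow> complex"
  assumes "CARD('n) \<ge> 3" "rad_profile CARD('n) G" "AE x in lebesgue. v x = prof G (norm x)"
  shows "v \<in> H1_rad"
  using H1_weak_pair(1)[OF weak_pair_profile[OF assms(1,2)] assms(3)] assms(3) by (auto simp: H1_rad_def)

context radial_variational
begin

text \<open>The equation \<open>n = CARD('n)\<close> ties the number in the locale to the dimension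
  in the type, so that functionals on the space can be read off from the half-line. The last claim
  expresses being nonzero as N > 0.\<close>

lemma profile_functionals:
  fixes v :: "real ^ 'n \<Rightarrow> complex"
  assumes dim: "n = CARD('n)" and G: "rp G" and v: "AE x in lebesgue. v x = prof G (norm x)"
  shows "action c \<alpha> \<omega> v = 1 / 2 * E G - N G / (\<alpha> + 2)"
    and "nehari c \<alpha> \<omega> v = E G - N G"
    and "(AE x in lebesgue. v x = 0) \<longleftrightarrow> N G = 0"
proof -
  have n3: "CARD('n) \<ge> 3" and G': "rad_profile CARD('n) G" using n G dim by auto
  note W = weak_pair_profile[OF n3 G']
  note [measurable] = rpD(4-6)[OF G]
  have Hc: "Hc_norm_sq c v = L2sq \<mu> G - c * L2sq \<mu> (hprof G)"
    unfolding Hc_norm_sq_eq[OF W v]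
    using radvec_L2(2)[of G, where 'n='n] rpD(1)[OF G] L2_radial_iff(2)[of "hprof G", where 'a="real^'n"]
    by (simp add: dim hprof_def[abs_def])
  have L: "(Lp_norm 2 v)\<^sup>2 = L2sq \<mu> (prof G)"
    using Lp_norm_2_sq_eq[OF _ v] L2_radial_iff(2)[of "prof G", where 'a="real^'n"] by (simp add: dim)
  have Nv: "Lp_norm (\<alpha> + 2) v powr (\<alpha> + 2) = N G"
  proof -
    have "Lp_norm (\<alpha> + 2) v powr (\<alpha> + 2) = (LINT x|lebesgue. norm (v x) powr (\<alpha> + 2))"
      using \<alpha>pos by (intro Lp_norm_powr) auto
    also have "\<dots> = (LINT x|lborel. norm (prof G (norm (x :: real ^ 'n))) powr (\<alpha> + 2))"
      by (rule lebesgue_integral_eq_lborel) (use v in \<open>auto elim: eventually_mono\<close>)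
    also have "\<dots> = N G"
      using radial_integral(2)[of "\<lambda>r. norm (prof G r) powr (\<alpha> + 2)", where 'a="real^'n"] unfolding N_def by (simp add: dim)
    finally show ?thesis .
  qed
  show "action c \<alpha> \<omega> v = 1 / 2 * E G - N G / (\<alpha> + 2)"
    unfolding action_def Hc L Nv E_def by (simp add: algebra_simps)
  have "v \<in> H1" by (rule H1_weak_pair(1)[OF W v])
  from nehari_eq[OF this \<alpha>pos] show "nehari c \<alpha> \<omega> v = E G - N G"
    by (simp add: Hc L Nv E_def)
  have "N G = 0 \<longleftrightarrow> (AE r in \<mu>. norm (prof G r) powr (\<alpha> + 2) = 0)"
    unfolding N_def by (rule integral_nonneg_eq_0_iff_AE[OF N_integrable[OF G]]) simp
  also have "\<dots> \<longleftrightarrow> (AE r in distr lborel borel (norm :: real ^ 'n \<Rightarrow> real). prof G r = 0)"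
    unfolding distr_norm_lborel DIM_cart DIM_real mult_1_right dim by simp
  also have "\<dots> \<longleftrightarrow> (AE x in lborel. prof G (norm (x :: real ^ 'n)) = 0)"
    by (rule AE_distr_iff) measurable
  also have "\<dots> \<longleftrightarrow> (AE x in lebesgue. prof G (norm (x :: real ^ 'n)) = 0)"
    by (simp add: AE_completion_iff)
  also have "\<dots> \<longleftrightarrow> (AE x in lebesgue. v x = 0)"
  proof
    assume "AE x in lebesgue. prof G (norm (x :: real ^ 'n)) = 0"
    with v show "AE x in lebesgue. v x = 0" by eventually_elim simp
  next
    assume "AE x in lebesgue. v x = 0"
    with v show "AE x in lebesgue. prof G (norm (x :: real ^ 'n)) = 0" by eventually_elim simp
  qed
  finally show "(AE x in lebesgue. v x = 0) \<longleftrightarrow> N G = 0" by simp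
qed

lemma energy_form_Re:
  fixes u :: "real ^ 'n \<Rightarrow> complex"
  assumes dim: "n = CARD('n)" and G: "rp G" and U: "weak_pair u \<gamma>"
  defines "V \<equiv> \<lambda>x :: real ^ 'n. prof G (norm x)"
  shows "integrable lborel (\<lambda>x. norm (V x) powr \<alpha> * (V x \<bullet> u x))"
    and "Re (energy_form c \<alpha> \<omega> V (radvec G) u \<gamma>) =
      L2inner lborel (radvec G) \<gamma> + \<omega> * L2inner lborel V u
      - c * L2inner lborel (\<lambda>x. hprof G (norm x)) (\<lambda>x. inverse (norm x) *\<^sub>R u x)
      - (LINT x|lborel. norm (V x) powr \<alpha> * (V x \<bullet> u x))"
proof -
  have n3: "CARD('n) \<ge> 3" and G': "rad_profile CARD('n) G" using n G dim by auto
  have LU: "L2 lborel u" "L2 lborel \<gamma>" using U by (auto simp: weak_pair_def)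
  note LH = Hardy_inequality(1)[OF n3 U]
  have LV: "L2 lborel V" "L2 lborel (radvec G :: real ^ 'n \<Rightarrow> complex ^ 'n)"
    using weak_pair_profile[OF n3 G'] by (auto simp: weak_pair_def V_def)
  have LhV: "L2 lborel (\<lambda>x :: real ^ 'n. hprof G (norm x))"
    using Hardy_inequality(1)[OF n3 weak_pair_profile[OF n3 G']] by (simp add: hprof_def)
  note [measurable] = LU[THEN L2_measurable, unfolded measurable_lborel2] LV[THEN L2_measurable, unfolded measurable_lborel2]
    rpD(4-6)[OF G]
  have Re_integral: "Re (LINT x|lborel. f x) = (LINT x|lborel. Re (f x))" if "integrable lborel f" for f :: "real ^ 'n \<Rightarrow> complex"
    using integral_bounded_linear[OF bounded_linear_Re that] by simp
  have Re_cnj: "Re (a * cnj b) = a \<bullet> b" for a b by (simp add: inner_complex_def)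
  have Re_of_real_mult: "Re (complex_of_real a * z) = a * Re z" for a z by simp
  have i1: "integrable lborel (\<lambda>x. radvec G x $ i * cnj (\<gamma> x $ i))" for i
    by (rule L2_integrable_mult_bound[OF L2_nth[OF LV(2)] L2_nth[OF LU(2)]]) (auto simp: norm_mult)
  have i2: "integrable lborel (\<lambda>x. V x * cnj (u x))"
    by (rule L2_integrable_mult_bound[OF LV(1) LU(1)]) (auto simp: norm_mult)
  have i3: "integrable lborel (\<lambda>x. inverse ((norm x)\<^sup>2) *\<^sub>R (V x * cnj (u x)))"
    by (rule L2_integrable_mult_bound[OF LhV LH])
       (auto simp: norm_mult hprof_def V_def power2_eq_square mult_ac)
  obtain K where K: "K \<ge> 0" "\<And>r. r > 0 \<Longrightarrow> norm (prof G r) powr \<alpha> \<le> K * (1 + inverse (r\<^sup>2))"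
    using prof_powr_le[OF G] by metis
  \<comment> \<open>By \<open>prof_powr_le\<close> the integrand is at most a constant times the sum
    of the L2 pairing of V with u and the pairing of their quotients by \<open>norm x\<close>, both
    integrable.\<close>
  have i4: "integrable lborel (\<lambda>x. (norm (V x) powr \<alpha>) *\<^sub>R (V x * cnj (u x)))"
  proof (rule Bochner_Integration.integrable_bound)
    show "integrable lborel (\<lambda>x. K * (norm (V x) * norm (u x)) + K * (norm (hprof G (norm x)) * norm (inverse (norm x) *\<^sub>R u x)))"
      using L2_integrable_norm_mult[OF LV(1) LU(1)] L2_integrable_norm_mult[OF LhV LH] by simp
    show "AE x in lborel. norm ((norm (V x) powr \<alpha>) *\<^sub>R (V x * cnj (u x)))
       \<le> norm (K * (norm (V x) * norm (u x)) + K * (norm (hprof G (norm x)) * norm (inverse (norm x) *\<^sub>R u x)))"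
      using AE_lborel_singleton[of 0]
    proof eventually_elim
      case (elim x)
      have "norm (V x) powr \<alpha> * (norm (V x) * norm (u x)) \<le> (K * (1 + inverse ((norm x)\<^sup>2))) * (norm (V x) * norm (u x))"
        using K(2)[of "norm x"] elim by (intro mult_right_mono) (auto simp: V_def)
      also have "\<dots> = K * (norm (V x) * norm (u x)) + K * (norm (hprof G (norm x)) * norm (inverse (norm x) *\<^sub>R u x))"
        by (simp add: hprof_def V_def power2_eq_square algebra_simps)
      finally show ?case using K(1) by (simp add: norm_mult abs_of_nonneg)
    qed
  qed measurable
  have "integrable lborel (\<lambda>x. Re ((norm (V x) powr \<alpha>) *\<^sub>R (V x * cnj (u x))))"
    by (rule integrable_bounded_linear[OF bounded_linear_Re i4])
  then show "integrable lborel (\<lambda>x. norm (V x) powr \<alpha> * (V x \<bullet> u x))"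
    by (simp only: scaleR_complex.sel Re_cnj)
  have t1: "Re (\<Sum>i\<in>UNIV. LINT x|lborel. radvec G x $ i * cnj (\<gamma> x $ i)) = L2inner lborel (radvec G) \<gamma>"
  proof -
    have ii: "integrable lborel (\<lambda>x. radvec G x $ i \<bullet> \<gamma> x $ i)" for i
      using L2_integrable_inner[OF L2_nth[OF LV(2)] L2_nth[OF LU(2)]] .
    have "Re (\<Sum>i\<in>UNIV. LINT x|lborel. radvec G x $ i * cnj (\<gamma> x $ i)) = (\<Sum>i\<in>UNIV. LINT x|lborel. radvec G x $ i \<bullet> \<gamma> x $ i)"
      by (simp only: Re_sum Re_integral[OF i1] Re_cnj)
    also have "\<dots> = L2inner lborel (radvec G) \<gamma>"
      unfolding L2inner_def inner_vec_def using ii by simp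
    finally show ?thesis .
  qed
  have t2: "Re (complex_of_real \<omega> * (LINT x|lborel. V x * cnj (u x))) = \<omega> * L2inner lborel V u"
    by (simp only: Re_of_real_mult Re_integral[OF i2] Re_cnj L2inner_def)
  have t3: "Re (complex_of_real c * (LINT x|lborel. inverse ((norm x)\<^sup>2) *\<^sub>R (V x * cnj (u x))))
      = c * L2inner lborel (\<lambda>x. hprof G (norm x)) (\<lambda>x. inverse (norm x) *\<^sub>R u x)"
  proof -
    have "hprof G (norm x) \<bullet> (inverse (norm x) *\<^sub>R u x) = inverse ((norm x)\<^sup>2) * (V x \<bullet> u x)" for x
      by (simp add: hprof_def V_def power2_eq_square)
    then show ?thesis
      by (simp only: Re_of_real_mult Re_integral[OF i3] scaleR_complex.sel Re_cnj L2inner_def)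
  qed
  have t4: "Re (LINT x|lborel. (norm (V x) powr \<alpha>) *\<^sub>R (V x * cnj (u x))) = (LINT x|lborel. norm (V x) powr \<alpha> * (V x \<bullet> u x))"
    by (simp only: Re_integral[OF i4] scaleR_complex.sel Re_cnj)
  show "Re (energy_form c \<alpha> \<omega> V (radvec G) u \<gamma>) =
      L2inner lborel (radvec G) \<gamma> + \<omega> * L2inner lborel V u
      - c * L2inner lborel (\<lambda>x. hprof G (norm x)) (\<lambda>x. inverse (norm x) *\<^sub>R u x)
      - (LINT x|lborel. norm (V x) powr \<alpha> * (V x \<bullet> u x))"
    unfolding energy_form_def minus_complex.sel plus_complex.sel t1 t2 t3 t4 by simp
qed

lemma energy_form_profile:
  assumes dim: "n = CARD('n)" and G: "rp G"
  shows "Re (energy_form c \<alpha> \<omega> (\<lambda>x :: real ^ 'n. prof G (norm x)) (radvec G) (\<lambda>x. prof G (norm x)) (radvec G)) = E G - N G"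
proof -
  have n3: "CARD('n) \<ge> 3" and G': "rad_profile CARD('n) G" using n G dim by auto
  note [measurable] = rpD(4-6)[OF G]
  note W = weak_pair_profile[OF n3 G']
  have inner_sq: "L2inner M f f = L2sq M f" for M :: "(real ^ 'n) measure" and f :: "real ^ 'n \<Rightarrow> 'b::euclidean_space"
    by (simp add: L2inner_def L2sq_def power2_norm_eq_inner)
  have "norm z powr \<alpha> * (z \<bullet> z) = norm z powr (\<alpha> + 2)" for z :: complex
    by (simp add: powr_add power2_norm_eq_inner[symmetric])
  then have NG: "(LINT x|lborel. norm (prof G (norm (x :: real ^ 'n))) powr \<alpha> * (prof G (norm x) \<bullet> prof G (norm x))) = N G"
    using radial_integral(2)[of "\<lambda>r. norm (prof G r) powr (\<alpha> + 2)", where 'a="real^'n"] unfolding N_def by (simp add: dim)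
  show ?thesis
    unfolding energy_form_Re(2)[OF dim G W] NG hprof_def[symmetric] inner_sq E_def
    using radvec_L2(2)[of G, where 'n='n] rpD(1)[OF G] L2_radial_iff(2)[of "hprof G", where 'a="real^'n"]
      L2_radial_iff(2)[of "prof G", where 'a="real^'n"] by (simp add: dim)
qed

text \<open>Symmetric criticality: only the spherical averages of a test function enter the energy
  form of a radial function.\<close>

lemma energy_form_average:
  fixes u :: "real ^ 'n \<Rightarrow> complex"
  assumes dim: "n = CARD('n)" and G: "rp G" and U: "weak_pair u \<gamma>"
  defines "H \<equiv> sph_avg (radial_deriv \<gamma>)"
  shows "Re (energy_form c \<alpha> \<omega> (\<lambda>x :: real ^ 'n. prof G (norm x)) (radvec G) u \<gamma>) = B G H - R G H"
proof -
  have n3: "CARD('n) \<ge> 3" and G': "rad_profile CARD('n) G" using n G dim by auto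
  have LU: "L2 lborel u" "L2 lborel \<gamma>" using U by (auto simp: weak_pair_def)
  note LH = Hardy_inequality(1)[OF n3 U]
  note W = weak_pair_profile[OF n3 G']
  have LV: "L2 lborel (\<lambda>x :: real ^ 'n. prof G (norm x))" "L2 lborel (radvec G :: real ^ 'n \<Rightarrow> complex ^ 'n)"
    using W by (auto simp: weak_pair_def)
  have LhV: "L2 lborel (\<lambda>x :: real ^ 'n. hprof G (norm x))"
    using Hardy_inequality(1)[OF n3 W] by (simp add: hprof_def)
  note [measurable] = LU[THEN L2_measurable, unfolded measurable_lborel2] rpD(4-6)[OF G]
  note avg = sph_avg_weak_pair[OF n3 U, folded H_def dim]
  note [measurable] = rpD(4-6)[OF avg(2)]
  have ae: "(LINT r|\<mu>. f r \<bullet> sph_avg u r) = (LINT r|\<mu>. f r \<bullet> prof H r)"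
    if [measurable]: "f \<in> borel_measurable borel" for f :: "real \<Rightarrow> complex"
  proof (rule integral_cong_AE)
    show "AE r in \<mu>. f r \<bullet> sph_avg u r = f r \<bullet> prof H r" using avg(1) by eventually_elim simp
  qed (unfold measurable_radial, measurable)
  have t1: "L2inner lborel (radvec G) \<gamma> = L2inner \<mu> G H"
  proof -
    have Ld: "L2 lborel (radial_deriv \<gamma>)" by (rule radial_deriv_L2[OF LU(2)])
    have "integrable lborel (\<lambda>x :: real ^ 'n. radvec G x \<bullet> \<gamma> x)" by (rule L2_integrable_inner[OF LV(2) LU(2)])
    then have "integrable lborel (\<lambda>x :: real ^ 'n. G (norm x) \<bullet> radial_deriv \<gamma> x)"
      by (simp only: radvec_inner radial_deriv_def)
    from integral_radial_inner[OF _ Ld this] show ?thesis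
      by (simp add: L2inner_def radvec_inner radial_deriv_def[symmetric] H_def dim)
  qed
  have t2: "L2inner lborel (\<lambda>x :: real ^ 'n. prof G (norm x)) u = L2inner \<mu> (prof G) (prof H)"
    using integral_radial_inner[OF _ LU(1) L2_integrable_inner[OF LV(1) LU(1)]] ae[of "prof G"]
    by (simp add: L2inner_def dim)
  have t3: "L2inner lborel (\<lambda>x :: real ^ 'n. hprof G (norm x)) (\<lambda>x. inverse (norm x) *\<^sub>R u x) = L2inner \<mu> (hprof G) (hprof H)"
  proof -
    \<comment> \<open>Both factors 1/r are put on the radial side, so that the function being
      averaged is u itself, whose mean is known to be \<open>prof H\<close>.\<close>
    define a where "a r = inverse r *\<^sub>R hprof G r" for r
    have [measurable]: "a \<in> borel_measurable borel" unfolding a_def[abs_def] by measurable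
    have eq: "hprof G (norm x) \<bullet> (inverse (norm x) *\<^sub>R u x) = a (norm x) \<bullet> u x" for x :: "real ^ 'n"
      by (simp add: a_def)
    have "integrable lborel (\<lambda>x :: real ^ 'n. a (norm x) \<bullet> u x)"
      using L2_integrable_inner[OF LhV LH] unfolding eq .
    from integral_radial_inner[OF _ LU(1) this] ae[of a]
    have "(LINT x|lborel. a (norm x) \<bullet> u x) = (LINT r|\<mu>. a r \<bullet> prof H r)" by (simp add: dim)
    moreover have "a r \<bullet> prof H r = hprof G r \<bullet> hprof H r" for r by (simp add: a_def hprof_def)
    ultimately show ?thesis unfolding L2inner_def eq by simp
  qed
  have t4: "(LINT x|lborel. norm (prof G (norm (x :: real ^ 'n))) powr \<alpha> * (prof G (norm x) \<bullet> u x)) = R G H"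
  proof -
    define a where "a r = (norm (prof G r) powr \<alpha>) *\<^sub>R prof G r" for r
    have [measurable]: "a \<in> borel_measurable borel" unfolding a_def[abs_def] by measurable
    have eq: "norm (prof G (norm x)) powr \<alpha> * (prof G (norm x) \<bullet> u x) = a (norm x) \<bullet> u x" for x :: "real ^ 'n"
      by (simp add: a_def)
    have "integrable lborel (\<lambda>x :: real ^ 'n. a (norm x) \<bullet> u x)"
      using energy_form_Re(1)[OF dim G U] unfolding eq .
    from integral_radial_inner[OF _ LU(1) this] ae[of a]
    have "(LINT x|lborel. a (norm x) \<bullet> u x) = (LINT r|\<mu>. a r \<bullet> prof H r)" by (simp add: dim)
    then show ?thesis unfolding eq R_def by (simp add: a_def)
  qed
  show ?thesis
    unfolding energy_form_Re(2)[OF dim G U] t1 t2 t3 t4 B_def by simp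
qed

text \<open>Criticality among profiles suffices: an arbitrary test function enters the real part
  through its averaged profile, and applying this also to i times the test function removes the
  imaginary part.\<close>

lemma weak_solution_profile:
  fixes v :: "real ^ 'n \<Rightarrow> complex"
  assumes dim: "n = CARD('n)" and G: "rp G" and v: "AE x in lebesgue. v x = prof G (norm x)"
    and crit: "\<And>H. rp H \<Longrightarrow> B G H = R G H"
  shows "weak_solution c \<alpha> \<omega> v"
proof -
  have n3: "CARD('n) \<ge> 3" and G': "rad_profile CARD('n) G" using n G dim by auto
  let ?T = "energy_form c \<alpha> \<omega> (\<lambda>x :: real ^ 'n. prof G (norm x)) (radvec G)"
  have Re0: "Re (?T u \<gamma>) = 0" if U: "weak_pair u \<gamma>" for u \<gamma>
    using energy_form_average[OF dim G U] crit sph_avg_weak_pair(2)[OF n3 U] by (simp add: dim)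
  have "?T u \<gamma> = 0" if U: "weak_pair u \<gamma>" for u \<gamma>
  proof (rule complex_eqI)
    show "Re (?T u \<gamma>) = Re 0" using Re0[OF U] by simp
    show "Im (?T u \<gamma>) = Im 0"
      using Re0[OF weak_pair_cmult[OF U, of \<i>]] unfolding energy_form_cmult by simp
  qed
  then show ?thesis unfolding weak_solution_iff[OF weak_pair_profile[OF n3 G'] v] by blast
qed

lemma nehari_weak_solution:
  fixes v :: "real ^ 'n \<Rightarrow> complex"
  assumes dim: "n = CARD('n)" and G: "rp G" and v: "AE x in lebesgue. v x = prof G (norm x)"
    and S: "weak_solution c \<alpha> \<omega> v"
  shows "E G = N G"
proof -
  have n3: "CARD('n) \<ge> 3" and G': "rad_profile CARD('n) G" using n G dim by auto
  note W = weak_pair_profile[OF n3 G']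
  have "energy_form c \<alpha> \<omega> (\<lambda>x :: real ^ 'n. prof G (norm x)) (radvec G) (\<lambda>x. prof G (norm x)) (radvec G) = 0"
    using S W unfolding weak_solution_iff[OF W v] by blast
  then show ?thesis using energy_form_profile[OF dim G] by simp
qed

end

theorem proposition1p2:
  fixes c \<alpha> \<omega> :: real
  assumes "CARD('n::finite) \<ge> 3"
    and "c \<noteq> 0" and "c < ((real CARD('n) - 2) / 2)\<^sup>2"
    and "4 / real CARD('n) < \<alpha>" and "\<alpha> < 4 / (real CARD('n) - 2)"
    and "\<omega> > 0"
  shows "(\<forall>v \<in> (H1 :: (real ^ 'n \<Rightarrow> complex) set).
            (\<lambda>l::real. action c \<alpha> \<omega> (\<lambda>x. l *\<^sub>R v x)) differentiable (at 1) \<and>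
            nehari c \<alpha> \<omega> v =
              Hc_norm_sq c v + \<omega> * (Lp_norm 2 v)\<^sup>2 - Lp_norm (\<alpha> + 2) v powr (\<alpha> + 2))
       \<and> (G_rad c \<alpha> \<omega> :: (real ^ 'n \<Rightarrow> complex) set) \<noteq> {}
       \<and> (G_rad c \<alpha> \<omega> :: (real ^ 'n \<Rightarrow> complex) set) =
           {v \<in> H1_rad_nonzero. action c \<alpha> \<omega> v = d_rad TYPE('n) c \<alpha> \<omega> \<and> nehari c \<alpha> \<omega> v = 0}"
proof -
  interpret radial_variational "CARD('n)" c \<alpha> \<omega>
    by unfold_locales (use assms profile_Hardy[where 'n='n] in auto)
  note dim = refl[of "CARD('n)"]
  have \<alpha>0: "\<alpha> > 0" by (rule \<alpha>pos)
  \<comment> \<open>On the Nehari set E = N, so the action is this multiple of N. The factor is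
    positive because \<alpha> > 0, hence least action and least N are the same thing.\<close>
  let ?s = "\<lambda>N. (1 / 2 - 1 / (\<alpha> + 2)) * N"
  have half: "1 / 2 - 1 / (\<alpha> + 2) > 0" using \<alpha>0 by (simp add: field_simps)
  let ?X = "H1_rad_nonzero :: (real ^ 'n \<Rightarrow> complex) set"
  obtain d where d: "d > 0"
    "\<And>G. rp G \<Longrightarrow> N G > 0 \<Longrightarrow> E G = N G \<Longrightarrow> d \<le> N G"
    "\<exists>G. rp G \<and> E G = N G \<and> N G = d"
    "\<And>G H. rp G \<Longrightarrow> E G = N G \<Longrightarrow> N G = d \<Longrightarrow> rp H \<Longrightarrow> B G H = R G H"
    by (rule ground_level) (rule that)
  have prof_of: "\<exists>G. rp G \<and> (AE x in lebesgue. v x = prof G (norm x)) \<and> N G > 0" if v: "v \<in> ?X" for v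
  proof -
    obtain G where G: "rp G" "AE x in lebesgue. v x = prof G (norm x)"
      using H1_rad_obtain_profile[OF assms(1), of v] v by (auto simp: H1_rad_nonzero_def)
    have "N G \<noteq> 0" using profile_functionals(3)[OF dim G] v by (auto simp: H1_rad_nonzero_def)
    then have "N G > 0" using N_nonneg[of G] by linarith
    with G show ?thesis by blast
  qed
  have in_X: "v \<in> ?X" if "rp G" "AE x in lebesgue. v x = prof G (norm x)" "N G > 0" for v G
    using profile_in_H1_rad[OF assms(1) that(1,2)] profile_functionals(3)[OF dim that(1,2)] that(3)
    by (auto simp: H1_rad_nonzero_def)
  have act: "action c \<alpha> \<omega> v = ?s (N G)"
    if "rp G" "AE x in lebesgue. v x = prof G (norm x)" "E G = N G" for v :: "real ^ 'n \<Rightarrow> complex" and G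
    using profile_functionals(1)[OF dim that(1,2)] that(3) by (simp add: left_diff_distrib)
  have neh: "nehari c \<alpha> \<omega> v = 0 \<longleftrightarrow> E G = N G"
    if "rp G" "AE x in lebesgue. v x = prof G (norm x)" for v :: "real ^ 'n \<Rightarrow> complex" and G
    using profile_functionals(2)[OF dim that] by simp
  obtain G0 where G0: "rp G0" "E G0 = N G0" "N G0 = d" using d(3) by blast
  define v0 where "v0 x = prof G0 (norm x)" for x :: "real ^ 'n"
  have v0: "AE x in lebesgue. v0 x = prof G0 (norm x)" by (simp add: v0_def)
  have v0X: "v0 \<in> ?X" by (rule in_X[OF G0(1) v0]) (simp add: G0(3) d(1))
  have lower: "?s d \<le> action c \<alpha> \<omega> v" if v: "v \<in> ?X" "nehari c \<alpha> \<omega> v = 0" for v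
  proof -
    obtain G where G: "rp G" "AE x in lebesgue. v x = prof G (norm x)" "N G > 0" using prof_of[OF v(1)] by blast
    have EN: "E G = N G" using neh[OF G(1,2)] v(2) by simp
    show ?thesis unfolding act[OF G(1,2) EN] using d(2)[OF G(1,3) EN] half by (intro mult_left_mono) auto
  qed
  have drad: "d_rad TYPE('n) c \<alpha> \<omega> = ?s d"
    unfolding d_rad_def
  proof (rule cInf_eq_minimum)
    show "?s d \<in> {action c \<alpha> \<omega> v |v :: real ^ 'n \<Rightarrow> complex. v \<in> H1_rad_nonzero \<and> nehari c \<alpha> \<omega> v = 0}"
      using v0X neh[OF G0(1) v0] act[OF G0(1) v0 G0(2)] G0 by (auto intro!: exI[of _ v0])
  qed (use lower in auto)
  let ?M = "{v \<in> ?X. action c \<alpha> \<omega> v = d_rad TYPE('n) c \<alpha> \<omega> \<and> nehari c \<alpha> \<omega> v = 0}"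
  have v0M: "v0 \<in> ?M"
    using v0X neh[OF G0(1) v0] act[OF G0(1) v0 G0(2)] G0 drad by auto
  \<comment> \<open>The equation may be tested against v itself, which gives E = N for its
    profile.\<close>
  have A_nehari: "nehari c \<alpha> \<omega> v = 0" if v: "v \<in> A_rad c \<alpha> \<omega>" for v :: "real ^ 'n \<Rightarrow> complex"
  proof -
    obtain G where G: "rp G" "AE x in lebesgue. v x = prof G (norm x)"
      using prof_of[of v] v by (auto simp: A_rad_def)
    from nehari_weak_solution[OF dim G] v neh[OF G] show ?thesis by (auto simp: A_rad_def)
  qed
  \<comment> \<open>The Nehari constraint is natural: a minimizer on it has N = d, and at that level
    the Euler-Lagrange equation holds with multiplier 1.\<close>
  have M_A: "v \<in> A_rad c \<alpha> \<omega>" if v: "v \<in> ?M" for v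
  proof -
    obtain G where G: "rp G" "AE x in lebesgue. v x = prof G (norm x)" "N G > 0"
      using prof_of[of v] v by auto
    have EN: "E G = N G" using neh[OF G(1,2)] v by simp
    have "?s (N G) = ?s d" using act[OF G(1,2) EN] v drad by simp
    then have Nd: "N G = d" using half mult_cancel_left[of "1 / 2 - 1 / (\<alpha> + 2)" "N G" d] by linarith
    have "weak_solution c \<alpha> \<omega> v"
      by (rule weak_solution_profile[OF dim G(1,2) d(4)[OF G(1) EN Nd]])
    then show ?thesis using v by (simp add: A_rad_def)
  qed
  have MG: "(G_rad c \<alpha> \<omega> :: (real ^ 'n \<Rightarrow> complex) set) = ?M"
  proof
    show "?M \<subseteq> G_rad c \<alpha> \<omega>"
    proof
      fix v assume v: "v \<in> ?M"
      have "action c \<alpha> \<omega> v \<le> action c \<alpha> \<omega> u" if u: "u \<in> A_rad c \<alpha> \<omega>" for u :: "real ^ 'n \<Rightarrow> complex"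
        using lower[of u] A_nehari[OF u] u v drad by (auto simp: A_rad_def)
      then show "v \<in> G_rad c \<alpha> \<omega>" using M_A[OF v] by (simp add: G_rad_def)
    qed
    \<comment> \<open>Since \<open>v0\<close> is itself a weak solution, a ground state has action
      at most that of \<open>v0\<close>, which is the infimum; as a weak solution it lies in the
      Nehari set, so its action is also at least the infimum.\<close>
    show "G_rad c \<alpha> \<omega> \<subseteq> ?M"
    proof
      fix v :: "real ^ 'n \<Rightarrow> complex" assume v: "v \<in> G_rad c \<alpha> \<omega>"
      then have vA: "v \<in> A_rad c \<alpha> \<omega>" by (simp add: G_rad_def)
      then have vX: "v \<in> ?X" by (simp add: A_rad_def)
      have "action c \<alpha> \<omega> v \<le> action c \<alpha> \<omega> v0" using v M_A[OF v0M] by (simp add: G_rad_def)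
      then have "action c \<alpha> \<omega> v = d_rad TYPE('n) c \<alpha> \<omega>"
        using v0M lower[OF vX A_nehari[OF vA]] drad by auto
      then show "v \<in> ?M" using vX A_nehari[OF vA] by simp
    qed
  qed
  show ?thesis
  proof (intro conjI ballI)
    fix v :: "real ^ 'n \<Rightarrow> complex" assume v: "v \<in> H1"
    show "(\<lambda>l::real. action c \<alpha> \<omega> (\<lambda>x. l *\<^sub>R v x)) differentiable (at 1)"
      using action_has_derivative[OF v \<alpha>0] unfolding real_differentiable_def by blast
    show "nehari c \<alpha> \<omega> v = Hc_norm_sq c v + \<omega> * (Lp_norm 2 v)\<^sup>2 - Lp_norm (\<alpha> + 2) v powr (\<alpha> + 2)"
      by (rule nehari_eq[OF v \<alpha>0])
  next
    show "(G_rad c \<alpha> \<omega> :: (real ^ 'n \<Rightarrow> complex) set) \<noteq> {}" using v0M MG by blast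
  qed (rule MG)
qed

end
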